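(* Suppose that $K(x)=\int_x^\infty P(N>u)\,du$ is of dominated variation, i.e. $K\in\mathcal D$. Then there is no absolutely continuous exact $\phi$-Hausdorff measure for $\partial\mathbf T$ with $\phi\in\Phi$. More precisely, let $\phi\in\Phi$ with $\phi(t)=t^\alpha g(|\log t|)$, $g\in\mathcal G$, let $\Delta=\{\mathbf i\in\partial\mathbf T:\lim_{n\to\infty}W_{\mathbf i|n}/g(n)=0\}$, and let $\Delta'$ be an arbitrary Borel set in $\partial\mathbf T$ with $\mu(\Delta')=0$ a.s. Then: (i) If $\sum_{n=0}^\infty K(g(n))<\infty$, then $\phi\text{-}H(\partial\mathbf T\setminus\Delta')=\phi\text{-}H(\partial\mathbf T)=\infty$ a.s. on $\{\partial\mathbf T\ne\varnothing\}$. (ii) If $\sum_{n=0}^\infty K(g(n))=\infty$, then $\phi\text{-}H(\partial\mathbf T\setminus\Delta)=0$ and $\mu(\Delta)=0$ a.s. (iii) If $\sum_{n=0}^\infty K(g(n))=\infty$ and $$\limsup_{\delta\to0+}\ \limsup_{n\to\infty}\ \frac{\sum_{k=0}^nK(\delta g(k))}{\log(g(n)\vee e)}=\infty,$$ then $\phi\text{-}H(\partial\mathbf T)=0$ a.s.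
   Context: Words and metric: $\mathbb Z_+=\{0,1,2,\dots\}$, $\mathbb R_+=[0,\infty)$, $\mathbf U=\bigcup_{n\ge0}\mathbb Z_+^n$ (finite words, with $\mathbb Z_+^0$ consisting of the empty word $\varnothing$), $\mathbf I=\mathbb Z_+^{\mathbb N}$ (infinite words). $|\mathbf i|$ is the length of $\mathbf i$, $\mathbf i|n$ its prefix of length $n$, $\mathbf i*\mathbf j$ is concatenation, $\mathbf i\le\mathbf j$ means $\mathbf i$ is a prefix of $\mathbf j$, $\mathbf i\wedge\mathbf j$ is the longest common prefix. $\mathbf I$ has the ultrametric $d(\mathbf i,\mathbf j)=e^{-|\mathbf i\wedge\mathbf j|}$ and Borel $\sigma$-algebra $\mathcal B(\mathbf I)$. For $\mathbf i\in\mathbf U$, $B_{\mathbf i}=\{\mathbf j\in\mathbf I:\mathbf i\le\mathbf j\}$. $x\vee y=\max(x,y)$. Tree: $\{N_{\mathbf i}\}_{\mathbf i\in\mathbf U}$ are i.i.d. $\mathbb Z_+$-valued random variables on $(\Omega,\mathcal F,P)$, $N:=N_\varnothing$, $p_n=P(N=n)$. Standing assumptions: the distribution of $N$ is not concentrated at one point, $a:=E(N)>1$, $E(N\log N)<\infty$. $\alpha:=\log a$. The Galton–Watson tree $\mathbf T\subset\mathbf U$ is the random set with $\varnothing\in\mathbf T$; for $\mathbf i\in\mathbf T$, $i\in\mathbb Z_+$: $\mathbf i*i\in\mathbf T$ iff $0\le i\le N_{\mathbf i}-1$; prefixes of elements of $\mathbf T$ are in $\mathbf T$. Boundary: $\partial\mathbf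 T=\{\mathbf i\in\mathbf I:\mathbf i|n\in\mathbf T\ \forall n\}$. For $\mathbf i\in\mathbf U$, $\mathbf T_{\mathbf i}$ is the tree with $\varnothing\in\mathbf T_{\mathbf i}$ and, for $\mathbf j\in\mathbf T_{\mathbf i}$, $\mathbf j*i\in\mathbf T_{\mathbf i}$ iff $0\le i\le N_{\mathbf i*\mathbf j}-1$; $W_{\mathbf i}=\lim_n a^{-n}\mathrm{Card}\{\mathbf j\in\mathbf T_{\mathbf i}:|\mathbf j|=n\}$ (exists a.s.). The branching measure $\mu=\mu_\omega$ is the finite Borel measure on $\mathbf I$ with $\mu(B_{\mathbf i})=a^{-|\mathbf i|}W_{\mathbf i}$ for $\mathbf i\in\mathbf T$ and $\mu(B_{\mathbf i})=0$ for $\mathbf i\in\mathbf U\setminus\mathbf T$. Dominated variation: a nonnegative decreasing (in the wide sense) function $h$ on $\mathbb R_+$ is in $\mathcal D$ if $h(x)>0$ for $x>0$ and $\liminf_{x\to\infty}h(2x)/h(x)>0$. Gauge functions: $\mathcal G$ is the set of functions $g>0$ on $\mathbb R_+$ with $\limsup_{n\to\infty}g(n+1)/g(n)<a$ ($n$ integer). $\Phi$ is the set of functions $\phi(t)=t^\alpha g(|\log t|)$ on $(0,\infty)$ with $g\in\mathcal G$, such that $\phi$ is positive and increasing (in the wide sense) on $(0,\delta_1)$ for some $\delta_1>0$ and $\phi(0):=\phi(0+)=0$. Hausdorff measure: for a Borel set $E\subset\mathbf I$, $\phi\text{-}H(E)=\lim_{\delta\to0+}\inf\{\sum_{n\ge1}\phi(|D_n|):E\subset\bigcup_nD_n,\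 D_n\in\mathcal B(\mathbf I),\ |D_n|\le\delta\}$, $|D|$ denoting diameter. $\phi$-$H$ is an exact Hausdorff measure for $\partial\mathbf T$ if $0<\phi\text{-}H(\partial\mathbf T)<\infty$ a.s. on $\{\partial\mathbf T\ne\varnothing\}$. It is absolutely continuous if, almost surely, $\phi\text{-}H(A)=0$ whenever $A\subset\partial\mathbf T$ is Borel with $\mu(A)=0$. (Since $\partial\mathbf T$ is random, Borel sets in $\partial\mathbf T$ may depend on $\omega$.) *)

theory Defs
  imports "HOL-Probability.Probability"
begin

section \<open>Infinite words as an ultrametric space\<close>

text \<open>Finite words are of type \<open>nat list\<close>, infinite words of type \<open>nat stream\<close>.  The metric
  below makes \<^const>\<open>borel\<close> and \<^const>\<open>diameter\<close> available on infinite words.\<close>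

text \<open>For \<open>x \<noteq> y\<close> this is the length of the longest common prefix; for \<open>x = y\<close> there is no greatest
  element and the value is irrelevant.\<close>
definition common_prefix_length :: "'a stream \<Rightarrow> 'a stream \<Rightarrow> nat" where
  "common_prefix_length x y = (GREATEST n. stake n x = stake n y)"

lemma stake_eq_iff_common_prefix_length:
  assumes "x \<noteq> y"
  shows "stake n x = stake n y \<longleftrightarrow> n \<le> common_prefix_length x y"
proof -
  have "\<exists>m. x !! m \<noteq> y !! m"
  proof (rule ccontr)
    assume "\<nexists>m. x !! m \<noteq> y !! m"
    then have "smap (\<lambda>s. s) x = y"
      unfolding smap_alt by simp
    with assms show False
      by (simp add: stream.map_ident)
  qed
  then obtain m where m: "x !! m \<noteq> y !! m" by blast
  have bd: "k \<le> m" if "stake k x = stake k y" for k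
    using m that by (metis not_le_imp_less stake_nth)
  have "stake (common_prefix_length x y) x = stake (common_prefix_length x y) y"
    unfolding common_prefix_length_def
    by (rule GreatestI_nat[where k = 0 and b = m]) (auto intro: bd)
  moreover have "k \<le> common_prefix_length x y" if "stake k x = stake k y" for k
    unfolding common_prefix_length_def
    by (rule Greatest_le_nat[where b = m]) (use that in \<open>auto intro: bd\<close>)
  moreover have "stake k x = stake k y" if "k \<le> l" "stake l x = stake l y" for k l
  proof -
    have "take k (stake l x) = take k (stake l y)"
      using that(2) by simp
    then show ?thesis
      using that(1) by (simp add: take_stake min_def split: if_splits)
  qed
  ultimately show ?thesis
    by blast
qed

instantiation stream :: (type) metric_space
begin

definition dist_stream :: "'a stream \<Rightarrow> 'a stream \<Rightarrow> real" where
  "dist_stream x y = (if x = y then 0 else exp (- real (common_prefix_length x y)))"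

definition uniformity_stream :: "('a stream \<times> 'a stream) filter" where
  "uniformity_stream = (INF e\<in>{0<..}. principal {(x, y). dist x y < e})"

definition open_stream :: "'a stream set \<Rightarrow> bool" where
  "open_stream U \<longleftrightarrow> (\<forall>x\<in>U. \<forall>\<^sub>F (x', y) in uniformity. x' = x \<longrightarrow> y \<in> U)"

instance
proof
  fix x y z :: "'a stream"
  show "dist x y = 0 \<longleftrightarrow> x = y"
    by (simp add: dist_stream_def)
  show "dist x y \<le> dist x z + dist y z"
  proof (cases "x = y \<or> x = z \<or> y = z")
    case True
    moreover have "common_prefix_length z y = common_prefix_length y z"
      unfolding common_prefix_length_def by (rule arg_cong[where f = Greatest]) auto
    ultimately show ?thesis
      by (auto simp: dist_stream_def)
  next
    case False
    define k where "k = min (common_prefix_length x z) (common_prefix_length y z)"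
    have "stake k x = stake k z" "stake k y = stake k z"
      using False by (auto simp: k_def stake_eq_iff_common_prefix_length)
    then have "k \<le> common_prefix_length x y"
      using False by (simp flip: stake_eq_iff_common_prefix_length)
    then have "dist x y \<le> exp (- real k)"
      using False by (simp add: dist_stream_def)
    also have "\<dots> \<le> dist x z + dist y z"
      using False by (auto simp: dist_stream_def k_def min_def)
    finally show ?thesis .
  qed
qed (simp_all only: uniformity_stream_def open_stream_def)

end

definition cylinder :: "nat list \<Rightarrow> nat stream set" where
  "cylinder i = {x. stake (length i) x = i}"


section \<open>Galton--Watson trees\<close>

text \<open>The tree determined by a fixed family \<open>\<nu>\<close> of offspring numbers.\<close>
inductive_set tree :: "(nat list \<Rightarrow> nat) \<Rightarrow> nat list set" for \<nu> :: "nat list \<Rightarrow> nat" where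
  root: "[] \<in> tree \<nu>"
| child: "i \<in> tree \<nu> \<Longrightarrow> k < \<nu> i \<Longrightarrow> i @ [k] \<in> tree \<nu>"

text \<open>If \<open>N\<close> were not integrable, its Bochner integral would be 0; so \<open>mean\<close> contains
  \<open>E(N) < \<infinity>\<close>.  Since \<open>ln 0 = 0\<close>, \<open>log_moment\<close> uses the convention \<open>0 log 0 = 0\<close>.\<close>
locale galton_watson = prob_space M
  for M :: "'w measure" +
  fixes N :: "nat list \<Rightarrow> 'w \<Rightarrow> nat"
  assumes indep: "indep_vars (\<lambda>_. count_space UNIV) N UNIV"
    and ident: "\<And>i. distr M (count_space UNIV) (N i) = distr M (count_space UNIV) (N [])"
    and nondegenerate: "\<And>n. prob {\<omega> \<in> space M. N [] \<omega> = n} \<noteq> 1"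
    and mean: "expectation (\<lambda>\<omega>. real (N [] \<omega>)) > 1"
    and log_moment: "integrable M (\<lambda>\<omega>. real (N [] \<omega>) * ln (real (N [] \<omega>)))"

definition offspring_mean :: "'w measure \<Rightarrow> (nat list \<Rightarrow> 'w \<Rightarrow> nat) \<Rightarrow> real" where
  "offspring_mean M N = (LINT \<omega>|M. real (N [] \<omega>))"

definition gw_tree :: "(nat list \<Rightarrow> 'w \<Rightarrow> nat) \<Rightarrow> nat list \<Rightarrow> 'w \<Rightarrow> nat list set" where
  "gw_tree N i \<omega> = tree (\<lambda>j. N (i @ j) \<omega>)"

definition boundary :: "(nat list \<Rightarrow> 'w \<Rightarrow> nat) \<Rightarrow> 'w \<Rightarrow> nat stream set" where
  "boundary N \<omega> = {x. \<forall>n. stake n x \<in> gw_tree N [] \<omega>}"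

definition limit_W :: "'w measure \<Rightarrow> (nat list \<Rightarrow> 'w \<Rightarrow> nat) \<Rightarrow> nat list \<Rightarrow> 'w \<Rightarrow> real" where
  "limit_W M N i \<omega> =
     lim (\<lambda>n. real (card {j \<in> gw_tree N i \<omega>. length j = n}) / offspring_mean M N ^ n)"

text \<open>The cylinders form an intersection-stable generator, so there is at most one such measure;
  it exists for almost every \<open>\<omega>\<close>.\<close>
definition branching_measure ::
    "'w measure \<Rightarrow> (nat list \<Rightarrow> 'w \<Rightarrow> nat) \<Rightarrow> 'w \<Rightarrow> nat stream measure" where
  "branching_measure M N \<omega> =
     (THE \<mu>. finite_measure \<mu> \<and> sets \<mu> = sets borel \<and>
        (\<forall>i. emeasure \<mu> (cylinder i) =
           (if i \<in> gw_tree N [] \<omega>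
            then ennreal (limit_W M N i \<omega> / offspring_mean M N ^ length i) else 0)))"

definition integrated_tail :: "'w measure \<Rightarrow> (nat list \<Rightarrow> 'w \<Rightarrow> nat) \<Rightarrow> real \<Rightarrow> real" where
  "integrated_tail M N x =
     (LINT u:{x..}|lborel. measure M {\<omega> \<in> space M. real (N [] \<omega>) > u})"


section \<open>Dominated variation and gauge functions\<close>

text \<open>Functions on \<open>[0, \<infinity>)\<close> are represented by functions on all reals whose values at negative
  arguments are irrelevant.\<close>

definition dominated_variation :: "(real \<Rightarrow> real) \<Rightarrow> bool" where
  "dominated_variation h \<longleftrightarrow>
     (\<forall>x\<ge>0. h x \<ge> 0) \<and> antimono_on {0..} h \<and> (\<forall>x>0. h x > 0) \<and>
     Liminf at_top (\<lambda>x. ereal (h (2 * x) / h x)) > 0"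

definition class_G :: "real \<Rightarrow> (real \<Rightarrow> real) set" where
  "class_G a = {g. (\<forall>x\<ge>0. g x > 0) \<and>
     limsup (\<lambda>n. ereal (g (real (Suc n)) / g (real n))) < ereal a}"

text \<open>\<open>gauge_rep a g \<phi>\<close>: \<open>\<phi>\<close> is the gauge function \<open>t\<^sup>\<alpha> g(|log t|)\<close> with \<open>\<alpha> = log a\<close>.\<close>
definition gauge_rep :: "real \<Rightarrow> (real \<Rightarrow> real) \<Rightarrow> (real \<Rightarrow> real) \<Rightarrow> bool" where
  "gauge_rep a g \<phi> \<longleftrightarrow>
     g \<in> class_G a \<and>
     (\<forall>t>0. \<phi> t = t powr (ln a) * g \<bar>ln t\<bar>) \<and>
     (\<exists>\<delta>>0. (\<forall>t\<in>{0<..<\<delta>}. \<phi> t > 0) \<and> mono_on {0<..<\<delta>} \<phi>) \<and>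
     \<phi> 0 = 0 \<and> (\<phi> \<longlongrightarrow> 0) (at_right 0)"

definition class_Phi :: "real \<Rightarrow> (real \<Rightarrow> real) set" where
  "class_Phi a = {\<phi>. \<exists>g. gauge_rep a g \<phi>}"


section \<open>Hausdorff measures\<close>

definition hausdorff_pre :: "(real \<Rightarrow> real) \<Rightarrow> real \<Rightarrow> nat stream set \<Rightarrow> ennreal" where
  "hausdorff_pre \<phi> \<delta> E =
     Inf {\<Sum>n. ennreal (\<phi> (diameter (D n))) | D :: nat \<Rightarrow> nat stream set.
       E \<subseteq> (\<Union>n. D n) \<and> (\<forall>n. D n \<in> sets borel \<and> diameter (D n) \<le> \<delta>)}"

text \<open>The limit always exists, since \<open>hausdorff_pre \<phi> \<delta> E\<close> is decreasing in \<open>\<delta>\<close>.\<close>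
definition hausdorff :: "(real \<Rightarrow> real) \<Rightarrow> nat stream set \<Rightarrow> ennreal" where
  "hausdorff \<phi> E = Lim (at_right 0) (\<lambda>\<delta>. hausdorff_pre \<phi> \<delta> E)"

definition exact_hausdorff ::
    "'w measure \<Rightarrow> (nat list \<Rightarrow> 'w \<Rightarrow> nat) \<Rightarrow> (real \<Rightarrow> real) \<Rightarrow> bool" where
  "exact_hausdorff M N \<phi> \<longleftrightarrow>
     (AE \<omega> in M. boundary N \<omega> \<noteq> {} \<longrightarrow>
        0 < hausdorff \<phi> (boundary N \<omega>) \<and> hausdorff \<phi> (boundary N \<omega>) < \<infinity>)"

definition abs_continuous_hausdorff ::
    "'w measure \<Rightarrow> (nat list \<Rightarrow> 'w \<Rightarrow> nat) \<Rightarrow> (real \<Rightarrow> real) \<Rightarrow> bool" where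
  "abs_continuous_hausdorff M N \<phi> \<longleftrightarrow>
     (AE \<omega> in M. \<forall>A \<in> sets borel. A \<subseteq> boundary N \<omega> \<longrightarrow>
        emeasure (branching_measure M N \<omega>) A = 0 \<longrightarrow> hausdorff \<phi> A = 0)"

text \<open>The exceptional set \<open>\<Delta>\<close>; it is Borel for every \<open>\<omega>\<close>, because for each \<open>n\<close> the conditions
  involve \<open>x\<close> only through \<open>stake n x\<close>.\<close>
definition exceptional_set ::
    "'w measure \<Rightarrow> (nat list \<Rightarrow> 'w \<Rightarrow> nat) \<Rightarrow> (real \<Rightarrow> real) \<Rightarrow> 'w \<Rightarrow> nat stream set" where
  "exceptional_set M N g \<omega> =
     {x \<in> boundary N \<omega>. (\<lambda>n. limit_W M N (stake n x) \<omega> / g (real n)) \<longlonglongrightarrow> 0}"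

end

theory Submission
  imports Defs
begin

text \<open>
  Along a word \<open>x\<close> of the boundary, \<open>W\<^sub>n\<close>, the limit \<open>W\<close> of the subtree at the \<open>n\<close>th prefix, satisfies
  \<open>W\<^sub>n = (S\<^sub>n + W\<^sub>n\<^sub>+\<^sub>1) / a\<close>, where \<open>S\<^sub>n\<close> adds up \<open>W\<close> over the siblings of the next vertex. If \<open>x\<close> is chosen
  according to the branching measure, the \<open>S\<^sub>n\<close> become independent and identically distributed, with
  \<open>P(S\<^sub>n > t)\<close> comparable to \<open>K t\<close>. From below, this holds because bounded independent variables concentrate
  around their mean. From above, one removes the trees with more than \<open>a\<^sup>k y\<close> children at some vertex of level
  \<open>k\<close>, which costs at most a multiple of \<open>K y\<close>, and estimates exponential moments of the rest; dominated
  variation absorbs the changes of scale. The two Borel--Cantelli lemmas then show that \<open>W\<^sub>n / g n\<close> tends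
  to \<open>0\<close>, or has upper limit \<open>\<infinity>\<close>, almost everywhere, according as \<open>\<Sum> K (g n)\<close> converges or
  diverges. Since \<open>W\<^sub>n / g n\<close> is the ratio of the mass of a cylinder to its gauge, density theorems for
  Hausdorff measures give the first two assertions, and with them the absence of an exact measure. For the third,
  the set where \<open>W\<^sub>n / g n\<close> tends to \<open>0\<close> is covered by the cylinders of level \<open>n\<close> along which all
  \<open>S\<^sub>k\<close> with \<open>k < n\<close> are small; their expected cost is \<open>g n\<close> times the product of the probabilities that
  \<open>S\<^sub>k\<close> is small, at most \<open>g n * exp (- c * (\<Sum>k<n. K (\<delta> * g k)))\<close> up to a constant.\<close>

section \<open>Doob's upcrossing argument\<close>

section \<open>Convergence of nonnegative supermartingales\<close>

text \<open>A sibling sum is large because the parent, or one vertex of a sibling's tree, has very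
  many children; everything else is controlled by exponential moments of trees truncated at a
  threshold that grows with the generation. The functional \<open>R\<close> stands in for the
  size-biased law of a tree with a marked path: it is a sum over one generation, its expectation
  factors over the levels (\<open>nn_integral_R\<close>), and for a fixed tree it is the mass of a
  set of paths if \<open>f\<close> is \<open>W\<close>, and a number of words divided by
  \<open>a ^ n\<close> if \<open>f\<close> is 1. Independence of the sibling sums thus enters
  through products of the numbers \<open>keep B\<close>, and the divergent half of Borel-Cantelli is
  a product that tends to 0. From sibling sums to \<open>W\<close>, one direction is immediate: a
  large sum forces a large \<open>W\<close>. Conversely, small sums make \<open>W\<close> small
  because the recursion contracts relative to \<open>g\<close>, whose growth factor is below
  \<open>a\<close>. Random exceptional sets are handled by statements about almost every tree that
  hold for all null sets at once.\<close>

context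
  fixes X :: "nat \<Rightarrow> 'a \<Rightarrow> real" and a b :: real
begin

text \<open>Doob's trading strategy. Whether the increment from time \<open>n\<close> to
  \<open>n + 1\<close> is collected depends on \<open>X\<close> up to time \<open>n\<close> only, so
  the supermartingale property applies to each increment.\<close>

fun holding :: "nat \<Rightarrow> 'a \<Rightarrow> bool" where
  "holding 0 x \<longleftrightarrow> X 0 x < a"
| "holding (Suc n) x \<longleftrightarrow> (if holding n x then X (Suc n) x \<le> b else X (Suc n) x < a)"

fun upcrossings :: "nat \<Rightarrow> 'a \<Rightarrow> nat" where
  "upcrossings 0 x = 0"
| "upcrossings (Suc n) x = upcrossings n x + (if holding n x \<and> b < X (Suc n) x then 1 else 0)"

definition gain :: "nat \<Rightarrow> 'a \<Rightarrow> real" where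
  "gain n x = (\<Sum>k<n. if holding k x then X (Suc k) x - X k x else 0)"

text \<open>Each completed round trip earns at least \<open>b - a\<close>. A position that is still
  open was bought below \<open>a\<close> and is worth at least 0, so it can lose at most
  \<open>a\<close>.\<close>

lemma gain_ge_upcrossings:
  assumes "a < b" "\<And>n. X n x \<ge> 0" "a \<ge> 0"
  shows "gain n x \<ge> (b - a) * upcrossings n x - a"
proof -
  \<comment> \<open>While a position is open, its current value \<open>X n x\<close> enters the
    invariant; nonnegativity removes it at the end.\<close>
  have "if holding n x then gain n x \<ge> (b - a) * upcrossings n x + X n x - a
        else gain n x \<ge> (b - a) * upcrossings n x"
  proof (induction n)
    case 0
    then show ?case by (simp add: gain_def)
  next
    case (Suc n)
    have "gain (Suc n) x = gain n x + (if holding n x then X (Suc n) x - X n x else 0)"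
      by (simp add: gain_def)
    with Suc assms(1) show ?case
      by (auto simp: algebra_simps split: if_splits)
  qed
  with assms(2)[of n] assms(3) show ?thesis
    by (auto split: if_splits)
qed

lemma mono_upcrossings: "mono (\<lambda>n. upcrossings n x)"
  by (simp add: mono_iff_le_Suc)

text \<open>Whenever \<open>X\<close> is below \<open>a\<close> the position is held, and the first
  later exceedance of \<open>b\<close> completes one more upcrossing.\<close>

lemma upcrossings_unbounded:
  assumes "a < b" "\<exists>\<^sub>F n in sequentially. X n x < a" "\<exists>\<^sub>F n in sequentially. b < X n x"
  shows "\<exists>n. m \<le> upcrossings n x"
proof (induction m)
  case (Suc m)
  then obtain n where n: "m \<le> upcrossings n x" by blast
  obtain n1 where n1: "n1 \<ge> n" "X n1 x < a"
    using assms(2) by (auto simp: frequently_sequentially)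
  obtain n' where n': "n' \<ge> n1" "b < X n' x"
    using assms(3) by (auto simp: frequently_sequentially)
  have "holding n1 x"
    using n1(2) assms(1) by (cases n1) auto
  have ex: "\<exists>k. n1 \<le> k \<and> b < X k x" using n' by blast
  define n2 where "n2 = (LEAST k. n1 \<le> k \<and> b < X k x)"
  have n2: "n1 \<le> n2" "b < X n2 x"
    using LeastI_ex[OF ex] by (auto simp: n2_def)
  have small: "X k x \<le> b" if "n1 \<le> k" "k < n2" for k
    using not_less_Least[of k "\<lambda>k. n1 \<le> k \<and> b < X k x"] that by (auto simp: n2_def not_less)
  have "n1 \<noteq> n2" using n2(2) n1(2) assms(1) by auto
  with n2(1) have lt: "n1 < n2" by simp
  have H: "holding k x" if "n1 \<le> k" "k < n2" for k
    using that
  proof (induction k rule: dec_induct)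
    case base
    show ?case by fact
  next
    case (step k)
    then show ?case using small[of "Suc k"] by simp
  qed
  obtain k where k: "n2 = Suc k" using lt by (cases n2) auto
  have "upcrossings n2 x = Suc (upcrossings k x)"
    using H[of k] lt n2(2) by (simp add: k)
  moreover have "upcrossings n x \<le> upcrossings k x"
    using n1(1) lt k by (intro monoD[OF mono_upcrossings]) auto
  ultimately have "Suc m \<le> upcrossings n2 x" using n by simp
  then show ?case by blast
qed simp

lemma holding_cong: "(\<And>k. k \<le> n \<Longrightarrow> X k x = X k y) \<Longrightarrow> holding n x = holding n y"
  by (induction n) auto

end

text \<open>If liminf and limsup differed, two rationals could be fitted between them. The
  assumption \<open>bounded\<close> excludes divergence to infinity, where no crossing
  occurs.\<close>

lemma convergent_if_no_upcrossing:
  fixes X :: "nat \<Rightarrow> real"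
  assumes nonneg: "\<And>n. X n \<ge> 0"
    and cross: "\<And>a b. a \<in> \<rat> \<Longrightarrow> b \<in> \<rat> \<Longrightarrow> 0 \<le> a \<Longrightarrow> a < b \<Longrightarrow>
      \<not> ((\<exists>\<^sub>F n in sequentially. X n < a) \<and> (\<exists>\<^sub>F n in sequentially. b < X n))"
    and bounded: "\<exists>\<^sub>F n in sequentially. X n < C"
  shows "convergent X"
proof -
  let ?l = "liminf (\<lambda>n. ereal (X n))" and ?u = "limsup (\<lambda>n. ereal (X n))"
  have fin: "?l < \<infinity>"
  proof (rule ccontr)
    assume "\<not> ?l < \<infinity>"
    then have "ereal C < ?l" by simp
    then have "\<forall>\<^sub>F n in sequentially. ereal C < ereal (X n)" by (rule less_LiminfD)
    then have "\<forall>\<^sub>F n in sequentially. \<not> X n < C" by (rule eventually_mono) simp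
    with bounded show False by (simp add: frequently_def)
  qed
  have l0: "0 \<le> ?l"
    by (rule Liminf_bounded) (use nonneg in auto)
  have le: "?l \<le> ?u" by (rule Liminf_le_Limsup) simp
  have "?l = ?u"
  proof (rule ccontr)
    assume "?l \<noteq> ?u"
    then have lt: "?l < ?u" using le by simp
    obtain l where l: "?l = ereal l" "l \<ge> 0" using l0 fin by (cases ?l) auto
    have "\<exists>r. l < r \<and> ereal r < ?u"
      using lt l by (metis ereal_dense2 ereal_less_eq(3) less_ereal.simps(1))
    then obtain r where r: "l < r" "ereal r < ?u" by blast
    obtain b where b: "b \<in> \<rat>" "l < b" "b < r" using Rats_dense_in_real[OF r(1)] by blast
    obtain a where a: "a \<in> \<rat>" "l < a" "a < b" using Rats_dense_in_real[OF b(2)] by blast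
    have "\<exists>\<^sub>F n in sequentially. X n < a"
    proof (rule ccontr)
      assume "\<not> ?thesis"
      then have "\<forall>\<^sub>F n in sequentially. ereal a \<le> ereal (X n)"
        by (simp add: frequently_def not_less)
      then have "ereal a \<le> ?l" by (rule Liminf_bounded)
      then show False using a l by simp
    qed
    moreover have "\<exists>\<^sub>F n in sequentially. b < X n"
    proof (rule ccontr)
      assume "\<not> ?thesis"
      then have "\<forall>\<^sub>F n in sequentially. ereal (X n) \<le> ereal b"
        by (simp add: frequently_def not_less)
      then have "?u \<le> ereal b" by (rule Limsup_bounded)
      then show False using b r by (metis ereal_less_eq(3) le_less_trans less_le_not_le linorder_not_less order_less_imp_le)
    qed
    ultimately show False using cross[of a b] a b l by auto
  qed
  moreover obtain l where l: "?l = ereal l" using l0 fin by (cases ?l) auto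
  ultimately have "(\<lambda>n. ereal (X n)) \<longlonglongrightarrow> ereal l"
    by (simp add: tendsto_iff_Liminf_eq_Limsup)
  then show ?thesis by (auto simp: convergent_def)
qed

text \<open>The supermartingale property is tested on events that are unions of level sets of
  \<open>X 0, ..., X n\<close>; the events \<open>holding n\<close> are of this kind, and for trees
  the property can be checked by resampling single offspring numbers.\<close>

theorem (in prob_space) nonneg_supermartingale_convergent:
  fixes X :: "nat \<Rightarrow> 'a \<Rightarrow> real"
  assumes X[measurable]: "\<And>n. random_variable borel (X n)"
    and nonneg: "\<And>n x. X n x \<ge> 0"
    and int0: "integrable M (X 0)"
    and super: "\<And>n A. A \<in> events \<Longrightarrow>
      (\<And>x y. x \<in> A \<Longrightarrow> y \<in> space M \<Longrightarrow> (\<And>k. k \<le> n \<Longrightarrow> X k x = X k y) \<Longrightarrow> y \<in> A) \<Longrightarrow>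
      (\<integral>\<^sup>+x\<in>A. X (Suc n) x \<partial>M) \<le> (\<integral>\<^sup>+x\<in>A. X n x \<partial>M)"
  shows "AE x in M. convergent (\<lambda>n. X n x)"
proof -
  have le0: "(\<integral>\<^sup>+x. X n x \<partial>M) \<le> (\<integral>\<^sup>+x. X 0 x \<partial>M)" for n
  proof (induction n)
    case (Suc n)
    have "(\<integral>\<^sup>+x\<in>space M. X (Suc n) x \<partial>M) \<le> (\<integral>\<^sup>+x\<in>space M. X n x \<partial>M)"
      by (rule super) auto
    then show ?case using Suc by (simp add: nn_integral_set_ennreal[symmetric] cong: nn_integral_cong_simp)
  qed simp
  have fin0: "(\<integral>\<^sup>+x. X 0 x \<partial>M) < \<infinity>"
    using int0 nonneg by (simp add: integrable_iff_bounded)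
  have int: "integrable M (X n)" for n
    using le0[of n] fin0 nonneg by (auto simp: integrable_iff_bounded intro: le_less_trans)
  \<comment> \<open>The expected gain is at most 0, so the expected number of upcrossings up to any
    time is at most \<open>a / (b - a)\<close>, and the total number is finite almost
    surely.\<close>
  have cross: "AE x in M. \<not> ((\<exists>\<^sub>F n in sequentially. X n x < a) \<and> (\<exists>\<^sub>F n in sequentially. b < X n x))"
    if ab: "0 \<le> a" "a < b" for a b
  proof -
    have meas_H[measurable]: "Measurable.pred M (holding X a b n)" for n
      by (induction n) simp_all
    have [measurable]: "(\<lambda>x. upcrossings X a b n x) \<in> measurable M (count_space UNIV)" for n
      by (induction n) simp_all
    have step: "(\<integral>x. (if holding X a b n x then X (Suc n) x - X n x else 0) \<partial>M) \<le> 0" for n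
    proof -
      let ?A = "{x\<in>space M. holding X a b n x}"
      have "(\<integral>\<^sup>+x\<in>?A. X (Suc n) x \<partial>M) \<le> (\<integral>\<^sup>+x\<in>?A. X n x \<partial>M)"
      proof (rule super)
        fix x y assume *: "x \<in> ?A" "y \<in> space M" "\<And>k. k \<le> n \<Longrightarrow> X k x = X k y"
        show "y \<in> ?A" using * holding_cong[of n X x y a b] by simp
      qed simp
      moreover have inti: "integrable M (\<lambda>x. X k x * indicator ?A x)" for k
        using integrable_mult_indicator[OF _ int[of k], of ?A] by (simp add: mult.commute)
      have "(\<integral>\<^sup>+x\<in>?A. X k x \<partial>M) = ennreal (\<integral>x. X k x * indicator ?A x \<partial>M)" for k
        using inti[of k] nonneg
        by (subst nn_integral_eq_integral[symmetric])
           (auto intro!: nn_integral_cong split: split_indicator)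
      ultimately have le: "(\<integral>x. X (Suc n) x * indicator ?A x \<partial>M) \<le> (\<integral>x. X n x * indicator ?A x \<partial>M)"
        using nonneg by (simp add: ennreal_le_iff integral_nonneg_AE)
      have "(\<integral>x. (if holding X a b n x then X (Suc n) x - X n x else 0) \<partial>M)
          = (\<integral>x. X (Suc n) x * indicator ?A x - X n x * indicator ?A x \<partial>M)"
        by (rule Bochner_Integration.integral_cong) (auto split: split_indicator)
      also have "\<dots> \<le> 0" using le inti by simp
      finally show ?thesis .
    qed
    have intg: "integrable M (\<lambda>x. if holding X a b n x then X (Suc n) x - X n x else 0)" for n
      by (rule Bochner_Integration.integrable_bound[of _ "\<lambda>x. X (Suc n) x - X n x"]) (use int in auto)
    have intgain: "integrable M (gain X a b n)" for n
      unfolding gain_def[abs_def] by (intro Bochner_Integration.integrable_sum intg)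
    have gain_le: "(\<integral>x. gain X a b n x \<partial>M) \<le> 0" for n
      unfolding gain_def using intg step by (simp add: sum_nonpos)
    have Ub: "(\<integral>\<^sup>+x. ennreal (upcrossings X a b n x) \<partial>M) \<le> ennreal (a / (b - a))" for n
    proof -
      have "(\<integral>\<^sup>+x. ennreal (upcrossings X a b n x) \<partial>M) \<le> (\<integral>\<^sup>+x. ennreal ((gain X a b n x + a) / (b - a)) \<partial>M)"
      proof (intro nn_integral_mono ennreal_leI)
        fix x
        have "(b - a) * upcrossings X a b n x \<le> gain X a b n x + a"
          using gain_ge_upcrossings[OF ab(2), where X=X and x=x and n=n] nonneg ab(1) by force
        then show "real (upcrossings X a b n x) \<le> (gain X a b n x + a) / (b - a)"
          using ab(2) by (simp add: pos_le_divide_eq mult.commute)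
      qed
      also have "\<dots> = ennreal (\<integral>x. (gain X a b n x + a) / (b - a) \<partial>M)"
      proof (rule nn_integral_eq_integral)
        show "integrable M (\<lambda>x. (gain X a b n x + a) / (b - a))" using intgain[of n] by simp
        have "(b - a) * upcrossings X a b n x \<le> gain X a b n x + a" for x
          using gain_ge_upcrossings[OF ab(2), where X=X and x=x and n=n] nonneg ab(1) by force
        then have "gain X a b n x + a \<ge> 0" for x
          using ab(2) by (meson diff_gt_0_iff_gt dual_order.trans less_eq_real_def mult_nonneg_nonneg of_nat_0_le_iff)
        then show "AE x in M. 0 \<le> (gain X a b n x + a) / (b - a)" using ab(2) by simp
      qed
      also have "(\<integral>x. (gain X a b n x + a) / (b - a) \<partial>M) = ((\<integral>x. gain X a b n x \<partial>M) + a) / (b - a)"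
        using intgain[of n] by (simp add: prob_space)
      also have "ennreal \<dots> \<le> ennreal (a / (b - a))"
        using gain_le[of n] ab(2) by (intro ennreal_leI divide_right_mono) auto
      finally show ?thesis .
    qed
    have "(\<integral>\<^sup>+x. (SUP n. ennreal (upcrossings X a b n x)) \<partial>M) = (SUP n. \<integral>\<^sup>+x. ennreal (upcrossings X a b n x) \<partial>M)"
    proof (rule nn_integral_monotone_convergence_SUP)
      show "incseq (\<lambda>n x. ennreal (upcrossings X a b n x))"
        using mono_upcrossings[of X a b] by (auto simp: incseq_def le_fun_def mono_def intro!: ennreal_leI)
    qed simp
    also have "\<dots> \<le> ennreal (a / (b - a))" by (intro SUP_least Ub)
    also have "\<dots> < \<infinity>" by simp
    finally have "AE x in M. (SUP n. ennreal (upcrossings X a b n x)) \<noteq> \<infinity>"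
      by (intro nn_integral_PInf_AE) auto
    then show ?thesis
    proof eventually_elim
      case (elim x)
      show ?case
      proof
        assume *: "(\<exists>\<^sub>F n in sequentially. X n x < a) \<and> (\<exists>\<^sub>F n in sequentially. b < X n x)"
        have "(of_nat m :: ennreal) \<le> (SUP n. ennreal (upcrossings X a b n x))" for m
        proof -
          obtain n where "m \<le> upcrossings X a b n x"
            using upcrossings_unbounded[OF ab(2), of X x m] * by blast
          then have "(of_nat m :: ennreal) \<le> ennreal (upcrossings X a b n x)"
            by (simp add: ennreal_of_nat_eq_real_of_nat)
          also have "\<dots> \<le> (SUP n. ennreal (upcrossings X a b n x))" by (rule SUP_upper) simp
          finally show ?thesis .
        qed
        then have "(SUP n. ennreal (upcrossings X a b n x)) = \<infinity>"
          by (metis ennreal_SUP_of_nat_eq_top SUP_least infinity_ennreal_def top.extremum_uniqueI)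
        with elim show False by simp
      qed
    qed
  qed
  have c: "countable {(a, b) | a b :: real. a \<in> \<rat> \<and> b \<in> \<rat> \<and> 0 \<le> a \<and> a < b}"
    by (rule countable_subset[of _ "\<rat> \<times> \<rat>"]) (auto simp: countable_rat)
  have "AE x in M. \<forall>(a, b)\<in>{(a, b) | a b :: real. a \<in> \<rat> \<and> b \<in> \<rat> \<and> 0 \<le> a \<and> a < b}.
      \<not> ((\<exists>\<^sub>F n in sequentially. X n x < a) \<and> (\<exists>\<^sub>F n in sequentially. b < X n x))"
    using cross by (subst AE_ball_countable[OF c]) auto
  \<comment> \<open>By Fatou the liminf has finite mean, which excludes divergence to
    infinity.\<close>
  moreover have "(\<integral>\<^sup>+x. liminf (\<lambda>n. ennreal (X n x)) \<partial>M) \<le> (\<integral>\<^sup>+x. X 0 x \<partial>M)"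
  proof -
    have "(\<integral>\<^sup>+x. liminf (\<lambda>n. ennreal (X n x)) \<partial>M) \<le> liminf (\<lambda>n. \<integral>\<^sup>+x. ennreal (X n x) \<partial>M)"
      by (rule nn_integral_liminf) simp
    also have "\<dots> \<le> limsup (\<lambda>n. \<integral>\<^sup>+x. ennreal (X n x) \<partial>M)"
      by (rule Liminf_le_Limsup) simp
    also have "\<dots> \<le> (\<integral>\<^sup>+x. X 0 x \<partial>M)"
      by (rule Limsup_bounded) (simp add: le0)
    finally show ?thesis .
  qed
  then have "AE x in M. liminf (\<lambda>n. ennreal (X n x)) \<noteq> \<infinity>"
    using fin0 by (intro nn_integral_PInf_AE) auto
  ultimately show ?thesis
  proof eventually_elim
    case (elim x)
    have "\<exists>C. \<exists>\<^sub>F n in sequentially. X n x < C"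
    proof (rule ccontr)
      assume "\<not> ?thesis"
      then have "ennreal C \<le> liminf (\<lambda>n. ennreal (X n x))" for C
        by (intro Liminf_bounded) (auto simp: frequently_def not_less elim!: eventually_mono intro!: ennreal_leI)
      then have "ennreal (of_nat m) \<le> liminf (\<lambda>n. ennreal (X n x))" for m
        by blast
      then have "(SUP m. of_nat m) \<le> liminf (\<lambda>n. ennreal (X n x))"
        by (intro SUP_least) (simp add: ennreal_of_nat_eq_real_of_nat)
      with elim(2) show False by (simp add: ennreal_SUP_of_nat_eq_top top.extremum_unique)
    qed
    then obtain C where "\<exists>\<^sub>F n in sequentially. X n x < C" ..
    then show ?case
      using elim(1) nonneg by (intro convergent_if_no_upcrossing) auto
  qed
qed

section \<open>Geometry of the space of words, measures given by cylinder masses, Hausdorff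
  densities\<close>

section \<open>Cylinders and Borel sets of infinite words\<close>

lemma mem_cylinder_iff: "x \<in> cylinder i \<longleftrightarrow> stake (length i) x = i"
  by (simp add: cylinder_def)

lemma dist_stream_le_iff: "dist x y \<le> exp (- real n) \<longleftrightarrow> stake n x = stake n y"
  by (cases "x = y") (auto simp: dist_stream_def stake_eq_iff_common_prefix_length)

lemma take_stake_le: "m \<le> n \<Longrightarrow> take m (stake n x) = stake m x"
  by (simp add: take_stake min_def)

lemma open_stake: "open {x. P (stake n x)}"
  unfolding open_dist
proof (intro ballI)
  fix x :: "'a stream" assume "x \<in> {x. P (stake n x)}"
  then have P: "P (stake n x)" by simp
  have "stake n y = stake n x" if "dist y x < exp (- real n)" for y
    using dist_stream_le_iff[of y x n] that by simp
  then show "\<exists>e>0. \<forall>y. dist y x < e \<longrightarrow> y \<in> {x. P (stake n x)}"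
    using P by (metis exp_gt_zero mem_Collect_eq)
qed

text \<open>There are countably many finite words, so an open set is a countable union of the
  cylinders inside it.\<close>

lemma sets_borel_cylinder: "(sets borel :: nat stream set set) = sigma_sets UNIV (range cylinder)"
proof -
  have "U \<in> sigma_sets UNIV (range cylinder)" if "open U" for U :: "nat stream set"
  proof -
    have eq: "U = (\<Union>i\<in>{i. cylinder i \<subseteq> U}. cylinder i)"
    proof (intro equalityI subsetI)
      fix x assume "x \<in> U"
      then obtain e where e: "e > 0" "\<And>y. dist y x < e \<Longrightarrow> y \<in> U"
        using \<open>open U\<close> by (auto simp: open_dist)
      obtain n where n: "exp (- real n) < e"
      proof -
        obtain n where "inverse e < real n" using reals_Archimedean2 by blast
        also have "\<dots> < exp (real n)" using exp_ge_add_one_self[of "real n"] by linarith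
        finally have "exp (- real n) < e"
          using e(1) by (metis exp_minus inverse_inverse_eq less_imp_inverse_less positive_imp_inverse_positive)
        with that show thesis by blast
      qed
      have "cylinder (stake n x) \<subseteq> U"
        using dist_stream_le_iff[of _ x n] n e(2) by (force simp: mem_cylinder_iff)
      then show "x \<in> (\<Union>i\<in>{i. cylinder i \<subseteq> U}. cylinder i)"
        by (intro UN_I[of "stake n x"]) (auto simp: mem_cylinder_iff)
    qed auto
    have "(\<Union>i\<in>{i. cylinder i \<subseteq> U}. cylinder i) \<in> sets (sigma UNIV (range cylinder))"
      by (intro sets.countable_UN') auto
    then show ?thesis using eq by simp
  qed
  then have "sigma_sets UNIV {S. open S} \<subseteq> sigma_sets UNIV (range (cylinder :: nat list \<Rightarrow> _))"
    by (intro sigma_sets_mono) auto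
  moreover have "open (cylinder i)" for i :: "nat list"
    using open_stake[of "\<lambda>j. j = i" "length i"] by (simp add: cylinder_def)
  then have "sigma_sets UNIV (range (cylinder :: nat list \<Rightarrow> _)) \<subseteq> sigma_sets UNIV {S. open S}"
    by (intro sigma_sets_mono) auto
  ultimately show ?thesis
    by (simp add: borel_def)
qed

lemma borel_stake [measurable]: "stake n \<in> borel \<rightarrow>\<^sub>M count_space UNIV"
proof (rule measurableI)
  fix A :: "'a list set"
  have "stake n -` A \<inter> space borel = {x. stake n x \<in> A}" by auto
  then show "stake n -` A \<inter> space borel \<in> sets borel"
    using borel_open[OF open_stake[of "\<lambda>i. i \<in> A" n]] by simp
qed simp

lemma cylinder_in_borel [simp, measurable]: "cylinder i \<in> sets borel"
  using sets_borel_cylinder by auto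

text \<open>Two cylinders are nested or disjoint, so they form an intersection-stable generator once
  the empty set is added.\<close>

lemma finite_measure_cylinder_eqI:
  fixes \<mu> \<nu> :: "nat stream measure"
  assumes "finite_measure \<mu>" "sets \<mu> = sets borel" "sets \<nu> = sets borel"
    and eq: "\<And>i. emeasure \<mu> (cylinder i) = emeasure \<nu> (cylinder i)"
  shows "\<mu> = \<nu>"
proof (rule measure_eqI_generator_eq)
  interpret finite_measure \<mu> by fact
  show "Int_stable (insert {} (range cylinder :: nat stream set set))"
  proof (rule Int_stableI)
    have "cylinder i \<inter> cylinder j \<in> insert {} (range cylinder)" if "length i \<le> length j" for i j :: "nat list"
    proof (cases "take (length i) j = i")
      case True
      then have "cylinder i \<inter> cylinder j = cylinder j"
        using that by (auto simp: mem_cylinder_iff) (metis take_stake_le)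
      then show ?thesis by simp
    next
      case False
      then have "cylinder i \<inter> cylinder j = {}"
        using that by (auto simp: mem_cylinder_iff) (metis take_stake_le)
      then show ?thesis by simp
    qed
    then have "cylinder i \<inter> cylinder j \<in> insert {} (range cylinder)" for i j :: "nat list"
      using nle_le[of "length i" "length j"] by (metis Int_commute)
    then show "a \<inter> b \<in> insert {} (range cylinder)"
      if "a \<in> insert {} (range cylinder)" "b \<in> insert {} (range cylinder)" for a b :: "nat stream set"
      using that by blast
  qed
  show "sets \<mu> = sigma_sets UNIV (insert {} (range cylinder))" "sets \<nu> = sigma_sets UNIV (insert {} (range cylinder))"
    unfolding assms(2,3) sets_borel_cylinder
    by (rule sigma_sets_eqI; auto intro: sigma_sets.Empty sigma_sets.Basic)+
  show "range (\<lambda>n::nat. cylinder []) \<subseteq> insert {} (range cylinder :: nat stream set set)" by auto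
  show "(\<Union>n::nat. cylinder []) = UNIV" by (auto simp: mem_cylinder_iff)
  show "emeasure \<mu> (cylinder []) \<noteq> \<infinity>" by simp
qed (use eq in auto)

lemma diameter_le_dist:
  assumes "S \<noteq> {}" "\<And>x y. x \<in> S \<Longrightarrow> y \<in> S \<Longrightarrow> dist x y \<le> d"
  shows "diameter S \<le> d"
  using assms unfolding diameter_def by (auto intro!: cSUP_least)

text \<open>The lower bound uses that the alphabet has at least two letters: two words that split
  directly after \<open>i\<close> have exactly this distance.\<close>

lemma diameter_cylinder: "diameter (cylinder i :: nat stream set) = exp (- real (length i))"
proof (rule antisym)
  let ?x = "i @- sconst (0::nat)" and ?y = "i @- sconst (1::nat)"
  have le: "dist x y \<le> exp (- real (length i))" if "x \<in> cylinder i" "y \<in> cylinder i" for x y :: "nat stream"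
    using that by (simp add: dist_stream_le_iff mem_cylinder_iff)
  have "cylinder i \<noteq> ({} :: nat stream set)"
    using stake_shift[of "length i" i "sconst 0"] by (auto simp: mem_cylinder_iff)
  then show "diameter (cylinder i :: nat stream set) \<le> exp (- real (length i))"
    by (intro diameter_le_dist le)
  have "stake (Suc (length i)) ?x \<noteq> stake (Suc (length i)) ?y"
    by (simp add: stake_shift)
  then have "\<not> dist ?x ?y \<le> exp (- real (Suc (length i)))" and "?x \<noteq> ?y"
    by (auto simp only: dist_stream_le_iff)
  then have "exp (- real (length i)) \<le> dist ?x ?y"
    by (auto simp: dist_stream_def)
  also have "\<dots> \<le> diameter (cylinder i :: nat stream set)"
  proof (rule diameter_bounded_bound)
    show mem: "?x \<in> cylinder i" "?y \<in> cylinder i"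
      using stake_shift[of "length i" i] by (simp_all add: mem_cylinder_iff)
    show "bounded (cylinder i :: nat stream set)"
      unfolding bounded_def using le[OF mem(1)] by blast
  qed
  finally show "exp (- real (length i)) \<le> diameter (cylinder i :: nat stream set)" .
qed

text \<open>In the ultrametric, a set with at least two points has the diameter of the smallest
  cylinder around it, because the common prefix lengths of pairs of its points attain a minimum.
  Singletons stand apart since their diameter is 0.\<close>

lemma diameter_stream_cases:
  fixes D :: "nat stream set"
  obtains "D = {}" | x where "D = {x}"
  | n where "diameter D = exp (- real n)" "\<And>x y. x \<in> D \<Longrightarrow> y \<in> D \<Longrightarrow> stake n x = stake n y"
proof (cases "\<exists>x\<in>D. \<exists>y\<in>D. x \<noteq> y")
  case True
  define Q where "Q k \<longleftrightarrow> (\<exists>x\<in>D. \<exists>y\<in>D. x \<noteq> y \<and> common_prefix_length x y = k)" for k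
  define n where "n = (LEAST k. Q k)"
  have "\<exists>k. Q k" using True by (auto simp: Q_def)
  then have Qn: "Q n" unfolding n_def by (rule LeastI_ex)
  have st: "stake n x = stake n y" if "x \<in> D" "y \<in> D" for x y
  proof (cases "x = y")
    case False
    then have "Q (common_prefix_length x y)" using that by (auto simp: Q_def)
    then have "n \<le> common_prefix_length x y" unfolding n_def by (rule Least_le)
    with False show ?thesis by (simp add: stake_eq_iff_common_prefix_length)
  qed simp
  obtain x y where xy: "x \<in> D" "y \<in> D" "x \<noteq> y" "common_prefix_length x y = n"
    using Qn by (auto simp: Q_def)
  have "bounded D"
    unfolding bounded_def using st[OF xy(1)] by (metis dist_stream_le_iff)
  then have "exp (- real n) \<le> diameter D"
    using diameter_bounded_bound[of D x y] xy by (simp add: dist_stream_def)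
  moreover have "diameter D \<le> exp (- real n)"
  proof (rule diameter_le_dist)
    show "D \<noteq> {}" using xy by auto
    show "dist x y \<le> exp (- real n)" if "x \<in> D" "y \<in> D" for x y
      using st[OF that] by (simp add: dist_stream_le_iff)
  qed
  ultimately have "diameter D = exp (- real n)" by (rule antisym[rotated])
  then show thesis using st that(3) by blast
next
  case False
  then have "D = {} \<or> (\<exists>x. D = {x})" by blast
  then show thesis using that(1,2) by blast
qed


section \<open>A measure with prescribed cylinder masses\<close>

text \<open>The measure is an image of Lebesgue measure. An interval of length \<open>w []\<close>
  is cut into consecutive intervals of lengths \<open>w [j]\<close>, these are cut in the same way,
  and a number is sent to the word that records the intervals containing it.\<close>

lemma ex_measure_cylinder:
  fixes w :: "nat list \<Rightarrow> real"
  assumes nonneg: "\<And>i. 0 \<le> w i" and sums: "\<And>i. (\<lambda>j. w (i @ [j])) sums w i"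
  shows "\<exists>\<mu> :: nat stream measure. finite_measure \<mu> \<and> sets \<mu> = sets borel \<and>
    (\<forall>i. emeasure \<mu> (cylinder i) = ennreal (w i))"
proof -
  \<comment> \<open>Left endpoint of the interval of \<open>i\<close>: the total weight of the
    earlier siblings of all nonempty prefixes of \<open>i\<close>.\<close>
  define L where "L i = (\<Sum>m<length i. \<Sum>l<i ! m. w (take m i @ [l]))" for i
  have L_snoc: "L (i @ [j]) = L i + (\<Sum>l<j. w (i @ [l]))" for i j
  proof -
    have "(\<Sum>m<length i. \<Sum>l<(i @ [j]) ! m. w (take m (i @ [j]) @ [l])) = L i"
      unfolding L_def by (rule sum.cong) (simp_all add: nth_append)
    then show ?thesis by (simp add: L_def)
  qed
  define I where "I i = {L i..<L i + w i}" for i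
  define digit where "digit i t = (LEAST j. t < L i + (\<Sum>l<Suc j. w (i @ [l])))" for i t
  define word where "word t = rec_nat [] (\<lambda>_ i. i @ [digit i t])" for t
  have word_0: "word t 0 = []" and word_Suc: "word t (Suc n) = word t n @ [digit (word t n) t]" for t n
    by (simp_all add: word_def)
  \<comment> \<open>The intervals of the children tile that of \<open>i\<close>: they are half-open,
    adjacent, and their lengths sum to \<open>w i\<close>. So \<open>digit i t\<close> names the
    child interval that contains \<open>t\<close>.\<close>
  have I_snoc: "t \<in> I (i @ [j]) \<longleftrightarrow> t \<in> I i \<and> j = digit i t" for t i j
  proof -
    let ?s = "\<lambda>j. L i + (\<Sum>l<j. w (i @ [l]))"
    have mono: "?s j \<le> ?s k" if "j \<le> k" for j k
      using that nonneg by (intro add_left_mono sum_mono2) auto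
    have lim: "?s \<longlonglongrightarrow> L i + w i"
      using sums[of i] by (intro tendsto_intros) (simp add: sums_def)
    have le: "?s j \<le> L i + w i" for j
      by (rule incseq_le[OF _ lim]) (use mono in \<open>auto simp: incseq_def\<close>)
    have eq: "t \<in> I (i @ [j]) \<longleftrightarrow> ?s j \<le> t \<and> t < ?s (Suc j)"
      by (auto simp: I_def L_snoc)
    show ?thesis
    proof
      assume "t \<in> I (i @ [j])"
      then have t: "?s j \<le> t" "t < ?s (Suc j)" using eq by auto
      have "digit i t = j" unfolding digit_def
      proof (rule Least_equality)
        show "j \<le> y" if "t < ?s (Suc y)" for y
        proof (rule ccontr)
          assume "\<not> j \<le> y"
          then have "?s (Suc y) \<le> ?s j" by (intro mono) simp
          then show False using that t by linarith
        qed
      qed (use t in simp)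
      moreover have "t \<in> I i"
        using t mono[of 0 j] le[of "Suc j"] by (simp add: I_def)
      ultimately show "t \<in> I i \<and> j = digit i t" by simp
    next
      assume a: "t \<in> I i \<and> j = digit i t"
      then have "\<forall>\<^sub>F j in sequentially. t < ?s j"
        by (intro order_tendstoD(1)[OF lim]) (simp add: I_def)
      then obtain k where "t < ?s (Suc k)"
        unfolding eventually_sequentially by (meson le_Suc_eq order_refl)
      then have 1: "t < ?s (Suc (digit i t))"
        unfolding digit_def by (rule LeastI)
      have 2: "?s (digit i t) \<le> t"
      proof (cases "digit i t")
        case 0
        then show ?thesis using a by (simp add: I_def)
      next
        case (Suc k)
        then have "\<not> t < ?s (Suc k)"
          using not_less_Least[of k "\<lambda>j. t < ?s (Suc j)"] by (simp add: digit_def)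
        then show ?thesis using Suc by simp
      qed
      show "t \<in> I (i @ [j])" using 1 2 a eq by blast
    qed
  qed
  have word_iff: "word t (length i) = i \<longleftrightarrow> t \<in> I i" if "t \<in> I []" for t i
    using that
  proof (induction i rule: rev_induct)
    case (snoc j i)
    then show ?case by (auto simp: word_Suc I_snoc)
  qed (simp add: word_0)
  define f :: "real \<Rightarrow> nat stream" where "f t = smap (\<lambda>n. digit (word t n) t) nats" for t
  have stake_f: "stake n (f t) = word t n" for n t
  proof (induction n)
    case (Suc n)
    then show ?case by (simp add: stake_Suc word_Suc f_def del: stake.simps)
  qed (simp add: word_0)
  \<comment> \<open>Outside \<open>I []\<close> the least index in \<open>digit\<close> need not
    exist, so Lebesgue measure is restricted to this interval.\<close>
  let ?M = "restrict_space lborel (I [])"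
  have vim: "f -` cylinder i \<inter> I [] = I i" for i
  proof -
    have "I i \<subseteq> I []"
      by (induction i rule: rev_induct) (auto simp: I_snoc)
    then show ?thesis using word_iff[of _ i] by (auto simp: mem_cylinder_iff stake_f)
  qed
  have sp: "space ?M = I []" by (simp add: space_restrict_space)
  have meas: "f \<in> measurable ?M borel"
  proof (rule measurable_sigma_sets[OF sets_borel_cylinder])
    fix y assume "y \<in> range (cylinder :: nat list \<Rightarrow> nat stream set)"
    then obtain i where y: "y = cylinder i" by auto
    have "I i \<subseteq> I []" using vim[of i] by blast
    then show "f -` y \<inter> space ?M \<in> sets ?M"
      using vim[of i] unfolding sp y by (auto simp: sets_restrict_space_iff I_def)
  qed auto
  have em: "emeasure (distr ?M borel f) (cylinder i) = ennreal (w i)" for i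
  proof -
    have "emeasure (distr ?M borel f) (cylinder i) = emeasure ?M (I i)"
      using meas by (simp add: emeasure_distr sp vim)
    also have "\<dots> = emeasure lborel (I i)"
    proof (rule emeasure_restrict_space)
      show "I i \<subseteq> I []" using vim[of i] by blast
    qed (simp add: I_def)
    also have "\<dots> = ennreal (w i)" using nonneg[of i] by (simp add: I_def)
    finally show ?thesis .
  qed
  moreover have "finite_measure (distr ?M borel f)"
  proof
    have "cylinder [] = (UNIV :: nat stream set)" by (auto simp: mem_cylinder_iff)
    then show "emeasure (distr ?M borel f) (space (distr ?M borel f)) \<noteq> \<infinity>"
      using em[of "[]"] by simp
  qed
  ultimately show ?thesis by (intro exI[of _ "distr ?M borel f"]) simp
qed


section \<open>Hausdorff measures and densities\<close>

lemma hausdorff_pre_antimono: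
  assumes "\<delta> \<le> \<delta>'"
  shows "hausdorff_pre \<phi> \<delta>' E \<le> hausdorff_pre \<phi> \<delta> E"
  unfolding hausdorff_pre_def 
  by (rule Inf_superset_mono, rule Collect_mono) (blast intro: order_trans[OF _ assms])

lemma hausdorff_pre_mono:
  assumes "E \<subseteq> F"
  shows "hausdorff_pre \<phi> \<delta> E \<le> hausdorff_pre \<phi> \<delta> F"
  unfolding hausdorff_pre_def 
  by (rule Inf_superset_mono, rule Collect_mono) (use assms in blast)

lemma hausdorff_eq_SUP: "hausdorff \<phi> E = (SUP \<delta>\<in>{0<..}. hausdorff_pre \<phi> \<delta> E)"
proof -
  let ?S = "SUP \<delta>\<in>{0<..}. hausdorff_pre \<phi> \<delta> E"
  have "((\<lambda>\<delta>. hausdorff_pre \<phi> \<delta> E) \<longlongrightarrow> ?S) (at_right 0)"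
  proof (rule order_tendstoI)
    fix c assume "c < ?S"
    then obtain \<delta> where d: "\<delta> > 0" "c < hausdorff_pre \<phi> \<delta> E" by (auto simp: less_SUP_iff)
    then show "\<forall>\<^sub>F x in at_right 0. c < hausdorff_pre \<phi> x E"
      unfolding eventually_at_right_field
      using hausdorff_pre_antimono less_le_trans by (metis less_imp_le)
  next
    fix c assume "?S < c"
    then have "hausdorff_pre \<phi> x E < c" if "x > 0" for x
      using that le_less_trans[OF SUP_upper[of x "{0<..}" "\<lambda>\<delta>. hausdorff_pre \<phi> \<delta> E"]] by simp
    then show "\<forall>\<^sub>F x in at_right 0. hausdorff_pre \<phi> x E < c"
      unfolding eventually_at_right_field using zero_less_one by blast
  qed
  then show ?thesis
    unfolding hausdorff_def by (intro tendsto_Lim) simp_all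
qed

lemma hausdorff_pre_le_hausdorff: "\<delta> > 0 \<Longrightarrow> hausdorff_pre \<phi> \<delta> E \<le> hausdorff \<phi> E"
  unfolding hausdorff_eq_SUP by (rule SUP_upper) simp

lemma hausdorff_mono: "E \<subseteq> F \<Longrightarrow> hausdorff \<phi> E \<le> hausdorff \<phi> F"
  unfolding hausdorff_eq_SUP by (intro SUP_subset_mono order_refl hausdorff_pre_mono)

lemma hausdorff_null_UN:
  assumes "\<And>m::nat. hausdorff \<phi> (E m) = 0"
  shows "hausdorff \<phi> (\<Union>m. E m) = 0"
proof -
  have le: "hausdorff_pre \<phi> \<delta> (\<Union>m. E m) \<le> ennreal e" if "\<delta> > 0" "e > 0" for \<delta> e
  proof -
    have "\<exists>D. (E m \<subseteq> (\<Union>n. D n) \<and> (\<forall>n. D n \<in> sets borel \<and> diameter (D n) \<le> \<delta>)) \<and>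
        (\<Sum>n. ennreal (\<phi> (diameter (D n)))) < ennreal (e * (1/2)^Suc m)" for m
    proof -
      have "hausdorff_pre \<phi> \<delta> (E m) = 0"
        using hausdorff_pre_le_hausdorff[OF that(1), of \<phi> "E m"] assms by simp
      also have "\<dots> < ennreal (e * (1/2)^Suc m)" using that(2) by simp
      finally show ?thesis unfolding hausdorff_pre_def Inf_less_iff by blast
    qed
    then obtain D where D: "\<And>m. E m \<subseteq> (\<Union>n. D m n)" "\<And>m n. D m n \<in> sets borel"
        "\<And>m n. diameter (D m n) \<le> \<delta>"
        "\<And>m. (\<Sum>n. ennreal (\<phi> (diameter (D m n)))) < ennreal (e * (1/2)^Suc m)"
      by metis
    define D' where "D' k = (case prod_decode k of (m, n) \<Rightarrow> D m n)" for k
    have "hausdorff_pre \<phi> \<delta> (\<Union>m. E m) \<le> (\<Sum>k. ennreal (\<phi> (diameter (D' k))))"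
      unfolding hausdorff_pre_def
    proof (rule Inf_lower, rule CollectI, rule exI[of _ D'], intro conjI refl)
      show "(\<Union>m. E m) \<subseteq> (\<Union>k. D' k)"
      proof
        fix x assume "x \<in> (\<Union>m. E m)"
        then obtain m n where "x \<in> D m n" using D(1) by blast
        then have "x \<in> D' (prod_encode (m, n))" by (simp add: D'_def)
        then show "x \<in> (\<Union>k. D' k)" by blast
      qed
      show "\<forall>n. D' n \<in> sets borel \<and> diameter (D' n) \<le> \<delta>"
        using D by (auto simp: D'_def split: prod.split)
    qed
    also have "\<dots> = (\<Sum>m. \<Sum>n. ennreal (\<phi> (diameter (D m n))))"
    proof -
      have "(\<Sum>k. case prod_decode k of (m, n) \<Rightarrow> ennreal (\<phi> (diameter (D m n)))) =
          (\<Sum>m. \<Sum>n. ennreal (\<phi> (diameter (D m n))))"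
        by (rule suminf_ennreal_2dimen) simp
      then show ?thesis by (simp add: D'_def case_prod_beta)
    qed
    also have "\<dots> \<le> (\<Sum>m. ennreal (e * (1/2)^Suc m))"
      using D(4) by (intro suminf_le) (auto intro: less_imp_le)
    also have "\<dots> = ennreal e"
      using that(2) sums_mult[OF power_half_series, of e]
      by (subst suminf_ennreal_eq[where x = e]) auto
    finally show ?thesis .
  qed
  have "hausdorff_pre \<phi> \<delta> (\<Union>m. E m) \<le> 0" if "\<delta> > 0" for \<delta>
  proof (rule ennreal_le_epsilon)
    show "hausdorff_pre \<phi> \<delta> (\<Union>m. E m) \<le> 0 + ennreal e" if "e > 0" for e
      using le[OF \<open>\<delta> > 0\<close> that] by simp
  qed
  then have "hausdorff \<phi> (\<Union>m. E m) \<le> 0"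
    unfolding hausdorff_eq_SUP by (intro SUP_least) (simp only: greaterThan_iff)
  then show ?thesis by simp
qed

lemma hausdorff_null_Un:
  assumes "hausdorff \<phi> E = 0" "hausdorff \<phi> F = 0"
  shows "hausdorff \<phi> (E \<union> F) = 0"
proof -
  let ?f = "\<lambda>m::nat. if m = 0 then E else F"
  have "E \<union> F \<subseteq> \<Union>(range ?f)"
    using UN_upper[of 0 UNIV ?f] UN_upper[of 1 UNIV ?f] by simp
  then have "hausdorff \<phi> (E \<union> F) \<le> hausdorff \<phi> (\<Union>(range ?f))"
    by (rule hausdorff_mono)
  also have "\<dots> = 0"
    using assms by (intro hausdorff_null_UN) simp
  finally show ?thesis by simp
qed

text \<open>Covers are sequences, so a set of words is enumerated by \<open>list_decode\<close>.
  Words outside \<open>V\<close> contribute the empty set, whose diameter is 0 and whose cost is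
  \<open>\<phi> 0 = 0\<close>.\<close>

lemma hausdorff_pre_le_cylinders:
  assumes "\<phi> 0 = 0" "E \<subseteq> (\<Union>i\<in>V. cylinder i)" "\<delta> > 0" "\<And>i. i \<in> V \<Longrightarrow> exp (- real (length i)) \<le> \<delta>"
  shows "hausdorff_pre \<phi> \<delta> E \<le>
    (\<Sum>m. if list_decode m \<in> V then ennreal (\<phi> (exp (- real (length (list_decode m))))) else 0)"
proof -
  define D where "D m = (if list_decode m \<in> V then cylinder (list_decode m) else {} :: nat stream set)" for m
  have "hausdorff_pre \<phi> \<delta> E \<le> (\<Sum>m. ennreal (\<phi> (diameter (D m))))"
    unfolding hausdorff_pre_def
  proof (rule Inf_lower, rule CollectI, rule exI[of _ D], intro conjI refl)
    show "E \<subseteq> (\<Union>m. D m)"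
    proof
      fix x assume "x \<in> E"
      then obtain i where "i \<in> V" "x \<in> cylinder i" using assms(2) by blast
      then have "x \<in> D (list_encode i)" by (simp add: D_def)
      then show "x \<in> (\<Union>m. D m)" by blast
    qed
    show "\<forall>m. D m \<in> sets borel \<and> diameter (D m) \<le> \<delta>"
      using assms(3,4) by (auto simp: D_def diameter_cylinder)
  qed
  also have "\<dots> = (\<Sum>m. if list_decode m \<in> V then ennreal (\<phi> (exp (- real (length (list_decode m))))) else 0)"
    using assms(1) by (intro arg_cong[where f = suminf] ext) (simp add: D_def diameter_cylinder)
  finally show ?thesis .
qed

lemma borel_pred_stake [measurable (raw)]: "Measurable.pred borel (\<lambda>x. P (stake n x))"
  by (rule measurable_compose[OF borel_stake]) simp

text \<open>The gauge is seen through its values at the possible positive diameters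
  \<open>exp (- n)\<close>, collected in \<open>G\<close>. The measure will be the branching measure
  of a fixed tree.\<close>

locale cylinder_density = finite_measure \<mu> for \<mu> :: "nat stream measure" +
  fixes \<phi> :: "real \<Rightarrow> real" and G :: "nat \<Rightarrow> real"
  assumes sets_\<mu> [measurable_cong]: "sets \<mu> = sets borel"
    and \<phi>_0: "\<phi> 0 = 0"
    and \<phi>_exp: "\<And>n. \<phi> (exp (- real n)) = G n"
    and G_pos: "\<And>n. G n > 0"
    and G_lim: "G \<longlonglongrightarrow> 0"
begin

abbreviation mass :: "nat \<Rightarrow> nat stream \<Rightarrow> real" where
  "mass n x \<equiv> measure \<mu> (cylinder (stake n x))"

text \<open>The mass distribution principle, with sharp constant: a set of diameter
  \<open>exp (- n)\<close> lies in a single cylinder of level \<open>n\<close>.\<close>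

lemma emeasure_le_hausdorff:
  assumes A: "A \<in> sets borel" and c: "c \<ge> 0"
    and le: "\<And>x n. x \<in> A \<Longrightarrow> n \<ge> k \<Longrightarrow> c * mass n x \<le> G n"
  shows "ennreal c * emeasure \<mu> A \<le> hausdorff \<phi> A"
proof -
  have [measurable]: "A \<in> sets \<mu>" using A sets_\<mu> by simp
  have piece: "ennreal c * emeasure \<mu> (A \<inter> D) \<le> ennreal (\<phi> (diameter D))"
    if D: "D \<in> sets borel" "diameter D \<le> exp (- real k)" for D
  proof -
    have [measurable]: "D \<in> sets \<mu>" using D(1) sets_\<mu> by simp
    have sub: "ennreal c * emeasure \<mu> (A \<inter> D) \<le> ennreal (G n)"
      if x: "x \<in> A" and n: "n \<ge> k" and st: "\<And>y. y \<in> D \<Longrightarrow> stake n y = stake n x" for x n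
    proof -
      have "emeasure \<mu> (A \<inter> D) \<le> emeasure \<mu> (cylinder (stake n x))"
        using st by (intro emeasure_mono) (auto simp: mem_cylinder_iff)
      then have "ennreal c * emeasure \<mu> (A \<inter> D) \<le> ennreal c * ennreal (mass n x)"
        by (intro mult_left_mono) (simp_all add: emeasure_eq_measure)
      also have "\<dots> = ennreal (c * mass n x)" using c by (simp add: ennreal_mult)
      also have "\<dots> \<le> ennreal (G n)" using le[OF x n] by (rule ennreal_leI)
      finally show ?thesis .
    qed
    show ?thesis
    proof (cases "A \<inter> D = {}")
      case False
      then obtain x where x: "x \<in> A" "x \<in> D" by blast
      consider "D = {x}" | n where "diameter D = exp (- real n)"
          "\<And>x y. x \<in> D \<Longrightarrow> y \<in> D \<Longrightarrow> stake n x = stake n y"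
        using x(2) by (cases D rule: diameter_stream_cases) blast+
      then show ?thesis
      proof cases
        \<comment> \<open>A singleton costs \<open>\<phi> 0 = 0\<close>, so its point must carry no
          mass. The bound \<open>c * mass n x \<le> G n\<close> with \<open>G\<close> tending to 0
          gives this.\<close>
        case 1
        have "ennreal c * emeasure \<mu> (A \<inter> D) \<le> 0"
        proof (rule tendsto_lowerbound)
          show "(\<lambda>n. ennreal (G n)) \<longlonglongrightarrow> 0"
            using tendsto_ennrealI[OF G_lim] by simp
          show "\<forall>\<^sub>F n in sequentially. ennreal c * emeasure \<mu> (A \<inter> D) \<le> ennreal (G n)"
          proof (rule eventually_sequentiallyI)
            show "ennreal c * emeasure \<mu> (A \<inter> D) \<le> ennreal (G n)" if "n \<ge> k" for n
              using 1 by (intro sub[OF x(1) that]) blast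
          qed
        qed (rule trivial_limit_sequentially)
        then show ?thesis by (rule order_trans) simp
      next
        case (2 n)
        then have "n \<ge> k" using D(2) by simp
        then have "ennreal c * emeasure \<mu> (A \<inter> D) \<le> ennreal (G n)"
          using 2(2)[OF _ x(2)] by (rule sub[OF x(1)])
        then show ?thesis using 2(1) \<phi>_exp by simp
      qed
    qed simp
  qed
  have "ennreal c * emeasure \<mu> A \<le> hausdorff_pre \<phi> (exp (- real k)) A"
    unfolding hausdorff_pre_def
  proof (rule Inf_greatest)
    fix z assume "z \<in> {\<Sum>n. ennreal (\<phi> (diameter (D n))) |D. A \<subseteq> (\<Union>n. D n) \<and>
      (\<forall>n. D n \<in> sets borel \<and> diameter (D n) \<le> exp (- real k))}"
    then obtain D where z: "z = (\<Sum>n. ennreal (\<phi> (diameter (D n))))" and D: "A \<subseteq> (\<Union>n. D n)"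
      "\<And>n. D n \<in> sets borel" "\<And>n. diameter (D n) \<le> exp (- real k)" by blast
    have [measurable]: "D n \<in> sets \<mu>" for n using D(2) sets_\<mu> by simp
    have "emeasure \<mu> A = emeasure \<mu> (\<Union>n. A \<inter> D n)"
      using D(1) by (intro arg_cong[where f="emeasure \<mu>"]) blast
    also have "\<dots> \<le> (\<Sum>n. emeasure \<mu> (A \<inter> D n))"
      by (rule emeasure_subadditive_countably) auto
    finally have "ennreal c * emeasure \<mu> A \<le> ennreal c * (\<Sum>n. emeasure \<mu> (A \<inter> D n))"
      by (rule mult_left_mono) simp
    also have "\<dots> = (\<Sum>n. ennreal c * emeasure \<mu> (A \<inter> D n))" by simp
    also have "\<dots> \<le> z"
      unfolding z using piece D(2,3) by (intro suminf_le) auto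
    finally show "ennreal c * emeasure \<mu> A \<le> z" .
  qed
  also have "\<dots> \<le> hausdorff \<phi> A" by (rule hausdorff_pre_le_hausdorff) simp
  finally show ?thesis .
qed

text \<open>For every \<open>c\<close>, the points whose cylinders of all levels
  \<open>n \<ge> k\<close> satisfy \<open>c * mass n x \<le> G n\<close> exhaust almost all of
  \<open>E\<close> as \<open>k\<close> grows. So \<open>c * emeasure \<mu> E\<close> is a lower
  bound for every \<open>c\<close>.\<close>

theorem hausdorff_infinite:
  assumes E: "E \<in> sets borel" "emeasure \<mu> E \<noteq> 0"
    and lim: "AE x in \<mu>. x \<in> E \<longrightarrow> (\<lambda>n. mass n x / G n) \<longlonglongrightarrow> 0"
  shows "hausdorff \<phi> E = \<infinity>"
proof -
  have [measurable]: "E \<in> sets \<mu>" using E sets_\<mu> by simp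
  have le: "ennreal c * emeasure \<mu> E \<le> hausdorff \<phi> E" if c: "c > 0" for c
  proof -
    define A where "A k = {x. \<forall>n\<ge>k. c * mass n x \<le> G n} \<inter> E" for k
    have "{x. c * mass n x \<le> G n} \<in> sets borel" for n
      using borel_pred_stake[of "\<lambda>i. c * measure \<mu> (cylinder i) \<le> G n" n] by (simp add: pred_def)
    then have "(\<Inter>n\<in>{k..}. {x. c * mass n x \<le> G n}) \<in> sets borel" for k
      by (intro sets.countable_INT') auto
    also have "(\<Inter>n\<in>{k..}. {x. c * mass n x \<le> G n}) = {x. \<forall>n\<ge>k. c * mass n x \<le> G n}" for k
      by auto
    finally have A: "A k \<in> sets borel" for k unfolding A_def using E(1) by simp
    then have [measurable]: "A k \<in> sets \<mu>" for k by (simp add: sets_\<mu>)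
    have "incseq A"
      unfolding A_def by (intro incseq_SucI) auto
    then have "(SUP k. emeasure \<mu> (A k)) = emeasure \<mu> (\<Union>k. A k)"
      by (intro SUP_emeasure_incseq) auto
    also have "\<dots> = emeasure \<mu> E"
    proof (rule emeasure_eq_AE)
      show "AE x in \<mu>. (x \<in> (\<Union>k. A k)) = (x \<in> E)"
        using lim
      proof eventually_elim
        case (elim x)
        have "x \<in> (\<Union>k. A k)" if "x \<in> E"
        proof -
          have "\<forall>\<^sub>F n in sequentially. mass n x / G n < 1 / c"
            using elim that c by (intro order_tendstoD(2)[of _ 0]) auto
          then obtain k where k: "\<And>n. n \<ge> k \<Longrightarrow> mass n x / G n < 1 / c"
            by (auto simp: eventually_sequentially)
          have "c * mass n x \<le> G n" if "n \<ge> k" for n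
            using k[OF that] c G_pos[of n] by (simp add: field_simps)
          with that show ?thesis unfolding A_def by blast
        qed
        then show ?case unfolding A_def by blast
      qed
    qed auto
    finally have eq: "emeasure \<mu> E = (SUP k. emeasure \<mu> (A k))" ..
    have "ennreal c * emeasure \<mu> (A k) \<le> hausdorff \<phi> E" for k
    proof -
      have "ennreal c * emeasure \<mu> (A k) \<le> hausdorff \<phi> (A k)"
        using A c by (rule_tac emeasure_le_hausdorff[where k=k]) (auto simp: A_def)
      also have "\<dots> \<le> hausdorff \<phi> E" by (rule hausdorff_mono) (auto simp: A_def)
      finally show ?thesis .
    qed
    then show ?thesis unfolding eq SUP_mult_left_ennreal by (intro SUP_least)
  qed
  show ?thesis
  proof (rule ccontr)
    assume "hausdorff \<phi> E \<noteq> \<infinity>"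
    then obtain h where h: "hausdorff \<phi> E = ennreal h" "h \<ge> 0"
      by (cases "hausdorff \<phi> E") auto
    define m where "m = measure \<mu> E"
    have m: "m > 0" using E(2) by (simp add: m_def emeasure_eq_measure zero_less_measure_iff)
    have "ennreal (((h + 1) / m) * m) \<le> ennreal h"
      using le[of "(h + 1) / m"] h m by (simp add: emeasure_eq_measure m_def ennreal_mult[symmetric] del: times_divide_eq_left)
    then show False using m h by (simp add: ennreal_le_iff)
  qed
qed

text \<open>Each point is covered by its first cylinder of level at least \<open>n1\<close> with
  \<open>c * G \<le> mass\<close>. First cylinders are disjoint, so \<open>c\<close> times the total
  cost is at most the mass of their union. The predicate \<open>P\<close> keeps the cover inside a
  given clopen neighbourhood of \<open>A\<close>.\<close>

lemma hausdorff_le_emeasure: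
  assumes c: "c > 0" and A: "\<And>x. x \<in> A \<Longrightarrow> P (stake n x)"
    and freq: "\<And>x. x \<in> A \<Longrightarrow> \<exists>\<^sub>F m in sequentially. c * G m \<le> mass m x"
  shows "ennreal c * hausdorff \<phi> A \<le> emeasure \<mu> {x. P (stake n x)}"
proof -
  have "ennreal c * hausdorff_pre \<phi> \<delta> A \<le> emeasure \<mu> {x. P (stake n x)}" if "\<delta> > 0" for \<delta>
  proof -
    have "(\<lambda>m. exp (- real m)) \<longlonglongrightarrow> 0" by real_asymp
    then have "\<forall>\<^sub>F m in sequentially. exp (- real m) < \<delta>"
      using that by (rule order_tendstoD(2))
    then obtain n0 where n0: "\<And>m. m \<ge> n0 \<Longrightarrow> exp (- real m) < \<delta>"
      by (auto simp: eventually_sequentially)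
    \<comment> \<open>Cylinders of level at least \<open>n\<close> respect \<open>P\<close>, and
      those of level at least \<open>n0\<close> are small enough for
      \<open>\<delta>\<close>.\<close>
    define n1 where "n1 = max n n0"
    define Q where "Q i \<longleftrightarrow> c * G (length i) \<le> measure \<mu> (cylinder i)" for i
    define V where "V = {i. n1 \<le> length i \<and> P (take n i) \<and> Q i \<and>
      (\<forall>m. n1 \<le> m \<longrightarrow> m < length i \<longrightarrow> \<not> Q (take m i))}"
    define D where "D m = (if list_decode m \<in> V then cylinder (list_decode m) else {} :: nat stream set)" for m
    have D_meas: "range D \<subseteq> sets \<mu>" by (auto simp: D_def sets_\<mu>)
    have V_unique: "i = j" if "i \<in> V" "j \<in> V" "x \<in> cylinder i" "x \<in> cylinder j" "length i \<le> length j" for i j x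
    proof (rule ccontr)
      assume "i \<noteq> j"
      have i: "i = take (length i) j"
        using that(3-5) take_stake_le[of "length i" "length j" x] by (simp add: mem_cylinder_iff)
      with \<open>i \<noteq> j\<close> that(5) have "length i < length j"
        by (metis le_neq_implies_less take_all order_refl)
      then have "\<not> Q (take (length i) j)" using that(1,2) by (simp add: V_def)
      with i that(1) show False by (simp add: V_def)
    qed
    have disj: "disjoint_family D"
      unfolding disjoint_family_on_def
    proof (intro ballI impI)
      fix m k :: nat assume "m \<noteq> k"
      then have ne: "list_decode m \<noteq> list_decode k" by (metis list_decode_inverse)
      show "D m \<inter> D k = {}"
      proof (rule ccontr)
        assume "D m \<inter> D k \<noteq> {}"
        then obtain x where "list_decode m \<in> V" "list_decode k \<in> V"
            "x \<in> cylinder (list_decode m)" "x \<in> cylinder (list_decode k)"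
          by (auto simp: D_def split: if_splits)
        with V_unique ne show False by (metis nle_le)
      qed
    qed
    have cover: "A \<subseteq> (\<Union>i\<in>V. cylinder i)"
    proof
      fix x assume x: "x \<in> A"
      have ex: "\<exists>m. n1 \<le> m \<and> Q (stake m x)"
        using freq[OF x] by (auto simp: frequently_sequentially Q_def)
      define m where "m = (LEAST m. n1 \<le> m \<and> Q (stake m x))"
      have m: "n1 \<le> m" "Q (stake m x)"
        using LeastI_ex[OF ex] by (simp_all add: m_def)
      have min: "\<not> Q (stake k x)" if "n1 \<le> k" "k < m" for k
        using not_less_Least[of k "\<lambda>m. n1 \<le> m \<and> Q (stake m x)"] that by (simp add: m_def)
      have "n \<le> m" using m(1) by (simp add: n1_def)
      then have "stake m x \<in> V"
        unfolding V_def using m min A[OF x] by (auto simp: take_stake_le)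
      then show "x \<in> (\<Union>i\<in>V. cylinder i)"
        by (rule UN_I) (simp add: mem_cylinder_iff)
    qed
    have "hausdorff_pre \<phi> \<delta> A \<le>
        (\<Sum>m. if list_decode m \<in> V then ennreal (\<phi> (exp (- real (length (list_decode m))))) else 0)"
    proof (rule hausdorff_pre_le_cylinders[where \<phi> = \<phi> and V = V, OF _ cover])
      fix i assume "i \<in> V"
      then have "n0 \<le> length i" by (simp add: V_def n1_def)
      then show "exp (- real (length i)) \<le> \<delta>" by (rule less_imp_le[OF n0])
    qed (use \<phi>_0 that in simp_all)
    then have "ennreal c * hausdorff_pre \<phi> \<delta> A \<le> ennreal c *
        (\<Sum>m. if list_decode m \<in> V then ennreal (\<phi> (exp (- real (length (list_decode m))))) else 0)"
      by (rule mult_left_mono) simp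
    also have "\<dots> = (\<Sum>m. ennreal c *
        (if list_decode m \<in> V then ennreal (\<phi> (exp (- real (length (list_decode m))))) else 0))"
      by (rule ennreal_suminf_cmult[symmetric])
    also have "\<dots> \<le> (\<Sum>m. emeasure \<mu> (D m))"
    proof (rule suminf_le)
      fix m
      show "ennreal c * (if list_decode m \<in> V then ennreal (\<phi> (exp (- real (length (list_decode m))))) else 0)
          \<le> emeasure \<mu> (D m)"
        using c G_pos[of "length (list_decode m)"]
        by (auto simp: D_def V_def Q_def \<phi>_exp emeasure_eq_measure ennreal_mult[symmetric] intro: ennreal_leI)
    qed simp_all
    also have "\<dots> = emeasure \<mu> (\<Union>m. D m)"
      by (rule suminf_emeasure[OF D_meas disj])
    also have "\<dots> \<le> emeasure \<mu> {x. P (stake n x)}"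
    proof (rule emeasure_mono)
      have "P (stake n x)" if "i \<in> V" "x \<in> cylinder i" for i x
      proof -
        have "n \<le> length i" "P (take n i)" using that(1) by (simp_all add: V_def n1_def)
        moreover have "stake (length i) x = i" using that(2) by (simp add: mem_cylinder_iff)
        ultimately show ?thesis by (metis take_stake_le)
      qed
      then show "(\<Union>m. D m) \<subseteq> {x. P (stake n x)}"
        by (auto simp: D_def split: if_splits)
      show "{x. P (stake n x)} \<in> sets \<mu>"
        using borel_pred_stake[of P n] by (simp add: pred_def sets_\<mu>)
    qed
    finally show ?thesis .
  qed
  then show ?thesis
    unfolding hausdorff_eq_SUP by (subst SUP_mult_left_ennreal, intro SUP_least) simp
qed

text \<open>The upper density is infinite almost everywhere, but on \<open>E\<close> it is only
  known to be positive. Where it is infinite, the Hausdorff measure is at most the total mass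
  divided by any \<open>C\<close>. Where it is finite, the points form a null set, and their cost is
  bounded by the masses of clopen sets that shrink to a null set.\<close>

theorem hausdorff_null:
  assumes dense: "AE x in \<mu>. \<forall>C. \<exists>\<^sub>F m in sequentially. C * G m \<le> mass m x"
    and E: "\<And>x. x \<in> E \<Longrightarrow> \<exists>c>0. \<exists>\<^sub>F m in sequentially. c * G m \<le> mass m x"
  shows "hausdorff \<phi> E = 0"
proof -
  define F where "F c = {x. \<exists>\<^sub>F m in sequentially. c * G m \<le> mass m x}" for c
  define B where "B C k = {x. \<forall>m\<ge>k. mass m x < C * G m}" for C k
  define I where "I = (\<Inter>C::nat. F (real C))"
  have I: "hausdorff \<phi> I = 0"
  proof (rule ccontr)
    assume "hausdorff \<phi> I \<noteq> 0"
    moreover have le: "ennreal (real (Suc C)) * hausdorff \<phi> I \<le> emeasure \<mu> UNIV" for C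
    proof -
      have "\<exists>\<^sub>F m in sequentially. real (Suc C) * G m \<le> mass m x" if "x \<in> I" for x
        using that INT_lower[of "Suc C" UNIV "\<lambda>C. F (real C)"] by (auto simp: I_def F_def simp del: of_nat_Suc)
      then show ?thesis
        using hausdorff_le_emeasure[of "real (Suc C)" I "\<lambda>_. True" 0] by simp
    qed
    moreover have "hausdorff \<phi> I \<noteq> \<infinity>"
    proof
      assume "hausdorff \<phi> I = \<infinity>"
      with le[of 0] have "emeasure \<mu> UNIV = \<infinity>" by (simp add: top_unique)
      then show False using sets_eq_imp_space_eq[OF sets_\<mu>] emeasure_finite[of UNIV] by simp
    qed
    ultimately obtain h where h: "hausdorff \<phi> I = ennreal h" "h > 0"
      by (cases "hausdorff \<phi> I") (auto simp: less_le)
    obtain C where C: "measure \<mu> UNIV / h < real C" using reals_Archimedean2 by blast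
    have "ennreal (real (Suc C) * h) \<le> ennreal (measure \<mu> UNIV)"
      using le[of C] h by (simp add: emeasure_eq_measure ennreal_mult)
    then have "real (Suc C) * h \<le> measure \<mu> UNIV" using h by (simp add: ennreal_le_iff)
    moreover have "measure \<mu> UNIV < real C * h" using C h by (simp add: field_simps)
    ultimately show False using h by (simp add: algebra_simps)
  qed
  \<comment> \<open>\<open>U n\<close> looks at the levels up to \<open>n\<close> only, so it is
    determined by a prefix, and it contains \<open>B C k\<close>. By \<open>dense\<close>, these
    sets decrease to a null set.\<close>
  have null: "hausdorff \<phi> (F c \<inter> B C k) = 0" if "c > 0" for c C k
  proof -
    define P where "P n i \<longleftrightarrow> (\<forall>m. k \<le> m \<and> m \<le> n \<longrightarrow> measure \<mu> (cylinder (take m i)) < C * G m)" for n i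
    define U where "U n = {x. P n (stake n x)}" for n
    have U_meas: "U n \<in> sets \<mu>" for n
      using borel_pred_stake[of "P n" n] by (simp add: U_def pred_def sets_\<mu>)
    have U_iff: "x \<in> U n \<longleftrightarrow> (\<forall>m. k \<le> m \<and> m \<le> n \<longrightarrow> mass m x < C * G m)" for x n
      by (simp add: U_def P_def take_stake_le)
    have "decseq U" by (intro decseq_SucI) (auto simp: U_iff)
    then have "(\<lambda>n. emeasure \<mu> (U n)) \<longlonglongrightarrow> emeasure \<mu> (\<Inter>n. U n)"
      using U_meas by (intro Lim_emeasure_decseq) auto
    moreover have "emeasure \<mu> (\<Inter>n. U n) = emeasure \<mu> {}"
    proof (rule emeasure_eq_AE)
      show "AE x in \<mu>. (x \<in> (\<Inter>n. U n)) = (x \<in> {})"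
        using dense
      proof eventually_elim
        case (elim x)
        then have "\<exists>\<^sub>F m in sequentially. C * G m \<le> mass m x" ..
        then obtain m where "m \<ge> k" "C * G m \<le> mass m x" by (auto simp: frequently_sequentially)
        then have "x \<notin> U m" by (auto simp: U_iff not_less)
        then show ?case by blast
      qed
    qed (use U_meas in auto)
    moreover have "ennreal c * hausdorff \<phi> (F c \<inter> B C k) \<le> emeasure \<mu> (U n)" for n
      unfolding U_def
      by (rule hausdorff_le_emeasure[OF that]) (auto simp: F_def B_def P_def take_stake_le)
    ultimately have "ennreal c * hausdorff \<phi> (F c \<inter> B C k) \<le> 0"
      by (intro tendsto_lowerbound[of _ 0]) (auto intro: always_eventually)
    then show ?thesis using that by simp
  qed
  have "E \<subseteq> I \<union> (\<Union>j::nat. \<Union>C::nat. \<Union>k. F (1 / real (Suc j)) \<inter> B (real C) k)"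
  proof
    fix x assume "x \<in> E"
    then obtain c where c: "c > 0" "\<exists>\<^sub>F m in sequentially. c * G m \<le> mass m x" using E by blast
    obtain j where j: "1 / real (Suc j) < c"
      using c(1) nat_approx_posE by blast
    have "\<exists>\<^sub>F m in sequentially. 1 / real (Suc j) * G m \<le> mass m x"
      using c(2)
    proof (rule frequently_mono[rotated], intro allI impI)
      fix m assume "c * G m \<le> mass m x"
      moreover have "1 / real (Suc j) * G m \<le> c * G m"
        using j G_pos[of m] by (intro mult_right_mono) auto
      ultimately show "1 / real (Suc j) * G m \<le> mass m x" by linarith
    qed
    then have F: "x \<in> F (1 / real (Suc j))" by (simp add: F_def)
    show "x \<in> I \<union> (\<Union>j::nat. \<Union>C::nat. \<Union>k. F (1 / real (Suc j)) \<inter> B (real C) k)"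
    proof (cases "x \<in> I")
      case False
      then obtain C :: nat where "x \<notin> F (real C)" by (auto simp: I_def)
      then obtain k where "\<And>m. m \<ge> k \<Longrightarrow> \<not> real C * G m \<le> mass m x"
        unfolding F_def frequently_def eventually_sequentially by blast
      then have "x \<in> B (real C) k" by (simp add: B_def not_le)
      with F show ?thesis by blast
    qed simp
  qed
  then have "hausdorff \<phi> E \<le> hausdorff \<phi> (I \<union> (\<Union>j::nat. \<Union>C::nat. \<Union>k. F (1 / real (Suc j)) \<inter> B (real C) k))"
    by (rule hausdorff_mono)
  also have "\<dots> = 0"
    by (intro hausdorff_null_Un I hausdorff_null_UN null) simp
  finally show ?thesis by simp
qed

end

section \<open>Galton-Watson trees and expectations of sums along them\<close>

section \<open>Trees\<close>

definition sub :: "nat \<Rightarrow> (nat list \<Rightarrow> nat) \<Rightarrow> nat list \<Rightarrow> nat" where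
  "sub k \<nu> = (\<lambda>j. \<nu> (k # j))"

definition shift :: "nat list \<Rightarrow> (nat list \<Rightarrow> nat) \<Rightarrow> nat list \<Rightarrow> nat" where
  "shift i \<nu> = (\<lambda>j. \<nu> (i @ j))"

definition generation :: "nat \<Rightarrow> (nat list \<Rightarrow> nat) \<Rightarrow> nat list set" where
  "generation n \<nu> = {j \<in> tree \<nu>. length j = n}"

text \<open>The recursion is at the root, because the subtrees of the root are independent copies of
  the tree. \<open>Z_Suc_snoc\<close> gives the decomposition at the last generation, on which the
  martingale property rests.\<close>

primrec Z :: "nat \<Rightarrow> (nat list \<Rightarrow> nat) \<Rightarrow> nat" where
  "Z 0 \<nu> = 1"
| "Z (Suc n) \<nu> = (\<Sum>k<\<nu> []. Z n (sub k \<nu>))"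

lemma shift_Nil [simp]: "shift [] \<nu> = \<nu>"
  and shift_Cons: "shift (k # i) \<nu> = shift i (sub k \<nu>)"
  and shift_shift: "shift j (shift i \<nu>) = shift (i @ j) \<nu>"
  and sub_shift: "sub k (shift i \<nu>) = shift (i @ [k]) \<nu>"
  and shift_at: "shift i \<nu> j = \<nu> (i @ j)"
  by (simp_all add: shift_def sub_def)

lemma tree_snoc: "i @ [m] \<in> tree \<nu> \<longleftrightarrow> i \<in> tree \<nu> \<and> m < \<nu> i"
  by (auto intro: tree.child elim: tree.cases)

lemma tree_Cons: "k # j \<in> tree \<nu> \<longleftrightarrow> k < \<nu> [] \<and> j \<in> tree (sub k \<nu>)"
proof (induction j rule: rev_induct)
  case Nil
  show ?case using tree_snoc[of "[]" k \<nu>] by (simp add: tree.root)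
next
  case (snoc m j)
  have "k # (j @ [m]) \<in> tree \<nu> \<longleftrightarrow> k # j \<in> tree \<nu> \<and> m < \<nu> (k # j)"
    using tree_snoc[of "k # j" m \<nu>] by simp
  with snoc show ?case by (auto simp: tree_snoc sub_def)
qed

lemma generation_0: "generation 0 \<nu> = {[]}"
  by (auto simp: generation_def tree.root)

lemma generation_Suc: "generation (Suc n) \<nu> = (\<Union>k<\<nu> []. (#) k ` generation n (sub k \<nu>))"
  unfolding generation_def by (auto simp: length_Suc_conv tree_Cons image_iff)

lemma generation_Suc_snoc: "generation (Suc n) \<nu> = (\<Union>i\<in>generation n \<nu>. (\<lambda>m. i @ [m]) ` {..<\<nu> i})"
  unfolding generation_def by (auto simp: length_Suc_conv_rev tree_snoc image_iff)

lemma finite_generation [simp]: "finite (generation n \<nu>)"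
  by (induction n arbitrary: \<nu>) (simp_all add: generation_0 generation_Suc)

lemma sum_generation_Suc:
  "(\<Sum>i\<in>generation (Suc n) \<nu>. f i) = (\<Sum>k<\<nu> []. \<Sum>i\<in>generation n (sub k \<nu>). f (k # i))"
proof -
  have "(\<Sum>i\<in>generation (Suc n) \<nu>. f i) = (\<Sum>k<\<nu> []. \<Sum>i\<in>(#) k ` generation n (sub k \<nu>). f i)"
    unfolding generation_Suc by (rule sum.UNION_disjoint) auto
  also have "\<dots> = (\<Sum>k<\<nu> []. \<Sum>i\<in>generation n (sub k \<nu>). f (k # i))"
    by (rule sum.cong) (simp_all add: sum.reindex)
  finally show ?thesis .
qed

lemma Z_eq_card: "Z n \<nu> = card (generation n \<nu>)"
proof (induction n arbitrary: \<nu>)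
  case (Suc n)
  then show ?case
    using sum_generation_Suc[of "\<lambda>_. 1::nat" n \<nu>] by simp
qed (simp add: generation_0)

lemma Z_Suc_snoc: "Z (Suc n) \<nu> = (\<Sum>i\<in>generation n \<nu>. \<nu> i)"
proof -
  have "Z (Suc n) \<nu> = (\<Sum>i\<in>generation n \<nu>. card ((\<lambda>m. i @ [m]) ` {..<\<nu> i}))"
    unfolding Z_eq_card generation_Suc_snoc by (rule card_UN_disjoint) auto
  also have "\<dots> = (\<Sum>i\<in>generation n \<nu>. \<nu> i)"
    by (rule sum.cong) (auto simp: card_image inj_on_def)
  finally show ?thesis .
qed

lemma tree_cong:
  assumes "\<And>j. length j < length i \<Longrightarrow> \<nu> j = \<nu>' j"
  shows "i \<in> tree \<nu> \<longleftrightarrow> i \<in> tree \<nu>'"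
  using assms by (induction i rule: rev_induct) (simp_all add: tree.root tree_snoc)

lemma Z_cong:
  assumes "\<And>j. length j < n \<Longrightarrow> \<nu> j = \<nu>' j"
  shows "Z n \<nu> = Z n \<nu>'"
  unfolding Z_eq_card generation_def
  using tree_cong[of _ \<nu> \<nu>'] assms by (intro arg_cong[where f = card]) auto

lemma suminf_list_decode:
  fixes f :: "nat list \<Rightarrow> ennreal"
  assumes "finite S"
  shows "(\<Sum>m. if list_decode m \<in> S then f (list_decode m) else 0) = (\<Sum>i\<in>S. f i)"
proof -
  have "(\<Sum>m. if list_decode m \<in> S then f (list_decode m) else 0)
      = (\<Sum>m\<in>list_encode ` S. if list_decode m \<in> S then f (list_decode m) else 0)"
  proof (rule suminf_finite)
    fix m assume "m \<notin> list_encode ` S"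
    then have "list_decode m \<notin> S" by (metis image_eqI list_decode_inverse)
    then show "(if list_decode m \<in> S then f (list_decode m) else 0) = 0" by simp
  qed (use assms in simp)
  also have "\<dots> = (\<Sum>i\<in>S. f i)"
    by (simp add: sum.reindex inj_list_encode)
  finally show ?thesis .
qed


section \<open>Product measures\<close>

text \<open>Resampling one coordinate leaves a product measure invariant. It encodes independence: a
  factor that does not depend on coordinate \<open>i\<close> passes through the inner
  integral.\<close>

lemma nn_integral_PiM_fun_upd:
  fixes q :: "'a measure" and i :: 'i
  assumes "prob_space q" and F[measurable]: "F \<in> borel_measurable (PiM UNIV (\<lambda>_::'i. q))"
  shows "(\<integral>\<^sup>+\<xi>. F \<xi> \<partial>PiM UNIV (\<lambda>_. q)) = (\<integral>\<^sup>+\<xi>. \<integral>\<^sup>+x. F (\<xi>(i := x)) \<partial>q \<partial>PiM UNIV (\<lambda>_. q))"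
proof -
  let ?P = "PiM UNIV (\<lambda>_::'i. q)"
  interpret q: prob_space q by fact
  interpret P: prob_space ?P using assms(1) by (intro prob_space_PiM)
  interpret pair_sigma_finite q ?P by unfold_locales
  have upd: "(\<lambda>(x, \<xi>). \<xi>(i := x)) \<in> q \<Otimes>\<^sub>M ?P \<rightarrow>\<^sub>M ?P"
    using measurable_fun_upd[of UNIV UNIV i "\<lambda>z. snd z" "q \<Otimes>\<^sub>M ?P" "\<lambda>_. q" fst]
    by (auto simp: case_prod_beta' insert_UNIV)
  have "distr (q \<Otimes>\<^sub>M ?P) ?P (\<lambda>(x, \<xi>). \<xi>(i := x)) = ?P"
    using distr_pair_PiM_eq_PiM[of UNIV "\<lambda>_. q" i] assms(1) by (simp add: insert_UNIV)
  then have "(\<integral>\<^sup>+\<xi>. F \<xi> \<partial>?P) = (\<integral>\<^sup>+\<xi>. F \<xi> \<partial>distr (q \<Otimes>\<^sub>M ?P) ?P (\<lambda>(x, \<xi>). \<xi>(i := x)))"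
    by simp
  also have "\<dots> = (\<integral>\<^sup>+z. F (case z of (x, \<xi>) \<Rightarrow> \<xi>(i := x)) \<partial>(q \<Otimes>\<^sub>M ?P))"
    by (rule nn_integral_distr[OF upd]) simp
  also have "\<dots> = (\<integral>\<^sup>+\<xi>. \<integral>\<^sup>+x. F (\<xi>(i := x)) \<partial>q \<partial>?P)"
  proof (subst nn_integral_snd[symmetric])
    show "(\<lambda>z. F (case z of (x, \<xi>) \<Rightarrow> \<xi>(i := x))) \<in> borel_measurable (q \<Otimes>\<^sub>M ?P)"
      by (rule measurable_compose[OF upd F])
  qed simp
  finally show ?thesis .
qed


section \<open>The law of a Galton--Watson tree\<close>

text \<open>\<open>\<xi>\<close> supplies a subtree for every natural number, not only for those
  below \<open>n\<close>, so that root and subtrees can be drawn independently.\<close>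

definition join :: "nat \<Rightarrow> (nat \<Rightarrow> nat list \<Rightarrow> nat) \<Rightarrow> nat list \<Rightarrow> nat" where
  "join n \<xi> i = (case i of [] \<Rightarrow> n | k # j \<Rightarrow> \<xi> k j)"

lemma join_Nil [simp]: "join n \<xi> [] = n"
  and sub_join [simp]: "sub k (join n \<xi>) = \<xi> k"
  by (simp_all add: join_def sub_def)

locale offspring_law = p: prob_space p for p :: "nat measure" +
  assumes sets_p [measurable_cong]: "sets p = sets (count_space UNIV)"
    and integrable_p: "integrable p real"
    and supercritical: "(\<integral>n. real n \<partial>p) > 1"
begin

abbreviation a :: real where "a \<equiv> \<integral>n. real n \<partial>p"

lemma a_gt_1: "a > 1" and a_pos: "a > 0"
  using supercritical by simp_all

definition GW :: "(nat list \<Rightarrow> nat) measure" where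
  "GW = PiM UNIV (\<lambda>_. p)"

definition Forest :: "(nat \<Rightarrow> nat list \<Rightarrow> nat) measure" where
  "Forest = PiM UNIV (\<lambda>_. GW)"

sublocale GW: prob_space GW
  unfolding GW_def by (rule prob_space_PiM) unfold_locales

sublocale Forest: prob_space Forest
  unfolding Forest_def by (rule prob_space_PiM) unfold_locales

lemma space_p: "space p = UNIV"
  using sets_eq_imp_space_eq[OF sets_p] by simp

lemma measurable_into_p: "M \<rightarrow>\<^sub>M p = M \<rightarrow>\<^sub>M count_space UNIV"
  and measurable_from_p: "p \<rightarrow>\<^sub>M M = count_space UNIV \<rightarrow>\<^sub>M M"
  by (rule measurable_cong_sets; simp only: sets_p)+

lemma space_GW [simp]: "space GW = UNIV"
  by (auto simp: GW_def space_PiM space_p)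

lemma space_Forest [simp]: "space Forest = UNIV"
  by (auto simp: Forest_def space_PiM)

lemma measurable_GW_eval [measurable]: "(\<lambda>\<nu>. \<nu> i) \<in> GW \<rightarrow>\<^sub>M count_space UNIV"
  using measurable_component_singleton[of i UNIV "\<lambda>_. p"]
  by (simp add: GW_def measurable_into_p)

lemma measurable_into_GW:
  assumes "\<And>i. (\<lambda>x. f x i) \<in> M \<rightarrow>\<^sub>M count_space UNIV"
  shows "f \<in> M \<rightarrow>\<^sub>M GW"
  unfolding GW_def
proof (rule measurable_PiM_single')
  show "(\<lambda>x. f x i) \<in> M \<rightarrow>\<^sub>M p" for i
    using assms by (simp only: measurable_into_p)
qed (simp add: space_p)

lemma measurable_shift [measurable]: "shift i \<in> GW \<rightarrow>\<^sub>M GW"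
  and measurable_sub [measurable]: "sub k \<in> GW \<rightarrow>\<^sub>M GW"
  by (rule measurable_into_GW; simp add: shift_def sub_def)+

lemma measurable_Forest_eval [measurable]: "(\<lambda>\<xi>. \<xi> k) \<in> Forest \<rightarrow>\<^sub>M GW"
  unfolding Forest_def by (rule measurable_component_singleton) simp

lemma measurable_join [measurable]: "(\<lambda>(n, \<xi>). join n \<xi>) \<in> p \<Otimes>\<^sub>M Forest \<rightarrow>\<^sub>M GW"
proof (rule measurable_into_GW)
  fix i :: "nat list"
  show "(\<lambda>x. (case x of (n, \<xi>) \<Rightarrow> join n \<xi>) i) \<in> p \<Otimes>\<^sub>M Forest \<rightarrow>\<^sub>M count_space UNIV"
  proof (cases i)
    case Nil
    have "fst \<in> p \<Otimes>\<^sub>M Forest \<rightarrow>\<^sub>M p" by simp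
    then have "fst \<in> p \<Otimes>\<^sub>M Forest \<rightarrow>\<^sub>M count_space UNIV" by (simp only: measurable_into_p)
    then show ?thesis by (simp add: Nil case_prod_beta')
  next
    case (Cons k j)
    have "(\<lambda>x. snd x k) \<in> p \<Otimes>\<^sub>M Forest \<rightarrow>\<^sub>M GW"
      by (rule measurable_compose[OF measurable_snd measurable_Forest_eval])
    from measurable_compose[OF this measurable_GW_eval[of j]] show ?thesis
      by (simp add: Cons case_prod_beta' join_def)
  qed
qed

lemma emeasure_GW_Collect:
  assumes "finite J"
  shows "emeasure GW {\<nu>. \<forall>i\<in>J. \<nu> i \<in> A i} = (\<Prod>i\<in>J. emeasure p (A i))"
proof -
  interpret product_prob_space "\<lambda>_::nat list. p" UNIV ..
  have "emeasure (PiM UNIV (\<lambda>_. p)) {x \<in> space (PiM UNIV (\<lambda>_. p)). \<forall>i\<in>J. x i \<in> A i} = (\<Prod>i\<in>J. emeasure p (A i))"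
    using assms by (intro emeasure_PiM_Collect) (auto simp: sets_p)
  then show ?thesis by (simp add: GW_def[symmetric])
qed

text \<open>Both measures are compared on finite-dimensional boxes. The index set \<open>J\<close>
  of a box is split into the root and, for each first letter \<open>k\<close>, the set
  \<open>JJ k\<close> of remaining words, and the product of the factors is regrouped
  accordingly.\<close>

lemma distr_join: "distr (p \<Otimes>\<^sub>M Forest) GW (\<lambda>(n, \<xi>). join n \<xi>) = GW"
proof -
  have "GW = distr (p \<Otimes>\<^sub>M Forest) GW (\<lambda>(n, \<xi>). join n \<xi>)"
    unfolding GW_def
  proof (rule measure_eqI_PiM_infinite[OF refl])
    fix J :: "nat list set" and A assume J: "finite J"
    let ?X = "prod_emb UNIV (\<lambda>_. p) J (Pi\<^sub>E J A)"
    have X: "?X = {\<nu>. \<forall>i\<in>J. \<nu> i \<in> A i}"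
      by (auto simp: prod_emb_def space_PiM space_p PiE_iff)
    have X_sets: "?X \<in> sets GW"
    proof -
      have "{\<nu>\<in>space GW. \<forall>i\<in>J. \<nu> i \<in> A i} \<in> sets GW"
        using J by measurable
      then show ?thesis unfolding X by simp
    qed
    define K where "K = hd ` (J - {[]})"
    define JJ where "JJ k = {j. k # j \<in> J}" for k
    define C where "C k = {\<nu>. \<forall>j\<in>JJ k. \<nu> j \<in> A (k # j)}" for k
    define B where "B = (if [] \<in> J then A [] else UNIV)"
    have finJJ: "finite (JJ k)" for k
      unfolding JJ_def by (rule finite_subset[of _ "tl ` J"]) (use J in \<open>force simp: image_iff\<close>)+
    have C_sets: "C k \<in> sets GW" for k
    proof -
      have "{\<nu>\<in>space GW. \<forall>j\<in>JJ k. \<nu> j \<in> A (k # j)} \<in> sets GW"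
        using finJJ by measurable
      then show ?thesis unfolding C_def by simp
    qed
    have K: "finite K" "J - {[]} = (\<lambda>(k, j). k # j) ` (SIGMA k:K. JJ k)"
    proof -
      show "finite K" using J by (simp add: K_def)
      show "J - {[]} = (\<lambda>(k, j). k # j) ` (SIGMA k:K. JJ k)"
      proof (intro equalityI subsetI)
        fix i assume i: "i \<in> J - {[]}"
        then obtain k j where kj: "i = k # j" by (cases i) auto
        then have "(k, j) \<in> (SIGMA k:K. JJ k)" using i by (force simp: K_def JJ_def image_iff)
        then show "i \<in> (\<lambda>(k, j). k # j) ` (SIGMA k:K. JJ k)" using kj by (force simp: image_iff)
      qed (auto simp: JJ_def)
    qed
    have "emeasure (distr (p \<Otimes>\<^sub>M Forest) GW (\<lambda>(n, \<xi>). join n \<xi>)) ?X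
        = emeasure (p \<Otimes>\<^sub>M Forest) (B \<times> {\<xi>. \<forall>k\<in>K. \<xi> k \<in> C k})"
    proof -
      have "(\<lambda>(n, \<xi>). join n \<xi>) -` ?X \<inter> space (p \<Otimes>\<^sub>M Forest) = B \<times> {\<xi>. \<forall>k\<in>K. \<xi> k \<in> C k}"
      proof -
        have "(\<forall>i\<in>J. join n \<xi> i \<in> A i) \<longleftrightarrow> n \<in> B \<and> (\<forall>k\<in>K. \<xi> k \<in> C k)" for n \<xi>
        proof -
          have "(\<forall>i\<in>J. join n \<xi> i \<in> A i) \<longleftrightarrow> n \<in> B \<and> (\<forall>i\<in>J - {[]}. join n \<xi> i \<in> A i)"
            by (auto simp: B_def)
          also have "(\<forall>i\<in>J - {[]}. join n \<xi> i \<in> A i) \<longleftrightarrow> (\<forall>k\<in>K. \<xi> k \<in> C k)"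
            unfolding K(2) by (simp add: join_def C_def)
          finally show ?thesis .
        qed
        then show ?thesis by (auto simp: X space_pair_measure space_p)
      qed
      then show ?thesis using measurable_join X_sets by (simp add: emeasure_distr)
    qed
    also have "\<dots> = emeasure p B * emeasure Forest {\<xi>. \<forall>k\<in>K. \<xi> k \<in> C k}"
    proof (rule Forest.emeasure_pair_measure_Times)
      show "B \<in> sets p" by (simp add: sets_p)
      have "{\<xi>\<in>space Forest. \<forall>k\<in>K. \<xi> k \<in> C k} \<in> sets Forest"
        using K(1) C_sets by measurable
      then show "{\<xi>. \<forall>k\<in>K. \<xi> k \<in> C k} \<in> sets Forest" by simp
    qed
    also have "emeasure Forest {\<xi>. \<forall>k\<in>K. \<xi> k \<in> C k} = (\<Prod>k\<in>K. emeasure GW (C k))"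
    proof -
      interpret product_prob_space "\<lambda>_::nat. GW" UNIV ..
      have "emeasure (PiM UNIV (\<lambda>_. GW)) {x \<in> space (PiM UNIV (\<lambda>_. GW)). \<forall>k\<in>K. x k \<in> C k} = (\<Prod>k\<in>K. emeasure GW (C k))"
        using K(1) C_sets by (intro emeasure_PiM_Collect) auto
      then show ?thesis by (simp add: Forest_def[symmetric])
    qed
    also have "(\<Prod>k\<in>K. emeasure GW (C k)) = (\<Prod>k\<in>K. \<Prod>j\<in>JJ k. emeasure p (A (k # j)))"
      unfolding C_def using finJJ by (simp add: emeasure_GW_Collect)
    also have "\<dots> = (\<Prod>(k, j)\<in>(SIGMA k:K. JJ k). emeasure p (A (k # j)))"
      using K(1) finJJ by (intro prod.Sigma) auto
    also have "\<dots> = (\<Prod>i\<in>J - {[]}. emeasure p (A i))"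
    proof -
      have "inj_on (\<lambda>(k, j). k # j) (SIGMA k:K. JJ k)" by (rule inj_onI) auto
      then show ?thesis
        unfolding K(2) by (simp add: prod.reindex case_prod_beta')
    qed
    also have "emeasure p B * \<dots> = (\<Prod>i\<in>J. emeasure p (A i))"
      using J p.emeasure_space_1 by (cases "[] \<in> J") (simp_all add: B_def prod.remove space_p)
    also have "\<dots> = emeasure GW ?X"
      unfolding X using J by (rule emeasure_GW_Collect[symmetric])
    finally show "emeasure (PiM UNIV (\<lambda>_. p)) ?X =
        emeasure (distr (p \<Otimes>\<^sub>M Forest) (PiM UNIV (\<lambda>_. p)) (\<lambda>(n, \<xi>). join n \<xi>)) ?X"
      by (simp add: GW_def)
  qed (use GW.finite_measure_axioms in \<open>simp_all add: GW_def\<close>)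
  then show ?thesis ..
qed

text \<open>The branching property in the form used throughout: condition on the root, then
  integrate over independent subtrees.\<close>

lemma nn_integral_GW_split:
  assumes [measurable]: "F \<in> borel_measurable GW"
  shows "(\<integral>\<^sup>+\<nu>. F \<nu> \<partial>GW) = (\<integral>\<^sup>+n. \<integral>\<^sup>+\<xi>. F (join n \<xi>) \<partial>Forest \<partial>p)"
proof -
  have "(\<integral>\<^sup>+\<nu>. F \<nu> \<partial>GW) = (\<integral>\<^sup>+\<nu>. F \<nu> \<partial>distr (p \<Otimes>\<^sub>M Forest) GW (\<lambda>(n, \<xi>). join n \<xi>))"
    by (simp add: distr_join)
  also have "\<dots> = (\<integral>\<^sup>+z. F (case z of (n, \<xi>) \<Rightarrow> join n \<xi>) \<partial>(p \<Otimes>\<^sub>M Forest))"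
    by (rule nn_integral_distr[OF measurable_join]) simp
  also have "\<dots> = (\<integral>\<^sup>+n. \<integral>\<^sup>+\<xi>. F (join n \<xi>) \<partial>Forest \<partial>p)"
    by (subst Forest.nn_integral_fst[symmetric])
       (use measurable_compose[OF measurable_join assms] in auto)
  finally show ?thesis .
qed

lemma distr_shift: "distr GW GW (shift i) = GW"
  using distr_PiM_reindex[of UNIV "\<lambda>_. p" "\<lambda>j. i @ j" UNIV] p.prob_space_axioms
  by (simp add: GW_def shift_def[abs_def] inj_on_def restrict_UNIV)

lemma distr_Forest_component: "distr Forest GW (\<lambda>\<xi>. \<xi> k) = GW"
  unfolding Forest_def by (rule distr_PiM_component) (auto intro: GW.prob_space_axioms)

lemma nn_integral_Forest_component:
  "f \<in> borel_measurable GW \<Longrightarrow> (\<integral>\<^sup>+\<xi>. f (\<xi> k) \<partial>Forest) = (\<integral>\<^sup>+\<nu>. f \<nu> \<partial>GW)"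
  using nn_integral_distr[OF measurable_Forest_eval, of f k] by (simp add: distr_Forest_component)

lemma AE_shift:
  assumes "AE \<nu> in GW. P \<nu>"
  shows "AE \<nu> in GW. \<forall>i. P (shift i \<nu>)"
  unfolding AE_all_countable
proof
  fix i
  show "AE \<nu> in GW. P (shift i \<nu>)"
    by (rule AE_distrD[OF measurable_shift]) (unfold distr_shift, rule assms)
qed

lemma AE_Forest:
  assumes "AE \<nu> in GW. P \<nu>"
  shows "AE \<xi> in Forest. \<forall>k. P (\<xi> k)"
  unfolding AE_all_countable
proof
  fix k
  show "AE \<xi> in Forest. P (\<xi> k)"
    by (rule AE_distrD[OF measurable_Forest_eval]) (unfold distr_Forest_component, rule assms)
qed

end

section \<open>Normalized generation sizes, their limit, and the branching measure\<close>

context offspring_law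
begin

text \<open>The number of children has countably many values, so it may select the function.\<close>

lemma measurable_children:
  assumes "\<And>r. F r \<in> GW \<rightarrow>\<^sub>M N"
  shows "(\<lambda>\<nu>. F (\<nu> []) \<nu>) \<in> GW \<rightarrow>\<^sub>M N"
  by (rule measurable_compose_countable[OF assms measurable_GW_eval])

lemma measurable_sum_children:
  fixes h :: "nat \<Rightarrow> (nat list \<Rightarrow> nat) \<Rightarrow> 'b::{second_countable_topology, topological_comm_monoid_add}"
  assumes [measurable]: "\<And>k. h k \<in> borel_measurable GW"
  shows "(\<lambda>\<nu>. \<Sum>k<\<nu> []. h k \<nu>) \<in> borel_measurable GW"
  by (rule measurable_children[where F = "\<lambda>r \<nu>. \<Sum>k<r. h k \<nu>"]) measurable

lemma measurable_Z [measurable]: "(\<lambda>\<nu>. real (Z n \<nu>)) \<in> borel_measurable GW"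
proof (induction n)
  case (Suc n)
  have "(\<lambda>\<nu>. \<Sum>k<\<nu> []. real (Z n (sub k \<nu>))) \<in> borel_measurable GW"
    by (rule measurable_sum_children) (rule measurable_compose[OF measurable_sub Suc])
  then show ?case by simp
qed simp

lemma nn_integral_p: "(\<integral>\<^sup>+n. ennreal (real n) \<partial>p) = ennreal a"
  using integrable_p by (subst nn_integral_eq_integral) auto

lemma nn_integral_sum_children:
  assumes h[measurable]: "h \<in> borel_measurable GW"
  shows "(\<integral>\<^sup>+\<nu>. (\<Sum>k<\<nu> []. h (sub k \<nu>)) \<partial>GW) = ennreal a * (\<integral>\<^sup>+\<nu>. h \<nu> \<partial>GW)"
proof -
  have "(\<integral>\<^sup>+\<nu>. (\<Sum>k<\<nu> []. h (sub k \<nu>)) \<partial>GW) = (\<integral>\<^sup>+n. \<integral>\<^sup>+\<xi>. (\<Sum>k<n. h (\<xi> k)) \<partial>Forest \<partial>p)"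
    by (subst nn_integral_GW_split) (simp_all add: measurable_sum_children)
  also have "\<dots> = (\<integral>\<^sup>+n. ennreal (real n) * (\<integral>\<^sup>+\<nu>. h \<nu> \<partial>GW) \<partial>p)"
    by (rule nn_integral_cong)
       (simp add: nn_integral_sum nn_integral_Forest_component ennreal_of_nat_eq_real_of_nat)
  also have "\<dots> = ennreal a * (\<integral>\<^sup>+\<nu>. h \<nu> \<partial>GW)"
    by (subst nn_integral_multc) (simp_all add: measurable_from_p nn_integral_p)
  finally show ?thesis .
qed

lemma nn_integral_Z: "(\<integral>\<^sup>+\<nu>. ennreal (real (Z n \<nu>)) \<partial>GW) = ennreal (a ^ n)"
proof (induction n)
  case 0
  then show ?case using GW.emeasure_space_1 by simp
next
  case (Suc n)
  have "(\<integral>\<^sup>+\<nu>. ennreal (real (Z (Suc n) \<nu>)) \<partial>GW) = (\<integral>\<^sup>+\<nu>. (\<Sum>k<\<nu> []. ennreal (real (Z n (sub k \<nu>)))) \<partial>GW)"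
    by (simp add: sum_ennreal)
  also have "\<dots> = ennreal a * ennreal (a ^ n)"
    using Suc by (subst nn_integral_sum_children[where h = "\<lambda>\<nu>. ennreal (real (Z n \<nu>))"]) simp_all
  also have "\<dots> = ennreal (a ^ Suc n)"
    using a_pos by (simp add: ennreal_mult)
  finally show ?case .
qed

lemma nn_integral_GW_eval: "(\<integral>\<^sup>+x. ennreal (real x) * c \<partial>p) = ennreal a * c"
  by (subst nn_integral_multc) (simp_all add: measurable_from_p nn_integral_p)

text \<open>The offspring number of a word of length \<open>n\<close> is independent of whether the
  word is in the tree and of the sizes \<open>Z 0, ..., Z n\<close>. Resampling it therefore gives a
  factor \<open>a\<close> for each word of generation \<open>n\<close>.\<close>

lemma nn_integral_Z_Suc_restrict:
  assumes A[measurable]: "A \<in> sets GW"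
    and det: "\<And>\<nu> \<nu>'. \<nu> \<in> A \<Longrightarrow> (\<And>k. k \<le> n \<Longrightarrow> Z k \<nu> = Z k \<nu>') \<Longrightarrow> \<nu>' \<in> A"
  shows "(\<integral>\<^sup>+\<nu>\<in>A. ennreal (real (Z (Suc n) \<nu>)) \<partial>GW) = ennreal a * (\<integral>\<^sup>+\<nu>\<in>A. ennreal (real (Z n \<nu>)) \<partial>GW)"
proof -
  have tree_meas: "Measurable.pred GW (\<lambda>\<nu>. i \<in> tree \<nu>)" for i
    by (induction i rule: rev_induct) (simp_all add: tree.root tree_snoc)
  have gen_meas[measurable]: "Measurable.pred GW (\<lambda>\<nu>. i \<in> generation n \<nu>)" for i
    using tree_meas unfolding generation_def by simp
  define c where "c i \<nu> = (if i \<in> generation n \<nu> \<and> \<nu> \<in> A then 1 else 0 :: ennreal)" for i \<nu>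
  have c_meas[measurable]: "c i \<in> borel_measurable GW" for i
    unfolding c_def by measurable
  have c_upd: "c i (\<nu>(i := x)) = c i \<nu>" for i \<nu> x
  proof (cases "length i = n")
    case True
    have "i \<in> tree (\<nu>(i := x)) \<longleftrightarrow> i \<in> tree \<nu>"
      by (rule tree_cong) auto
    moreover have "Z k (\<nu>(i := x)) = Z k \<nu>" if "k \<le> n" for k
      using True that by (intro Z_cong) auto
    then have "\<nu>(i := x) \<in> A \<longleftrightarrow> \<nu> \<in> A"
      using det by metis
    ultimately show ?thesis by (simp add: c_def generation_def)
  qed (simp add: c_def generation_def)
  have int1: "(\<integral>\<^sup>+\<nu>. c i \<nu> * ennreal (real (\<nu> i)) \<partial>GW) = ennreal a * (\<integral>\<^sup>+\<nu>. c i \<nu> \<partial>GW)" for i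
  proof -
    have "(\<integral>\<^sup>+\<nu>. c i \<nu> * ennreal (real (\<nu> i)) \<partial>GW) = (\<integral>\<^sup>+\<nu>. \<integral>\<^sup>+x. c i \<nu> * ennreal (real x) \<partial>p \<partial>GW)"
      unfolding GW_def
      by (subst nn_integral_PiM_fun_upd[OF p.prob_space_axioms, where i = i])
         (simp_all add: GW_def[symmetric] c_upd)
    also have "\<dots> = (\<integral>\<^sup>+\<nu>. ennreal a * c i \<nu> \<partial>GW)"
      by (simp add: mult.commute[of "c _ _"] nn_integral_GW_eval)
    also have "\<dots> = ennreal a * (\<integral>\<^sup>+\<nu>. c i \<nu> \<partial>GW)" by (rule nn_integral_cmult) simp
    finally show ?thesis .
  qed
  \<comment> \<open>The generation is a random finite set, so the sum is extended to all words with
    the weights \<open>c\<close> before it is integrated term by term.\<close>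
  have sum: "(\<Sum>i\<in>generation n \<nu>. f i) * indicator A \<nu> = (\<Sum>m. c (list_decode m) \<nu> * f (list_decode m))"
    for \<nu> and f :: "nat list \<Rightarrow> ennreal"
  proof -
    have "(\<Sum>m. c (list_decode m) \<nu> * f (list_decode m))
        = (\<Sum>m. (if list_decode m \<in> generation n \<nu> then f (list_decode m) * indicator A \<nu> else 0))"
      by (rule arg_cong[where f = suminf]) (auto simp: c_def split: split_indicator)
    also have "\<dots> = (\<Sum>i\<in>generation n \<nu>. f i * indicator A \<nu>)"
      by (rule suminf_list_decode) simp
    finally show ?thesis by (simp add: sum_distrib_right)
  qed
  have "(\<integral>\<^sup>+\<nu>\<in>A. ennreal (real (Z (Suc n) \<nu>)) \<partial>GW)
      = (\<integral>\<^sup>+\<nu>. (\<Sum>m. c (list_decode m) \<nu> * ennreal (real (\<nu> (list_decode m)))) \<partial>GW)"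
  proof (rule nn_integral_cong)
    fix \<nu>
    have "ennreal (real (Z (Suc n) \<nu>)) = (\<Sum>i\<in>generation n \<nu>. ennreal (real (\<nu> i)))"
      unfolding Z_Suc_snoc of_nat_sum by (rule sum_ennreal[symmetric]) simp
    then show "ennreal (real (Z (Suc n) \<nu>)) * indicator A \<nu> =
        (\<Sum>m. c (list_decode m) \<nu> * ennreal (real (\<nu> (list_decode m))))"
      by (simp only: sum[of "\<lambda>i. ennreal (real (\<nu> i))" \<nu>])
  qed
  also have "\<dots> = (\<Sum>m. \<integral>\<^sup>+\<nu>. c (list_decode m) \<nu> * ennreal (real (\<nu> (list_decode m))) \<partial>GW)"
    by (rule nn_integral_suminf) simp
  also have "\<dots> = ennreal a * (\<Sum>m. \<integral>\<^sup>+\<nu>. c (list_decode m) \<nu> * 1 \<partial>GW)"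
    by (simp add: int1)
  also have "\<dots> = ennreal a * (\<integral>\<^sup>+\<nu>. (\<Sum>m. c (list_decode m) \<nu> * 1) \<partial>GW)"
    by (subst nn_integral_suminf) simp_all
  also have "\<dots> = ennreal a * (\<integral>\<^sup>+\<nu>\<in>A. ennreal (real (Z n \<nu>)) \<partial>GW)"
  proof -
    have "(\<Sum>m. c (list_decode m) \<nu> * 1) = ennreal (real (Z n \<nu>)) * indicator A \<nu>" for \<nu>
      using sum[of "\<lambda>_. 1" \<nu>] by (simp add: Z_eq_card ennreal_of_nat_eq_real_of_nat)
    then show ?thesis by (simp only:)
  qed
  finally show ?thesis .
qed

theorem AE_convergent_Z: "AE \<nu> in GW. convergent (\<lambda>n. real (Z n \<nu>) / a ^ n)"
proof (rule GW.nonneg_supermartingale_convergent)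
  fix n A assume A: "A \<in> sets GW" and
    det: "\<And>x y. x \<in> A \<Longrightarrow> y \<in> space GW \<Longrightarrow> (\<And>k. k \<le> n \<Longrightarrow> real (Z k x) / a ^ k = real (Z k y) / a ^ k) \<Longrightarrow> y \<in> A"
  have norm: "(\<integral>\<^sup>+\<nu>\<in>A. ennreal (real (Z k \<nu>) / a ^ k) \<partial>GW) = (\<integral>\<^sup>+\<nu>\<in>A. ennreal (real (Z k \<nu>)) \<partial>GW) * ennreal (1 / a ^ k)" for k
  proof -
    have "ennreal (real (Z k \<nu>) / a ^ k) * indicator A \<nu> = ennreal (real (Z k \<nu>)) * indicator A \<nu> * ennreal (1 / a ^ k)" for \<nu>
      using a_pos by (simp add: ennreal_mult[symmetric] mult.commute mult.left_commute divide_inverse split: split_indicator)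
    then show ?thesis using A by (simp add: nn_integral_multc)
  qed
  have "(\<integral>\<^sup>+\<nu>\<in>A. ennreal (real (Z (Suc n) \<nu>)) \<partial>GW) = ennreal a * (\<integral>\<^sup>+\<nu>\<in>A. ennreal (real (Z n \<nu>)) \<partial>GW)"
    using A det by (intro nn_integral_Z_Suc_restrict) auto
  then have "(\<integral>\<^sup>+x\<in>A. ennreal (real (Z (Suc n) x) / a ^ Suc n) \<partial>GW)
      = (\<integral>\<^sup>+\<nu>\<in>A. ennreal (real (Z n \<nu>)) \<partial>GW) * (ennreal a * ennreal (1 / a ^ Suc n))"
    unfolding norm by (simp only: mult_ac)
  also have "ennreal a * ennreal (1 / a ^ Suc n) = ennreal (1 / a ^ n)"
    using a_pos by (simp add: ennreal_mult[symmetric])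
  finally show "(\<integral>\<^sup>+x\<in>A. ennreal (real (Z (Suc n) x) / a ^ Suc n) \<partial>GW) \<le> (\<integral>\<^sup>+x\<in>A. ennreal (real (Z n x) / a ^ n) \<partial>GW)"
    unfolding norm[of n] by (rule eq_refl)
qed (use a_pos in simp_all)

definition W :: "(nat list \<Rightarrow> nat) \<Rightarrow> real" where
  "W \<nu> = lim (\<lambda>n. real (Z n \<nu>) / a ^ n)"

text \<open>Convergence is required in all subtrees at once. It holds almost surely since there are
  countably many words, and it makes \<open>W\<close> nonnegative and additive at every vertex, so
  that the branching measure exists for each regular tree.\<close>

definition regular :: "(nat list \<Rightarrow> nat) \<Rightarrow> bool" where
  "regular \<nu> \<longleftrightarrow> (\<forall>i. convergent (\<lambda>n. real (Z n (shift i \<nu>)) / a ^ n))"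

lemma AE_regular: "AE \<nu> in GW. regular \<nu>"
  unfolding regular_def by (rule AE_shift[OF AE_convergent_Z])

lemma measurable_W [measurable]: "W \<in> borel_measurable GW"
  unfolding W_def[abs_def] by measurable

lemma regular_shift: "regular \<nu> \<Longrightarrow> regular (shift i \<nu>)"
  by (simp add: regular_def shift_shift)

lemma regular_sub: "regular \<nu> \<Longrightarrow> regular (sub k \<nu>)"
  using regular_shift[of \<nu> "[k]"] by (simp add: shift_Cons)

lemma tendsto_W: "regular \<nu> \<Longrightarrow> (\<lambda>n. real (Z n \<nu>) / a ^ n) \<longlonglongrightarrow> W \<nu>"
  unfolding W_def regular_def convergent_LIMSEQ_iff[symmetric] by (metis shift_Nil)

lemma W_nonneg: "regular \<nu> \<Longrightarrow> W \<nu> \<ge> 0"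
  using a_pos by (intro LIMSEQ_le_const[OF tendsto_W]) auto

lemma W_eq_sum_children:
  assumes "regular \<nu>"
  shows "W \<nu> = (\<Sum>k<\<nu> []. W (sub k \<nu>)) / a"
proof -
  have "(\<lambda>n. (\<Sum>k<\<nu> []. real (Z n (sub k \<nu>)) / a ^ n) / a) \<longlonglongrightarrow> (\<Sum>k<\<nu> []. W (sub k \<nu>)) / a"
    using a_pos by (intro tendsto_intros tendsto_W regular_sub assms) simp
  moreover have "(\<Sum>k<\<nu> []. real (Z n (sub k \<nu>)) / a ^ n) / a = real (Z (Suc n) \<nu>) / a ^ Suc n" for n
    by (simp add: sum_divide_distrib mult.commute)
  ultimately have "(\<lambda>n. real (Z (Suc n) \<nu>) / a ^ Suc n) \<longlonglongrightarrow> (\<Sum>k<\<nu> []. W (sub k \<nu>)) / a"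
    by simp
  moreover have "(\<lambda>n. real (Z (Suc n) \<nu>) / a ^ Suc n) \<longlonglongrightarrow> W \<nu>"
    using tendsto_W[OF assms] by (rule LIMSEQ_Suc)
  ultimately show ?thesis using LIMSEQ_unique by blast
qed

lemma W_shift_eq_sum:
  "regular \<nu> \<Longrightarrow> W (shift i \<nu>) = (\<Sum>k<\<nu> i. W (shift (i @ [k]) \<nu>)) / a"
  using W_eq_sum_children[OF regular_shift, of \<nu> i] by (simp add: shift_at sub_shift)

text \<open>By Fatou. This is what bounds expected masses from above; that \<open>W\<close> does not
  vanish is proved separately.\<close>

lemma nn_integral_W_le: "(\<integral>\<^sup>+\<nu>. ennreal (W \<nu>) \<partial>GW) \<le> 1"
proof -
  have one: "(\<integral>\<^sup>+\<nu>. ennreal (real (Z n \<nu>) / a ^ n) \<partial>GW) = 1" for n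
  proof -
    have eq: "ennreal (real (Z n \<nu>) / a ^ n) = ennreal (real (Z n \<nu>)) * ennreal (1 / a ^ n)" for \<nu>
      using a_pos by (simp add: ennreal_mult[symmetric])
    have "(\<integral>\<^sup>+\<nu>. ennreal (real (Z n \<nu>) / a ^ n) \<partial>GW) = (\<integral>\<^sup>+\<nu>. ennreal (real (Z n \<nu>)) * ennreal (1 / a ^ n) \<partial>GW)"
      by (rule nn_integral_cong) (rule eq)
    also have "\<dots> = (\<integral>\<^sup>+\<nu>. ennreal (real (Z n \<nu>)) \<partial>GW) * ennreal (1 / a ^ n)"
      by (rule nn_integral_multc) simp
    also have "\<dots> = 1" using a_pos by (simp add: nn_integral_Z ennreal_mult[symmetric])
    finally show ?thesis .
  qed
  have "(\<integral>\<^sup>+\<nu>. ennreal (W \<nu>) \<partial>GW) = (\<integral>\<^sup>+\<nu>. liminf (\<lambda>n. ennreal (real (Z n \<nu>) / a ^ n)) \<partial>GW)"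
  proof (rule nn_integral_cong_AE)
    show "AE \<nu> in GW. ennreal (W \<nu>) = liminf (\<lambda>n. ennreal (real (Z n \<nu>) / a ^ n))"
      using AE_regular
    proof eventually_elim
      case (elim \<nu>)
      then have "(\<lambda>n. ennreal (real (Z n \<nu>) / a ^ n)) \<longlonglongrightarrow> ennreal (W \<nu>)"
        by (intro tendsto_ennrealI tendsto_W)
      then show ?case by (simp add: lim_imp_Liminf)
    qed
  qed
  also have "\<dots> \<le> liminf (\<lambda>n. \<integral>\<^sup>+\<nu>. ennreal (real (Z n \<nu>) / a ^ n) \<partial>GW)"
    by (rule nn_integral_liminf) simp
  also have "\<dots> = 1" unfolding one by (simp add: Liminf_const)
  finally show ?thesis .
qed


section \<open>The branching measure\<close>

definition bm :: "(nat list \<Rightarrow> nat) \<Rightarrow> nat stream measure" where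
  "bm \<nu> = (THE \<mu>. finite_measure \<mu> \<and> sets \<mu> = sets borel \<and>
     (\<forall>i. emeasure \<mu> (cylinder i) = (if i \<in> tree \<nu> then ennreal (W (shift i \<nu>) / a ^ length i) else 0)))"

definition bdry :: "(nat list \<Rightarrow> nat) \<Rightarrow> nat stream set" where
  "bdry \<nu> = {x. \<forall>n. stake n x \<in> tree \<nu>}"

text \<open>The masses are consistent because \<open>W\<close> of a vertex is the sum over its
  children divided by \<open>a\<close>; words outside the tree get weight 0, and so do their
  extensions.\<close>

lemma bm_exists:
  assumes reg: "regular \<nu>"
  shows "\<exists>!\<mu>. finite_measure \<mu> \<and> sets \<mu> = sets borel \<and>
     (\<forall>i. emeasure \<mu> (cylinder i) = (if i \<in> tree \<nu> then ennreal (W (shift i \<nu>) / a ^ length i) else 0))"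
    (is "\<exists>!\<mu>. ?P \<mu>")
proof -
  define w where "w i = (if i \<in> tree \<nu> then W (shift i \<nu>) / a ^ length i else 0)" for i
  have "\<exists>\<mu> :: nat stream measure. finite_measure \<mu> \<and> sets \<mu> = sets borel \<and>
    (\<forall>i. emeasure \<mu> (cylinder i) = ennreal (w i))"
  proof (rule ex_measure_cylinder)
    show "0 \<le> w i" for i
      using W_nonneg[OF regular_shift[OF reg]] a_pos by (simp add: w_def)
    show "(\<lambda>j. w (i @ [j])) sums w i" for i
    proof (cases "i \<in> tree \<nu>")
      case True
      have "(\<lambda>j. w (i @ [j])) sums (\<Sum>j<\<nu> i. w (i @ [j]))"
        by (rule sums_finite) (auto simp: w_def tree_snoc)
      also have "(\<Sum>j<\<nu> i. w (i @ [j])) = (\<Sum>j<\<nu> i. W (shift (i @ [j]) \<nu>)) / a / a ^ length i"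
        using True a_pos by (simp add: w_def tree_snoc sum_divide_distrib)
      also have "\<dots> = w i" using True by (simp add: W_shift_eq_sum[OF reg, of i] w_def)
      finally show ?thesis .
    next
      case False
      then show ?thesis by (simp add: w_def tree_snoc sums_zero)
    qed
  qed
  then obtain \<mu> :: "nat stream measure" where mu: "finite_measure \<mu>" "sets \<mu> = sets borel"
    "\<And>i. emeasure \<mu> (cylinder i) = ennreal (w i)" by blast
  then have "?P \<mu>" by (auto simp: w_def)
  moreover have "\<mu>' = \<mu>" if "?P \<mu>'" for \<mu>'
    using that mu by (intro finite_measure_cylinder_eqI) (auto simp: w_def)
  ultimately show ?thesis by blast
qed

lemma
  assumes "regular \<nu>"
  shows finite_bm: "finite_measure (bm \<nu>)"
    and sets_bm: "sets (bm \<nu>) = sets borel"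
    and emeasure_bm_cylinder: "emeasure (bm \<nu>) (cylinder i) =
      (if i \<in> tree \<nu> then ennreal (W (shift i \<nu>) / a ^ length i) else 0)"
  using theI'[OF bm_exists[OF assms]] unfolding bm_def[symmetric] by blast+

lemma measure_bm_cylinder:
  assumes "regular \<nu>" "i \<in> tree \<nu>"
  shows "measure (bm \<nu>) (cylinder i) = W (shift i \<nu>) / a ^ length i"
  using emeasure_bm_cylinder[OF assms(1), of i] W_nonneg[OF regular_shift[OF assms(1)], of i] a_pos assms(2)
  by (simp add: measure_def)

lemma bdry_borel: "bdry \<nu> \<in> sets borel"
proof -
  have "bdry \<nu> = (\<Inter>n. {x. stake n x \<in> tree \<nu>})" by (auto simp: bdry_def)
  also have "\<dots> \<in> sets borel"
    using borel_pred_stake[of "\<lambda>i. i \<in> tree \<nu>"] by (intro sets.countable_INT) (auto simp: pred_def)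
  finally show ?thesis .
qed

lemma AE_bm_bdry:
  assumes "regular \<nu>"
  shows "AE x in bm \<nu>. x \<in> bdry \<nu>"
proof -
  have "AE x in bm \<nu>. x \<notin> cylinder i" if "i \<notin> tree \<nu>" for i
    using that emeasure_bm_cylinder[OF assms, of i] sets_bm[OF assms]
    by (intro AE_not_in) (simp add: null_sets_def)
  then have "AE x in bm \<nu>. \<forall>i\<in>- tree \<nu>. x \<notin> cylinder i"
    by (subst AE_ball_countable) auto
  then show ?thesis
  proof eventually_elim
    case (elim x)
    have "stake n x \<in> tree \<nu>" for n
      using elim by (metis ComplI length_stake mem_cylinder_iff)
    then show ?case by (simp add: bdry_def)
  qed
qed

lemma emeasure_bm_bdry: "regular \<nu> \<Longrightarrow> emeasure (bm \<nu>) (bdry \<nu>) = ennreal (W \<nu>)"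
proof -
  assume reg: "regular \<nu>"
  have "emeasure (bm \<nu>) (bdry \<nu>) = emeasure (bm \<nu>) (cylinder [])"
    using AE_bm_bdry[OF reg] sets_bm[OF reg] bdry_borel
    by (intro emeasure_eq_AE) (auto simp: mem_cylinder_iff)
  then show ?thesis by (simp add: emeasure_bm_cylinder[OF reg] tree.root)
qed


section \<open>Sums along the tree with conditions on the siblings\<close>

definition siblings :: "nat \<Rightarrow> (nat list \<Rightarrow> nat) \<Rightarrow> real" where
  "siblings j \<nu> = (\<Sum>l\<in>{..<\<nu> []} - {j}. W (sub l \<nu>))"

text \<open>With \<open>f = W\<close>, this is the mass that the branching measure gives to the words whose sibling sum at step \<open>m\<close>
  lies in \<open>B m\<close> for all \<open>m < n\<close>.\<close>
primrec R :: "nat \<Rightarrow> (nat \<Rightarrow> real set) \<Rightarrow> ((nat list \<Rightarrow> nat) \<Rightarrow> ennreal) \<Rightarrow> (nat list \<Rightarrow> nat) \<Rightarrow> ennreal" where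
  "R 0 B f \<nu> = f \<nu>"
| "R (Suc n) B f \<nu> =
     (\<Sum>j<\<nu> []. if siblings j \<nu> \<in> B 0 then R n (\<lambda>m. B (Suc m)) f (sub j \<nu>) else 0) * ennreal (1 / a)"

text \<open>The probability that the sibling sum lies in \<open>B\<close> when the root has the
  size-biased offspring law and the next vertex is a uniformly chosen child.\<close>

definition keep :: "real set \<Rightarrow> ennreal" where
  "keep B = (\<integral>\<^sup>+\<nu>. (\<Sum>j<\<nu> []. if siblings j \<nu> \<in> B then 1 else 0) \<partial>GW) * ennreal (1 / a)"

lemma R_eq_sum:
  "R n B f \<nu> = (\<Sum>i\<in>generation n \<nu>.
     if \<forall>m<n. siblings (i ! m) (shift (take m i) \<nu>) \<in> B m then f (shift i \<nu>) else 0) * ennreal ((1 / a) ^ n)"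
proof (induction n arbitrary: B \<nu>)
  case (Suc n)
  have "R (Suc n) B f \<nu> = (\<Sum>j<\<nu> []. if siblings j \<nu> \<in> B 0 then
      (\<Sum>i\<in>generation n (sub j \<nu>). if \<forall>m<n. siblings (i ! m) (shift (take m i) (sub j \<nu>)) \<in> B (Suc m)
        then f (shift i (sub j \<nu>)) else 0) else 0) * (ennreal ((1 / a) ^ n) * ennreal (1 / a))"
    unfolding R.simps Suc mult.assoc[symmetric]
    by (simp add: sum_distrib_right if_distrib[of "\<lambda>x. x * _"] cong: if_cong)
  also have "ennreal ((1 / a) ^ n) * ennreal (1 / a) = ennreal ((1 / a) ^ Suc n)"
    using a_pos by (simp add: ennreal_mult[symmetric] mult.commute)
  also have "(\<Sum>j<\<nu> []. if siblings j \<nu> \<in> B 0 then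
      (\<Sum>i\<in>generation n (sub j \<nu>). if \<forall>m<n. siblings (i ! m) (shift (take m i) (sub j \<nu>)) \<in> B (Suc m)
        then f (shift i (sub j \<nu>)) else 0) else 0)
    = (\<Sum>i\<in>generation (Suc n) \<nu>.
     if \<forall>m<Suc n. siblings (i ! m) (shift (take m i) \<nu>) \<in> B m then f (shift i \<nu>) else 0)"
    unfolding sum_generation_Suc All_less_Suc2 by (auto intro!: sum.cong simp: shift_Cons)
  finally show ?case .
qed (simp add: generation_0)

lemma measurable_siblings [measurable]: "siblings j \<in> borel_measurable GW"
  unfolding siblings_def[abs_def]
  by (rule measurable_children[where F = "\<lambda>r \<nu>. \<Sum>l\<in>{..<r} - {j}. W (sub l \<nu>)"]) measurable

text \<open>For a given root, the sibling sum at \<open>j\<close> involves only the subtrees other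
  than \<open>j\<close>, so resampling subtree \<open>j\<close> leaves the condition unchanged and
  separates \<open>h\<close>.\<close>

lemma nn_integral_siblings:
  assumes B[measurable]: "B \<in> sets borel" and h[measurable]: "h \<in> borel_measurable GW"
  shows "(\<integral>\<^sup>+\<nu>. (\<Sum>j<\<nu> []. if siblings j \<nu> \<in> B then h (sub j \<nu>) else 0) \<partial>GW) * ennreal (1 / a)
    = keep B * (\<integral>\<^sup>+\<nu>. h \<nu> \<partial>GW)"
proof -
  define cond where "cond n j \<xi> \<longleftrightarrow> (\<Sum>l\<in>{..<n} - {j}. W (\<xi> l)) \<in> B" for n j :: nat and \<xi> :: "nat \<Rightarrow> nat list \<Rightarrow> nat"
  have cond_meas[measurable]: "Measurable.pred Forest (cond n j)" for n j
    unfolding cond_def[abs_def] by measurable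
  have split: "(\<integral>\<^sup>+\<nu>. (\<Sum>j<\<nu> []. if siblings j \<nu> \<in> B then g (sub j \<nu>) else 0) \<partial>GW)
      = (\<integral>\<^sup>+n. (\<Sum>j<n. \<integral>\<^sup>+\<xi>. (if cond n j \<xi> then g (\<xi> j) else 0) \<partial>Forest) \<partial>p)"
    if [measurable]: "g \<in> borel_measurable GW" for g :: "_ \<Rightarrow> ennreal"
  proof -
    have "(\<integral>\<^sup>+\<nu>. (\<Sum>j<\<nu> []. if siblings j \<nu> \<in> B then g (sub j \<nu>) else 0) \<partial>GW)
      = (\<integral>\<^sup>+n. \<integral>\<^sup>+\<xi>. (\<Sum>j<n. if cond n j \<xi> then g (\<xi> j) else 0) \<partial>Forest \<partial>p)"
      by (subst nn_integral_GW_split) (simp_all add: measurable_sum_children siblings_def cond_def cong: if_cong)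
    also have "\<dots> = (\<integral>\<^sup>+n. (\<Sum>j<n. \<integral>\<^sup>+\<xi>. (if cond n j \<xi> then g (\<xi> j) else 0) \<partial>Forest) \<partial>p)"
      by (intro nn_integral_cong nn_integral_sum) measurable
    finally show ?thesis .
  qed
  have indep: "(\<integral>\<^sup>+\<xi>. (if cond n j \<xi> then h (\<xi> j) else 0) \<partial>Forest)
      = (\<integral>\<^sup>+\<xi>. (if cond n j \<xi> then 1 else 0) \<partial>Forest) * (\<integral>\<^sup>+\<nu>. h \<nu> \<partial>GW)" for n j
  proof -
    have upd: "cond n j (\<xi>(j := x)) = cond n j \<xi>" for \<xi> x
    proof -
      have "(\<Sum>l\<in>{..<n} - {j}. W ((\<xi>(j := x)) l)) = (\<Sum>l\<in>{..<n} - {j}. W (\<xi> l))"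
        by (rule sum.cong) simp_all
      then show ?thesis by (simp only: cond_def)
    qed
    have "(\<integral>\<^sup>+\<xi>. (if cond n j \<xi> then h (\<xi> j) else 0) \<partial>Forest)
        = (\<integral>\<^sup>+\<xi>. \<integral>\<^sup>+x. (if cond n j \<xi> then h x else 0) \<partial>GW \<partial>Forest)"
      unfolding Forest_def
      by (subst nn_integral_PiM_fun_upd[OF GW.prob_space_axioms, where i = j])
         (simp_all add: Forest_def[symmetric] upd cong: if_cong)
    also have "\<dots> = (\<integral>\<^sup>+\<xi>. (if cond n j \<xi> then 1 else 0) * (\<integral>\<^sup>+\<nu>. h \<nu> \<partial>GW) \<partial>Forest)"
      by (rule nn_integral_cong) simp
    also have "\<dots> = (\<integral>\<^sup>+\<xi>. (if cond n j \<xi> then 1 else 0) \<partial>Forest) * (\<integral>\<^sup>+\<nu>. h \<nu> \<partial>GW)"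
      by (rule nn_integral_multc) measurable
    finally show ?thesis .
  qed
  show ?thesis
    unfolding keep_def split[OF h] split[of "\<lambda>_. 1", simplified] indep sum_distrib_right[symmetric]
    by (subst nn_integral_multc) (simp_all add: measurable_from_p mult_ac)
qed

lemma measurable_R:
  assumes [measurable]: "f \<in> borel_measurable GW" and B: "\<And>m. B m \<in> sets borel"
  shows "R n B f \<in> borel_measurable GW"
  using B
proof (induction n arbitrary: B)
  case 0
  show ?case using assms(1) by (simp add: R.simps(1)[abs_def])
next
  case (Suc n)
  have [measurable]: "R n (\<lambda>m. B (Suc m)) f \<in> borel_measurable GW" "B 0 \<in> sets borel"
    using Suc by auto
  have "(\<lambda>\<nu>. \<Sum>j<\<nu> []. if siblings j \<nu> \<in> B 0 then R n (\<lambda>m. B (Suc m)) f (sub j \<nu>) else 0) \<in> borel_measurable GW"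
    by (rule measurable_sum_children) measurable
  then show ?case by (simp add: R.simps(2)[abs_def])
qed

text \<open>A many-to-one formula: along a path the sibling sums act as independent draws, also
  independent of the subtree at the end. It is used with \<open>f = W\<close>, possibly restricted
  to an event, for masses and with \<open>f = 1\<close> for numbers of words.\<close>

theorem nn_integral_R:
  assumes f[measurable]: "f \<in> borel_measurable GW" and B: "\<And>m. B m \<in> sets borel"
  shows "(\<integral>\<^sup>+\<nu>. R n B f \<nu> \<partial>GW) = (\<Prod>m<n. keep (B m)) * (\<integral>\<^sup>+\<nu>. f \<nu> \<partial>GW)"
  using B
proof (induction n arbitrary: B)
  case (Suc n)
  have meas[measurable]: "R n (\<lambda>m. B (Suc m)) f \<in> borel_measurable GW" "B 0 \<in> sets borel"
    using Suc(2) f by (auto intro: measurable_R)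
  have "(\<integral>\<^sup>+\<nu>. R (Suc n) B f \<nu> \<partial>GW)
      = (\<integral>\<^sup>+\<nu>. (\<Sum>j<\<nu> []. if siblings j \<nu> \<in> B 0 then R n (\<lambda>m. B (Suc m)) f (sub j \<nu>) else 0) \<partial>GW) * ennreal (1 / a)"
    unfolding R.simps by (rule nn_integral_multc) (rule measurable_sum_children, measurable)
  also have "\<dots> = keep (B 0) * (\<integral>\<^sup>+\<nu>. R n (\<lambda>m. B (Suc m)) f \<nu> \<partial>GW)"
    by (rule nn_integral_siblings) measurable
  also have "\<dots> = (\<Prod>m<Suc n. keep (B m)) * (\<integral>\<^sup>+\<nu>. f \<nu> \<partial>GW)"
    using Suc by (simp only: prod.lessThan_Suc_shift mult.assoc)
  finally show ?case .
qed (simp add: R.simps(1)[abs_def])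

lemma keep_UNIV: "keep UNIV = 1"
proof -
  have "(\<integral>\<^sup>+\<nu>. (\<Sum>j<\<nu> []. (1::ennreal)) \<partial>GW) = ennreal a"
    using nn_integral_sum_children[of "\<lambda>_. 1"] GW.emeasure_space_1 by simp
  then show ?thesis
    using a_pos by (simp add: keep_def ennreal_mult[symmetric])
qed

end

section \<open>Upper and lower tail estimates for the sibling sums\<close>

section \<open>The integrated tail\<close>

context offspring_law
begin

text \<open>By the layer cake formula this is the integrated tail at nonnegative arguments, see
  \<open>integrated_tail_eq\<close>. As the mean of a positive part it is easily compared with other
  moments.\<close>

definition K :: "real \<Rightarrow> real" where
  "K x = (\<integral>n. max (real n - x) 0 \<partial>p)"

text \<open>Divided by \<open>a\<close>, this is the tail of the size-biased offspring law.\<close>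

definition tail :: "real \<Rightarrow> ennreal" where
  "tail x = (\<integral>\<^sup>+n. (if real n > x then ennreal (real n) else 0) \<partial>p)"

lemma emeasure_GW_UNIV [simp]: "emeasure GW UNIV = 1"
  and emeasure_Forest_UNIV [simp]: "emeasure Forest UNIV = 1"
  using GW.emeasure_space_1 Forest.emeasure_space_1 by simp_all

lemma measurable_p_any: "f \<in> p \<rightarrow>\<^sub>M N \<longleftrightarrow> f \<in> UNIV \<rightarrow> space N"
  by (simp add: measurable_from_p)

lemma integrable_p_bound:
  fixes f :: "nat \<Rightarrow> real"
  assumes "\<And>n. \<bar>f n\<bar> \<le> c * real n + d"
  shows "integrable p f"
proof (rule Bochner_Integration.integrable_bound)
  show "integrable p (\<lambda>n. c * real n + d)" using integrable_p by simp
  show "AE n in p. norm (f n) \<le> norm (c * real n + d)"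
    using assms by (intro AE_I2) (simp add: order_trans[OF _ abs_ge_self])
qed (simp add: measurable_p_any)

lemma integrable_K: "integrable p (\<lambda>n. max (real n - x) 0)"
  by (rule integrable_p_bound[of _ 1 "\<bar>x\<bar>"]) simp

lemma K_nonneg: "K x \<ge> 0"
  unfolding K_def by (rule integral_nonneg_AE) simp

lemma K_antimono: "x \<le> y \<Longrightarrow> K y \<le> K x"
  unfolding K_def by (intro integral_mono integrable_K) simp

lemma K_0: "K 0 = a"
  by (simp add: K_def)

lemma K_le_a: "x \<ge> 0 \<Longrightarrow> K x \<le> a"
  using K_antimono[of 0 x] by (simp add: K_0)

lemma K_tendsto_0: "(K \<longlongrightarrow> 0) at_top"
proof -
  have "((\<lambda>x. \<integral>n. max (real n - x) 0 \<partial>p) \<longlongrightarrow> (\<integral>n. 0 \<partial>p)) at_top"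
  proof (rule integral_dominated_convergence_at_top)
    show "integrable p real" by (rule integrable_p)
    show "\<forall>\<^sub>F x in at_top. AE n in p. norm (max (real n - x) 0) \<le> real n"
      by (rule eventually_mono[OF eventually_ge_at_top[of 0]]) simp
    show "AE n in p. ((\<lambda>x. max (real n - x) 0) \<longlongrightarrow> 0) at_top"
    proof (rule AE_I2)
      fix n
      have "\<forall>\<^sub>F x in at_top. max (real n - x) 0 = 0"
        by (rule eventually_mono[OF eventually_ge_at_top[of "real n"]]) simp
      then show "((\<lambda>x. max (real n - x) 0) \<longlongrightarrow> 0) at_top"
        by (rule tendsto_eventually)
    qed
  qed (simp_all add: measurable_p_any)
  then show ?thesis by (simp add: K_def[abs_def])
qed

lemma nn_integral_K: "(\<integral>\<^sup>+n. ennreal (real n - x) \<partial>p) = ennreal (K x)"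
  unfolding K_def by (subst nn_integral_eq_integral[OF integrable_K, symmetric]) simp_all

lemma K_le_tail: "x \<ge> 0 \<Longrightarrow> ennreal (K x) \<le> tail x"
  unfolding nn_integral_K[symmetric] tail_def
  by (rule nn_integral_mono) (auto intro!: ennreal_leI simp: ennreal_neg)

text \<open>If \<open>n > x\<close>, then \<open>n \<le> 2 * (n - x / 2)\<close>. The change of
  scale is absorbed by dominated variation later.\<close>

lemma tail_le_K:
  assumes "x \<ge> 0"
  shows "tail x \<le> ennreal (2 * K (x / 2))"
proof -
  have "tail x \<le> (\<integral>\<^sup>+n. ennreal 2 * ennreal (real n - x / 2) \<partial>p)"
    unfolding tail_def ennreal_mult'[symmetric, OF zero_le_numeral]
    using assms by (intro nn_integral_mono) (auto intro!: ennreal_leI)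
  also have "\<dots> = ennreal 2 * ennreal (K (x / 2))"
    by (subst nn_integral_cmult) (simp_all add: measurable_p_any nn_integral_K del: ennreal_numeral)
  finally show ?thesis using K_nonneg by (simp add: ennreal_mult del: ennreal_numeral)
qed

section \<open>Individuals with many children\<close>

text \<open>The thresholds grow like the typical generation size, which makes the total probability of an
  exceedance telescope.\<close>
primrec bad :: "nat \<Rightarrow> real \<Rightarrow> (nat list \<Rightarrow> nat) \<Rightarrow> bool" where
  "bad 0 y \<nu> \<longleftrightarrow> False"
| "bad (Suc n) y \<nu> \<longleftrightarrow> y < real (\<nu> []) \<or> (\<exists>k<\<nu> []. bad n (a * y) (sub k \<nu>))"

definition ever_bad :: "real \<Rightarrow> (nat list \<Rightarrow> nat) \<Rightarrow> bool" where
  "ever_bad y \<nu> \<longleftrightarrow> (\<exists>n. bad n y \<nu>)"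

text \<open>A vertex above its threshold loses all its children, not just the surplus. An offspring
  number then counts fully or not at all, which is how the moments \<open>V\<close> and
  \<open>large\<close> arise.\<close>

primrec Zt :: "nat \<Rightarrow> real \<Rightarrow> (nat list \<Rightarrow> nat) \<Rightarrow> nat" where
  "Zt 0 y \<nu> = 1"
| "Zt (Suc n) y \<nu> = (if real (\<nu> []) \<le> y then \<Sum>k<\<nu> []. Zt n (a * y) (sub k \<nu>) else 0)"

lemma bad_Suc: "bad n y \<nu> \<Longrightarrow> bad (Suc n) y \<nu>"
proof (induction n arbitrary: y \<nu>)
  case (Suc n)
  then show ?case unfolding bad.simps(2)[of "Suc n"] by (metis bad.simps(2))
qed simp

lemma Zt_le_Z: "Zt n y \<nu> \<le> Z n \<nu>"
  by (induction n arbitrary: y \<nu>) (auto intro!: sum_mono)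

lemma Zt_eq_Z: "\<not> bad n y \<nu> \<Longrightarrow> Zt n y \<nu> = Z n \<nu>"
  by (induction n arbitrary: y \<nu>) (auto intro!: sum.cong)

lemma measurable_bad [measurable]: "Measurable.pred GW (bad n y)"
proof (induction n arbitrary: y)
  case 0
  show ?case by (simp add: bad.simps(1)[abs_def])
next
  case (Suc n)
  have [measurable]: "Measurable.pred GW (bad n (a * y))" by (rule Suc)
  have "Measurable.pred GW (\<lambda>\<nu>. \<exists>k<\<nu> []. bad n (a * y) (sub k \<nu>))"
    by (rule measurable_children[where F = "\<lambda>r \<nu>. \<exists>k<r. bad n (a * y) (sub k \<nu>)"]) measurable
  then show ?case by (simp add: bad.simps(2)[abs_def])
qed

lemma measurable_ever_bad [measurable]: "Measurable.pred GW (ever_bad y)"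
  unfolding ever_bad_def[abs_def] by measurable

lemma measurable_Zt [measurable]: "(\<lambda>\<nu>. real (Zt n y \<nu>)) \<in> borel_measurable GW"
proof (induction n arbitrary: y)
  case (Suc n)
  have "(\<lambda>\<nu>. \<Sum>k<\<nu> []. real (Zt n (a * y) (sub k \<nu>))) \<in> borel_measurable GW"
    by (rule measurable_sum_children) (rule measurable_compose[OF measurable_sub Suc])
  then show ?case by (simp add: if_distrib[of real] cong: if_cong)
qed simp

lemma nn_integral_indicator_eval:
  "(\<integral>\<^sup>+\<nu>. f (\<nu> []) \<partial>GW) = (\<integral>\<^sup>+n. f n \<partial>p)" for f :: "nat \<Rightarrow> ennreal"
  by (subst nn_integral_GW_split) (simp_all)

text \<open>The bound \<open>h y = a / (a - 1) * K (y / a) / y\<close> satisfies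
  \<open>P (N > y) + a * h (a * y) \<le> h y\<close>, because
  \<open>K (y / a) - K y \<ge> (y - y / a) * P (N > y)\<close>. This is the inequality that the
  union bound over the root and its subtrees requires.\<close>

lemma bad_probability:
  assumes "y > 0"
  shows "(\<integral>\<^sup>+\<nu>. (if bad n y \<nu> then 1 else 0) \<partial>GW) \<le> ennreal (a / (a - 1) * K (y / a) / y)"
  using assms
proof (induction n arbitrary: y)
  case (Suc n)
  have IH: "(\<integral>\<^sup>+\<nu>. (if bad n (a * y) \<nu> then 1 else 0) \<partial>GW) \<le> ennreal (a / (a - 1) * K y / (a * y))"
    using Suc.IH[of "a * y"] Suc.prems a_pos by simp
  have int: "integrable p (\<lambda>n. if y < real n then 1 else 0 :: real)"
    by (rule integrable_p_bound[of _ 0 1]) simp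
  have "(\<integral>\<^sup>+\<nu>. (if bad (Suc n) y \<nu> then 1 else 0) \<partial>GW)
      \<le> (\<integral>\<^sup>+\<nu>. (if y < real (\<nu> []) then 1 else 0) + (\<Sum>k<\<nu> []. if bad n (a * y) (sub k \<nu>) then 1 else 0) \<partial>GW)"
  proof (rule nn_integral_mono)
    fix \<nu>
    show "(if bad (Suc n) y \<nu> then 1 else 0) \<le> (if y < real (\<nu> []) then 1 else 0) +
        (\<Sum>k<\<nu> []. if bad n (a * y) (sub k \<nu>) then 1 else 0 :: ennreal)"
    proof (cases "\<exists>k<\<nu> []. bad n (a * y) (sub k \<nu>)")
      case True
      then obtain k where k: "k < \<nu> []" "bad n (a * y) (sub k \<nu>)" by blast
      then have "(1::ennreal) \<le> (\<Sum>k<\<nu> []. if bad n (a * y) (sub k \<nu>) then 1 else 0)"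
        using member_le_sum[of k "{..<\<nu> []}" "\<lambda>k. if bad n (a * y) (sub k \<nu>) then 1 else 0 :: ennreal"] by simp
      then show ?thesis by (simp add: add_increasing)
    qed auto
  qed
  also have "\<dots> = (\<integral>\<^sup>+n. (if y < real n then 1 else 0) \<partial>p) +
      ennreal a * (\<integral>\<^sup>+\<nu>. (if bad n (a * y) \<nu> then 1 else 0) \<partial>GW)"
    by (subst nn_integral_add)
       (simp_all add: measurable_sum_children nn_integral_sum_children[where h = "\<lambda>\<nu>. if bad n (a * y) \<nu> then 1 else 0"]
         nn_integral_indicator_eval[where f = "\<lambda>n. if y < real n then 1 else 0"])
  also have "(\<integral>\<^sup>+n. (if y < real n then 1 else 0) \<partial>p) = ennreal (\<integral>n. (if y < real n then 1 else 0) \<partial>p)"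
    by (subst nn_integral_eq_integral[OF int, symmetric]) (auto intro!: nn_integral_cong)
  also have "ennreal (\<integral>n. (if y < real n then 1 else 0) \<partial>p) + ennreal a * (\<integral>\<^sup>+\<nu>. (if bad n (a * y) \<nu> then 1 else 0) \<partial>GW)
      \<le> ennreal (\<integral>n. (if y < real n then 1 else 0) \<partial>p) + ennreal a * ennreal (a / (a - 1) * K y / (a * y))"
    by (intro add_left_mono mult_left_mono IH) simp
  also have "\<dots> = ennreal ((\<integral>n. (if y < real n then 1 else 0) \<partial>p) + a / (a - 1) * K y / y)"
  proof -
    have "ennreal a * ennreal (a / (a - 1) * K y / (a * y)) = ennreal (a / (a - 1) * K y / y)"
      using a_gt_1 Suc.prems K_nonneg[of y] by (subst ennreal_mult[symmetric]) simp_all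
    then show ?thesis
      using a_gt_1 Suc.prems K_nonneg[of y]
      by (simp only:) (intro ennreal_plus[symmetric] integral_nonneg_AE, simp_all)
  qed
  also have "\<dots> \<le> ennreal (a / (a - 1) * K (y / a) / y)"
  proof (rule ennreal_leI)
    \<comment> \<open>On \<open>n > y\<close> the difference of the two positive parts is exactly
      \<open>y - y / a\<close>.\<close>
    have "(\<integral>n. (y - y / a) * (if y < real n then 1 else 0) \<partial>p) \<le> (\<integral>n. max (real n - y / a) 0 - max (real n - y) 0 \<partial>p)"
    proof (rule integral_mono)
      have "y / a \<le> y" using Suc.prems a_gt_1 by (simp add: field_simps)
      then show "(y - y / a) * (if y < real n then 1 else 0) \<le> max (real n - y / a) 0 - max (real n - y) 0" for n
        by (auto simp: max_def)
    qed (use int integrable_K in auto)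
    then have "(y - y / a) * (\<integral>n. (if y < real n then 1 else 0) \<partial>p) \<le> K (y / a) - K y"
      using integrable_K by (simp add: K_def)
    moreover have "y - y / a = y * (a - 1) / a" using a_pos by (simp add: field_simps)
    ultimately have "y * (a - 1) / a * (\<integral>n. (if y < real n then 1 else 0) \<partial>p) + K y \<le> K (y / a)" by simp
    then have "a / (a - 1) / y * (y * (a - 1) / a * (\<integral>n. (if y < real n then 1 else 0) \<partial>p) + K y) \<le> a / (a - 1) / y * K (y / a)"
      using a_gt_1 Suc.prems by (intro mult_left_mono) simp_all
    then show "(\<integral>n. (if y < real n then 1 else 0) \<partial>p) + a / (a - 1) * K y / y \<le> a / (a - 1) * K (y / a) / y"
      using a_gt_1 Suc.prems by (simp add: distrib_left)
  qed
  finally show ?case .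
qed simp

lemma ever_bad_probability:
  assumes "y > 0"
  shows "(\<integral>\<^sup>+\<nu>. (if ever_bad y \<nu> then 1 else 0) \<partial>GW) \<le> ennreal (a / (a - 1) * K (y / a) / y)"
proof -
  have eq: "(if ever_bad y \<nu> then 1 else 0) = (SUP n. if bad n y \<nu> then 1 else 0 :: ennreal)" for \<nu>
  proof (cases "ever_bad y \<nu>")
    case True
    then obtain n where "bad n y \<nu>" by (auto simp: ever_bad_def)
    then have "1 \<le> (SUP n. if bad n y \<nu> then 1 else 0 :: ennreal)"
      by (intro SUP_upper2[of n]) auto
    moreover have "(SUP n. if bad n y \<nu> then 1 else 0 :: ennreal) \<le> 1" by (intro SUP_least) auto
    ultimately show ?thesis using True by simp
  qed (simp add: ever_bad_def)
  have "(\<integral>\<^sup>+\<nu>. (if ever_bad y \<nu> then 1 else 0) \<partial>GW) = (SUP n. \<integral>\<^sup>+\<nu>. (if bad n y \<nu> then 1 else 0) \<partial>GW)"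
    unfolding eq
  proof (rule nn_integral_monotone_convergence_SUP)
    show "incseq (\<lambda>n \<nu>. if bad n y \<nu> then 1 else 0 :: ennreal)"
      using bad_Suc by (intro incseq_SucI le_funI) (simp del: bad.simps)
  qed measurable
  also have "\<dots> \<le> ennreal (a / (a - 1) * K (y / a) / y)"
    using bad_probability[OF assms] by (rule SUP_least)
  finally show ?thesis .
qed

section \<open>Exponential moments of truncated trees\<close>

definition V :: "real \<Rightarrow> real" where
  "V y = (\<integral>n. (if real n \<le> y then (real n)\<^sup>2 else 0) \<partial>p)"

text \<open>The truncation acts on one factor only. This makes \<open>V_le_E2\<close> telescope: the
  sum of \<open>V (a ^ k * y) / a ^ k\<close> over all \<open>k\<close> is at most
  \<open>E2 y / (1 - 1 / a)\<close>.\<close>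

definition E2 :: "real \<Rightarrow> real" where
  "E2 y = (\<integral>n. real n * min (real n) y \<partial>p)"

lemma integrable_V: "y \<ge> 0 \<Longrightarrow> integrable p (\<lambda>n. if real n \<le> y then (real n)\<^sup>2 else 0)"
  by (rule integrable_p_bound[of _ y 0]) (auto simp: power2_eq_square intro: mult_right_mono)

lemma integrable_E2: "y \<ge> 0 \<Longrightarrow> integrable p (\<lambda>n. real n * min (real n) y)"
  by (rule integrable_p_bound[of _ y 0]) (auto simp: abs_mult min_def mult.commute intro: mult_right_mono)

lemma V_nonneg: "V y \<ge> 0"
  unfolding V_def by (rule integral_nonneg_AE) simp

lemma E2_nonneg: "y \<ge> 0 \<Longrightarrow> E2 y \<ge> 0"
  unfolding E2_def by (rule integral_nonneg_AE) simp

text \<open>Replacing \<open>y\<close> by \<open>a * y\<close> and dividing by \<open>a\<close>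
  turns \<open>min n y\<close> into \<open>min (n / a) y\<close>, which for \<open>n \<le> y\<close>
  is smaller by \<open>n - n / a\<close>.\<close>

lemma V_le_E2: "y \<ge> 0 \<Longrightarrow> (1 - 1 / a) * V y \<le> E2 y - E2 (a * y) / a"
proof -
  assume y: "y \<ge> 0"
  then have ay: "a * y \<ge> 0" using a_pos by simp
  have "(\<integral>n. (1 - 1 / a) * (if real n \<le> y then (real n)\<^sup>2 else 0) \<partial>p) \<le>
    (\<integral>n. real n * min (real n) y - real n * min (real n) (a * y) / a \<partial>p)"
  proof (rule integral_mono)
    fix n
    have 1: "real n / a \<le> real n"
      using mult_left_mono[of 1 a "real n"] a_gt_1 by (simp add: divide_le_eq)
    have "min (real n) (a * y) / a = min (real n / a) y"
      using a_pos by (simp add: min_def field_simps)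
    then have "real n * min (real n) y - real n * min (real n) (a * y) / a = real n * (min (real n) y - min (real n / a) y)"
      by (simp only: times_divide_eq_right[symmetric] right_diff_distrib)
    moreover have "(if real n \<le> y then real n - real n / a else 0) \<le> min (real n) y - min (real n / a) y"
      using 1 by (auto simp: min_def)
    then have "real n * (if real n \<le> y then real n - real n / a else 0) \<le> real n * (min (real n) y - min (real n / a) y)"
      by (rule mult_left_mono) simp
    moreover have "(1 - 1 / a) * (if real n \<le> y then (real n)\<^sup>2 else 0) = real n * (if real n \<le> y then real n - real n / a else 0)"
      by (simp add: power2_eq_square algebra_simps)
    ultimately show "(1 - 1 / a) * (if real n \<le> y then (real n)\<^sup>2 else 0)
        \<le> real n * min (real n) y - real n * min (real n) (a * y) / a" by linarith
  qed (use integrable_V[OF y] integrable_E2[OF y] integrable_E2[OF ay] in auto)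
  then show ?thesis
    using integrable_E2[OF y] integrable_E2[OF ay] by (simp add: V_def E2_def)
qed

text \<open>This is \<open>1 - t \<le> exp (- t)\<close> multiplied by
  \<open>(1 + t) * exp t\<close>.\<close>

lemma exp_le_quadratic: "t \<ge> 0 \<Longrightarrow> exp t \<le> 1 + t + t\<^sup>2 * exp t" for t :: real
proof -
  assume t: "t \<ge> 0"
  have "(1 + t) * (1 - t) \<le> (1 + t) * exp (- t)"
    using exp_ge_add_one_self[of "- t"] t by (intro mult_left_mono) auto
  then have "1 * exp t \<le> ((1 + t) * exp (- t) + t\<^sup>2) * exp t"
    by (intro mult_right_mono) (auto simp: algebra_simps power2_eq_square)
  then show ?thesis by (simp add: distrib_right mult.assoc mult_exp_exp)
qed

lemma nn_integral_Forest_prod: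
  assumes "finite S" and f[measurable]: "f \<in> borel_measurable GW"
  shows "(\<integral>\<^sup>+\<xi>. (\<Prod>l\<in>S. f (\<xi> l)) \<partial>Forest) = (\<integral>\<^sup>+\<nu>. f \<nu> \<partial>GW) ^ card S"
  using assms(1)
proof (induction S rule: finite_induct)
  case empty
  then show ?case by (simp)
next
  case (insert j S)
  have upd: "(\<Prod>l\<in>S. f ((\<xi>(j := x)) l)) = (\<Prod>l\<in>S. f (\<xi> l))" for \<xi> x
    using insert.hyps by (intro prod.cong) auto
  have "(\<integral>\<^sup>+\<xi>. (\<Prod>l\<in>insert j S. f (\<xi> l)) \<partial>Forest) = (\<integral>\<^sup>+\<xi>. \<integral>\<^sup>+x. f x * (\<Prod>l\<in>S. f (\<xi> l)) \<partial>GW \<partial>Forest)"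
    unfolding Forest_def
    by (subst nn_integral_PiM_fun_upd[OF GW.prob_space_axioms, where i = j])
       (simp_all add: Forest_def[symmetric] insert.hyps upd del: fun_upd_apply, simp add: upd)
  also have "\<dots> = (\<integral>\<^sup>+\<xi>. (\<integral>\<^sup>+\<nu>. f \<nu> \<partial>GW) * (\<Prod>l\<in>S. f (\<xi> l)) \<partial>Forest)"
    by (intro nn_integral_cong nn_integral_multc) measurable
  also have "\<dots> = (\<integral>\<^sup>+\<nu>. f \<nu> \<partial>GW) ^ card (insert j S)"
    using insert by (subst nn_integral_cmult) simp_all
  finally show ?case .
qed

definition mgf :: "nat \<Rightarrow> real \<Rightarrow> real \<Rightarrow> ennreal" where
  "mgf n y l = (\<integral>\<^sup>+\<nu>. ennreal (exp (l * (real (Zt n y \<nu>) / a ^ n))) \<partial>GW)"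

lemma mgf_0: "mgf 0 y l = ennreal (exp l)"
  by (simp add: mgf_def)

lemma mgf_Suc: "mgf (Suc n) y l = (\<integral>\<^sup>+k. (if real k \<le> y then mgf n (a * y) (l / a) ^ k else 1) \<partial>p)"
proof -
  have eq: "ennreal (exp (l * (real (Zt (Suc n) y (join k \<xi>)) / a ^ Suc n))) =
    (if real k \<le> y then \<Prod>i<k. ennreal (exp (l / a * (real (Zt n (a * y) (\<xi> i)) / a ^ n))) else 1)" for k \<xi>
    by (simp add: prod_ennreal exp_sum[symmetric] sum_distrib_left sum_divide_distrib mult.commute)
  have "mgf (Suc n) y l = (\<integral>\<^sup>+k. \<integral>\<^sup>+\<xi>.
      (if real k \<le> y then \<Prod>i<k. ennreal (exp (l / a * (real (Zt n (a * y) (\<xi> i)) / a ^ n))) else 1) \<partial>Forest \<partial>p)"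
    unfolding mgf_def by (subst nn_integral_GW_split) (measurable, simp only: eq)
  also have "\<dots> = (\<integral>\<^sup>+k. (if real k \<le> y then mgf n (a * y) (l / a) ^ k else 1) \<partial>p)"
  proof (rule nn_integral_cong)
    fix k
    show "(\<integral>\<^sup>+\<xi>. (if real k \<le> y then \<Prod>i<k. ennreal (exp (l / a * (real (Zt n (a * y) (\<xi> i)) / a ^ n))) else 1) \<partial>Forest)
        = (if real k \<le> y then mgf n (a * y) (l / a) ^ k else 1)"
      using nn_integral_Forest_prod[of "{..<k}" "\<lambda>\<nu>. ennreal (exp (l / a * (real (Zt n (a * y) \<nu>) / a ^ n)))"]
      by (simp add: mgf_def)
  qed
  finally show ?thesis .
qed

text \<open>The product \<open>l * y\<close> is invariant under passing from a tree to the subtrees of its root, and \<open>B * l * E2 y\<close>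
  collects the second order errors of all generations.\<close>
lemma mgf_le:
  assumes B: "B = 2 / a\<^sup>2 * exp (2 * L) / (1 - 1 / a)"
    and "y > 0" "l \<ge> 0" "l * y \<le> L" "B * l * E2 y \<le> ln 2"
  shows "mgf n y l \<le> ennreal (exp (l * exp (B * l * E2 y)))"
  using assms(2-)
proof (induction n arbitrary: y l)
  case 0
  have "B \<ge> 0" using a_gt_1 by (simp add: B)
  then have "exp (B * l * E2 y) \<ge> 1" using 0 E2_nonneg[of y] by simp
  then have "l * 1 \<le> l * exp (B * l * E2 y)" using 0 by (intro mult_left_mono) auto
  then show ?case by (simp add: mgf_0 ennreal_leI)
next
  case (Suc n)
  note y = Suc.prems(1) and l = Suc.prems(2) and ly = Suc.prems(3) and small = Suc.prems(4)
  have B0: "B \<ge> 0" using a_gt_1 by (simp add: B)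
  \<comment> \<open>\<open>h'\<close> is the accumulated error of the subtrees, with the parameters
    \<open>l / a\<close> and \<open>a * y\<close> that belong to a child; \<open>exp u\<close>
    bounds the exponential moment of one subtree.\<close>
  define h' where "h' = B * (l / a) * E2 (a * y)"
  define u where "u = l / a * exp h'"
  have ay: "a * y > 0" using y a_pos by simp
  have V: "(1 - 1 / a) * V y \<le> E2 y - E2 (a * y) / a" using y by (intro V_le_E2) simp
  have E2: "E2 (a * y) / a \<le> E2 y"
  proof -
    have "0 \<le> (1 - 1 / a) * V y"
      using V_nonneg a_gt_1 by (intro mult_nonneg_nonneg) simp_all
    then show ?thesis using V by linarith
  qed
  have h'_le: "h' \<le> B * l * E2 y"
    using mult_left_mono[OF E2, of "B * l"] B0 l by (simp add: h'_def)
  have h'_ln2: "h' \<le> ln 2" using h'_le small by simp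
  have exph': "exp h' \<le> 2" using h'_ln2 by (metis exp_le_cancel_iff exp_ln zero_less_numeral)
  have u0: "u \<ge> 0" using l a_pos by (simp add: u_def)
  have u_le: "u \<le> 2 * l / a"
    using mult_left_mono[OF exph', of "l / a"] l a_pos by (simp add: u_def mult.commute)
  have IH: "mgf n (a * y) (l / a) \<le> ennreal (exp u)"
  proof -
    have "l / a * (a * y) \<le> L" using ly a_pos by simp
    moreover have "B * (l / a) * E2 (a * y) \<le> ln 2" using h'_ln2 by (simp add: h'_def)
    ultimately have "mgf n (a * y) (l / a) \<le> ennreal (exp (l / a * exp (B * (l / a) * E2 (a * y))))"
      using ay l a_pos by (intro Suc.IH) simp_all
    then show ?thesis by (simp add: u_def h'_def)
  qed
  \<comment> \<open>On the truncated offspring the exponent stays below \<open>2 * L\<close>, which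
    is the origin of \<open>exp (2 * L)\<close> in \<open>B\<close>.\<close>
  have uk: "u * real k \<le> 2 * L" if "real k \<le> y" for k
  proof -
    have "u * real k \<le> 2 * l / a * y" using u_le that l a_pos by (intro mult_mono) auto
    also have "\<dots> \<le> 2 * l * y"
      using mult_left_mono[of 1 a "2 * l * y"] l y a_gt_1 by (simp add: pos_divide_le_eq)
    finally show ?thesis using ly by simp
  qed
  have "mgf (Suc n) y l \<le> (\<integral>\<^sup>+k. ennreal (1 + u * real k + u\<^sup>2 * exp (2 * L) * (if real k \<le> y then (real k)\<^sup>2 else 0)) \<partial>p)"
    unfolding mgf_Suc
  proof (rule nn_integral_mono)
    fix k
    show "(if real k \<le> y then mgf n (a * y) (l / a) ^ k else 1) \<le>
        ennreal (1 + u * real k + u\<^sup>2 * exp (2 * L) * (if real k \<le> y then (real k)\<^sup>2 else 0))"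
    proof (cases "real k \<le> y")
      case True
      have "mgf n (a * y) (l / a) ^ k \<le> ennreal (exp u) ^ k" by (rule power_mono[OF IH]) simp
      also have "\<dots> = ennreal (exp (u * real k))"
        by (simp add: ennreal_power exp_of_nat_mult[symmetric] mult.commute)
      also have "\<dots> \<le> ennreal (1 + u * real k + u\<^sup>2 * exp (2 * L) * (real k)\<^sup>2)"
      proof (rule ennreal_leI)
        have "exp (u * real k) \<le> 1 + u * real k + (u * real k)\<^sup>2 * exp (u * real k)"
          using u0 by (intro exp_le_quadratic) simp
        also have "(u * real k)\<^sup>2 * exp (u * real k) \<le> (u * real k)\<^sup>2 * exp (2 * L)"
          using uk[OF True] by (intro mult_left_mono) simp_all
        finally show "exp (u * real k) \<le> 1 + u * real k + u\<^sup>2 * exp (2 * L) * (real k)\<^sup>2"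
          by (simp add: power_mult_distrib mult_ac)
      qed
      finally show ?thesis using True by simp
    next
      case False
      then show ?thesis using u0 by (simp add: ennreal_leI[of 1, simplified])
    qed
  qed
  also have "\<dots> = ennreal (\<integral>k. 1 + u * real k + u\<^sup>2 * exp (2 * L) * (if real k \<le> y then (real k)\<^sup>2 else 0) \<partial>p)"
    using integrable_p integrable_V[of y] y u0 by (intro nn_integral_eq_integral) auto
  also have "(\<integral>k. 1 + u * real k + u\<^sup>2 * exp (2 * L) * (if real k \<le> y then (real k)\<^sup>2 else 0) \<partial>p)
      = 1 + u * a + u\<^sup>2 * exp (2 * L) * V y"
    using integrable_p integrable_V[of y] y by (simp add: V_def p.prob_space)
  also have "\<dots> \<le> exp (l * exp (B * l * E2 y))"
  proof -
    \<comment> \<open>The second order error of this generation. The constant \<open>B\<close> is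
      chosen such that \<open>e = B * l * ((1 - 1 / a) * V y)\<close>, to which
      \<open>V_le_E2\<close> applies.\<close>
    define e where "e = 2 / a\<^sup>2 * exp (2 * L) * l * V y"
    have "u\<^sup>2 * exp (2 * L) * V y = u * a * (u / a * exp (2 * L) * V y)"
      using a_pos by (simp add: power2_eq_square)
    also have "\<dots> \<le> u * a * e"
    proof (rule mult_left_mono)
      have "u / a \<le> 2 * l / a / a" using u_le a_pos by (intro divide_right_mono) auto
      then have "u / a * (exp (2 * L) * V y) \<le> 2 * l / a / a * (exp (2 * L) * V y)"
        using V_nonneg by (intro mult_right_mono) auto
      then show "u / a * exp (2 * L) * V y \<le> e" by (simp add: e_def power2_eq_square mult_ac)
    qed (use u0 a_pos in simp)
    finally have "1 + u * a + u\<^sup>2 * exp (2 * L) * V y \<le> 1 + u * a * (1 + e)" by (simp add: algebra_simps)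
    also have "\<dots> \<le> 1 + u * a * exp e"
      using u0 a_pos by (intro add_left_mono mult_left_mono exp_ge_add_one_self) simp
    also have "\<dots> \<le> exp (u * a * exp e)" by (rule exp_ge_add_one_self)
    also have "u * a * exp e = l * exp (h' + e)"
      using a_pos by (simp add: u_def exp_add)
    also have "exp (l * exp (h' + e)) \<le> exp (l * exp (B * l * E2 y))"
    proof -
      have "e = B * l * ((1 - 1 / a) * V y)"
        using a_gt_1 by (simp add: e_def B)
      also have "\<dots> \<le> B * l * (E2 y - E2 (a * y) / a)"
        using V B0 l by (intro mult_left_mono) simp_all
      finally have "h' + e \<le> B * l * E2 y" by (simp add: h'_def right_diff_distrib)
      then show ?thesis using l by (simp add: mult_left_mono)
    qed
    finally show ?thesis .
  qed
  finally show ?case by (simp add: ennreal_leI)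
qed

end

section \<open>Dominated variation\<close>

locale dominated_law = offspring_law +
  assumes xlogx: "integrable p (\<lambda>n. real n * ln (real n))"
    and dominated: "dominated_variation K"
begin

lemma K_pos: "K x > 0"
proof -
  have "K (max x 1) > 0" using dominated by (simp add: dominated_variation_def)
  also have "K (max x 1) \<le> K x" by (rule K_antimono) simp
  finally show ?thesis .
qed

lemma doubling: obtains D where "D \<ge> 2" "\<And>x. x \<ge> 0 \<Longrightarrow> K x \<le> D * K (2 * x)"
proof -
  have "0 < Liminf at_top (\<lambda>x. ereal (K (2 * x) / K x))"
    using dominated by (simp add: dominated_variation_def)
  then obtain c where c: "0 < ereal c" "ereal c < Liminf at_top (\<lambda>x. ereal (K (2 * x) / K x))"
    using ereal_dense2 by blast
  then have "\<forall>\<^sub>F x in at_top. ereal c < ereal (K (2 * x) / K x)" by (intro less_LiminfD)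
  then obtain x0 where x0: "\<And>x. x \<ge> x0 \<Longrightarrow> c < K (2 * x) / K x"
    by (auto simp: eventually_at_top_linorder)
  have c0: "c > 0" using c by simp
  \<comment> \<open>The liminf controls large arguments only. For smaller ones,
    \<open>K x \<le> a\<close> and \<open>K (2 * x)\<close> is at least \<open>K (2 * x0)\<close>.
    The bound 2 makes \<open>ln D\<close> positive later.\<close>
  define D where "D = max 2 (max (1 / c) (a / K (2 * x0)))"
  have "K x \<le> D * K (2 * x)" if "x \<ge> 0" for x
  proof (cases "x \<ge> x0")
    case True
    have "c * K x \<le> K (2 * x)" using x0[OF True] K_pos[of x] by (simp add: pos_less_divide_eq)
    then have "K x \<le> 1 / c * K (2 * x)" using c0 by (simp add: pos_le_divide_eq mult.commute)
    also have "\<dots> \<le> D * K (2 * x)" using K_nonneg by (intro mult_right_mono) (simp_all add: D_def)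
    finally show ?thesis .
  next
    case False
    have "K x \<le> a" using that by (rule K_le_a)
    also have "a = a / K (2 * x0) * K (2 * x0)" using K_pos[of "2 * x0"] by simp
    also have "\<dots> \<le> a / K (2 * x0) * K (2 * x)"
      using False a_pos K_nonneg[of "2 * x0"] by (intro mult_left_mono K_antimono) simp_all
    also have "\<dots> \<le> D * K (2 * x)" using K_nonneg by (intro mult_right_mono) (simp_all add: D_def)
    finally show ?thesis .
  qed
  moreover have "D \<ge> 2" by (simp add: D_def)
  ultimately show thesis using that by blast
qed

lemma K_le_power:
  assumes D: "D \<ge> 0" "\<And>x. x \<ge> 0 \<Longrightarrow> K x \<le> D * K (2 * x)" and x: "x \<ge> 0"
  shows "K x \<le> D ^ m * K (2 ^ m * x)"
proof (induction m)
  case (Suc m)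
  have "K (2 ^ m * x) \<le> D * K (2 * (2 ^ m * x))" using x by (intro D(2)) simp
  then have "D ^ m * K (2 ^ m * x) \<le> D ^ m * (D * K (2 * (2 ^ m * x)))"
    using D(1) by (intro mult_left_mono) simp_all
  then show ?case using Suc by (simp add: mult_ac)
qed simp

text \<open>Doubling is iterated until \<open>2 ^ m\<close> exceeds \<open>r\<close>.\<close>

lemma scaling:
  obtains C where "C > 0" "\<And>x. x \<ge> 0 \<Longrightarrow> K x \<le> C * K (r * x)"
proof -
  obtain D where D: "D \<ge> 2" "\<And>x. x \<ge> 0 \<Longrightarrow> K x \<le> D * K (2 * x)" by (rule doubling) blast
  obtain m where m: "r < 2 ^ m" using real_arch_pow[of 2 r] by auto
  have "K x \<le> D ^ m * K (r * x)" if "x \<ge> 0" for x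
  proof -
    have "K x \<le> D ^ m * K (2 ^ m * x)" using D that by (intro K_le_power) auto
    also have "\<dots> \<le> D ^ m * K (r * x)"
      using m that D(1) by (intro mult_left_mono K_antimono mult_right_mono) simp_all
    finally show ?thesis .
  qed
  then show thesis using that[of "D ^ m"] D(1) by simp
qed

text \<open>Split at \<open>n = t * y\<close>. Below it, \<open>min n y \<le> t * y\<close>; above
  it, \<open>n \<le> 2 * (n - t * y / 2)\<close>. The first part is small with \<open>t\<close>, the
  second is governed by \<open>K\<close>.\<close>

lemma E2_le:
  assumes y: "y > 0" and t: "0 \<le> t" "t \<le> 1"
  shows "E2 y \<le> y * (a * t + 2 * K (t * y / 2))"
proof -
  have "E2 y \<le> (\<integral>n. y * t * real n + 2 * y * max (real n - t * y / 2) 0 \<partial>p)"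
    unfolding E2_def
  proof (rule integral_mono)
    fix n
    show "real n * min (real n) y \<le> y * t * real n + 2 * y * max (real n - t * y / 2) 0"
    proof (cases "real n \<le> t * y")
      case True
      then have "real n * min (real n) y \<le> real n * (t * y)" by (intro mult_left_mono) simp_all
      also have "\<dots> \<le> y * t * real n + 2 * y * max (real n - t * y / 2) 0" using y by simp
      finally show ?thesis .
    next
      case False
      have "real n * min (real n) y \<le> real n * y" by (intro mult_left_mono) simp_all
      also have "\<dots> \<le> 2 * (real n - t * y / 2) * y" using False y by (intro mult_right_mono) simp_all
      also have "\<dots> = 2 * y * (real n - t * y / 2)" by simp
      also have "\<dots> \<le> 2 * y * max (real n - t * y / 2) 0" using y by (intro mult_left_mono) simp_all
      also have "\<dots> \<le> y * t * real n + 2 * y * max (real n - t * y / 2) 0" using y t by simp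
      finally show ?thesis .
    qed
  qed (use integrable_E2[of y] integrable_p integrable_K y in auto)
  also have "\<dots> = y * t * a + 2 * y * K (t * y / 2)"
    using integrable_p integrable_K by (simp add: K_def)
  finally show ?thesis by (simp add: algebra_simps)
qed

lemma eventually_K_less: "c > 0 \<Longrightarrow> \<forall>\<^sub>F y in at_top. K y < c"
  by (rule order_tendstoD(2)[OF K_tendsto_0])

lemma tendsto_K_powr: "s > 0 \<Longrightarrow> ((\<lambda>y. K y powr s) \<longlongrightarrow> 0) at_top"
  by (rule tendsto_zero_powrI[OF K_tendsto_0 tendsto_const]) (simp_all add: K_nonneg)

text \<open>That \<open>E2 y / y\<close> gains a power of \<open>K y\<close> leaves room for an
  exponential parameter of the order \<open>ln (1 / K y) / y\<close>, and with such a parameter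
  Chernoff bounds reach the order of \<open>K y\<close> itself.\<close>

lemma E2_le_powr:
  obtains s C where "s > 0" "C > 0" "\<forall>\<^sub>F y in at_top. E2 y / y \<le> C * K y powr s"
proof -
  obtain D where D: "D \<ge> 2" "\<And>x. x \<ge> 0 \<Longrightarrow> K x \<le> D * K (2 * x)" by (rule doubling) blast
  \<comment> \<open>In \<open>E2_le\<close>, \<open>t\<close> will be \<open>(1/2) ^ m\<close>; each
    halving of the argument multiplies \<open>K\<close> by at most \<open>D\<close>. The number
    \<open>m\<close> is chosen such that \<open>D ^ m\<close> is about
    \<open>K y powr (- 1 / 2)\<close>, and then \<open>(1/2) ^ m\<close> is about
    \<open>K y powr s\<close>.\<close>
  define s where "s = ln 2 / (2 * ln D)"
  have lnD: "ln D \<ge> ln 2" using D(1) by simp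
  then have lnD0: "ln D > 0" using ln_gt_zero[of "2::real"] by linarith
  have s: "s > 0" "s \<le> 1 / 2" using lnD lnD0 by (simp_all add: s_def field_simps)
  have "E2 y / y \<le> (2 * a + 2 * D) * K y powr s" if y: "y > 0" "K y < 1" for y
  proof -
    define k where "k = K y"
    have k: "0 < k" "k < 1" using K_pos that by (simp_all add: k_def)
    define t where "t = - ln k / (2 * ln D)"
    define m where "m = nat \<lfloor>t\<rfloor>"
    have t0: "t \<ge> 0" unfolding t_def using k lnD0 by (intro divide_nonneg_pos) simp_all
    have m: "real m \<le> t" "t \<le> real m + 1"
      using t0 by (simp_all add: m_def of_nat_floor)
    have Dm: "D ^ m \<le> k powr (- 1 / 2)"
    proof -
      have "D ^ m = exp (real m * ln D)" using D(1) by (simp add: exp_of_nat_mult)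
      also have "\<dots> \<le> exp (t * ln D)" using m lnD0 by simp
      also have "t * ln D = - 1 / 2 * ln k" using lnD0 by (simp add: t_def)
      also have "exp (- 1 / 2 * ln k) = k powr (- 1 / 2)" using k by (simp add: powr_def)
      finally show ?thesis .
    qed
    have 2: "(1 / 2) ^ m \<le> 2 * k powr s"
    proof -
      have "(1 / 2 :: real) ^ m = 2 * exp (- (real m + 1) * ln 2)"
      proof -
        have "exp (- (real m + 1) * ln 2) = exp (real (Suc m) * (- ln 2))" by (simp add: algebra_simps)
        also have "\<dots> = exp (- ln 2) ^ Suc m" by (rule exp_of_nat_mult)
        also have "exp (- ln 2) = (1 / 2 :: real)" by (simp add: exp_minus)
        finally show ?thesis by simp
      qed
      also have "\<dots> \<le> 2 * exp (- t * ln 2)"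
      proof -
        have "- (real m + 1) * ln 2 \<le> - t * ln 2" using m by (intro mult_right_mono) simp_all
        then show ?thesis by (simp only: exp_le_cancel_iff mult_le_cancel_left_pos zero_less_numeral)
      qed
      also have "- t * ln 2 = s * ln k" using lnD0 by (simp add: t_def s_def)
      also have "exp (s * ln k) = k powr s" using k by (simp add: powr_def)
      finally show ?thesis .
    qed
    have "K ((1 / 2) ^ m * y / 2) \<le> D ^ Suc m * K (2 ^ Suc m * ((1 / 2) ^ m * y / 2))"
      using D y by (intro K_le_power) simp_all
    also have "2 ^ Suc m * ((1 / 2) ^ m * y / 2) = y" by (simp add: power_one_over)
    also have "D ^ Suc m * K y \<le> D * (k powr (- 1 / 2) * k)"
      using Dm D(1) k by (simp add: k_def)
    also have "k powr (- 1 / 2) * k = k powr (1 / 2)"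
      using k powr_add[of k "- 1 / 2" 1] by simp
    also have "k powr (1 / 2) \<le> k powr s"
      using k s by (intro powr_mono') simp_all
    finally have 3: "K ((1 / 2) ^ m * y / 2) \<le> D * k powr s" using D(1) by simp
    have "E2 y \<le> y * (a * (1 / 2) ^ m + 2 * K ((1 / 2) ^ m * y / 2))"
      using y(1) by (intro E2_le) (simp_all add: power_le_one)
    also have "\<dots> \<le> y * (a * (2 * k powr s) + 2 * (D * k powr s))"
      using 2 3 y(1) a_pos by (intro mult_left_mono add_mono) simp_all
    finally show ?thesis using y(1) by (simp add: k_def divide_le_eq algebra_simps)
  qed
  moreover have "\<forall>\<^sub>F y in at_top. (y::real) > 0 \<and> K y < 1"
    by (intro eventually_conj eventually_gt_at_top eventually_K_less) simp
  ultimately have "\<forall>\<^sub>F y in at_top. E2 y / y \<le> (2 * a + 2 * D) * K y powr s"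
    by (auto elim: eventually_mono)
  then show thesis using that[of s "2 * a + 2 * D"] s a_pos D(1) by simp
qed

section \<open>Large sibling sums\<close>

definition tamed :: "real \<Rightarrow> (nat list \<Rightarrow> nat) \<Rightarrow> real" where
  "tamed y \<nu> = (if ever_bad y \<nu> then 0 else W \<nu>)"

lemma measurable_tamed [measurable]: "tamed y \<in> borel_measurable GW"
  unfolding tamed_def[abs_def] by measurable

text \<open>Fatou carries the bound from the generations to the limit: on a tree that is never bad
  \<open>Zt\<close> equals \<open>Z\<close>, and otherwise \<open>tamed\<close> is 0 and the
  exponential on the left is 1.\<close>

lemma exp_tamed_le:
  assumes B: "B = 2 / a\<^sup>2 * exp (2 * L) / (1 - 1 / a)"
    and y: "y > 0" and l: "l \<ge> 0" "l * y \<le> L" "B * l * E2 y \<le> ln 2"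
  shows "(\<integral>\<^sup>+\<nu>. ennreal (exp (l * tamed y \<nu>)) \<partial>GW) \<le> ennreal (exp (2 * l))"
proof -
  have mgf: "mgf n y l \<le> ennreal (exp (2 * l))" for n
  proof -
    have "exp (B * l * E2 y) \<le> 2" using l(3) by (metis exp_le_cancel_iff exp_ln zero_less_numeral)
    then have "l * exp (B * l * E2 y) \<le> l * 2" using l(1) by (rule mult_left_mono)
    then have "ennreal (exp (l * exp (B * l * E2 y))) \<le> ennreal (exp (2 * l))"
      by (intro ennreal_leI) simp
    with mgf_le[OF B y l] show ?thesis by (rule order_trans)
  qed
  have "(\<integral>\<^sup>+\<nu>. ennreal (exp (l * tamed y \<nu>)) \<partial>GW)
      \<le> (\<integral>\<^sup>+\<nu>. liminf (\<lambda>n. ennreal (exp (l * (real (Zt n y \<nu>) / a ^ n)))) \<partial>GW)"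
  proof (rule nn_integral_mono_AE)
    show "AE \<nu> in GW. ennreal (exp (l * tamed y \<nu>)) \<le> liminf (\<lambda>n. ennreal (exp (l * (real (Zt n y \<nu>) / a ^ n))))"
      using AE_regular
    proof eventually_elim
      case (elim \<nu>)
      show ?case
      proof (cases "ever_bad y \<nu>")
        case True
        then show ?thesis
          using l(1) a_pos by (intro Liminf_bounded always_eventually allI ennreal_leI) (simp add: tamed_def)
      next
        case False
        then have "Zt n y \<nu> = Z n \<nu>" for n by (intro Zt_eq_Z) (simp add: ever_bad_def)
        moreover have "(\<lambda>n. ennreal (exp (l * (real (Z n \<nu>) / a ^ n)))) \<longlonglongrightarrow> ennreal (exp (l * W \<nu>))"
          by (intro tendsto_ennrealI tendsto_intros tendsto_W elim)
        then have "liminf (\<lambda>n. ennreal (exp (l * (real (Z n \<nu>) / a ^ n)))) = ennreal (exp (l * W \<nu>))"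
          by (rule lim_imp_Liminf[rotated]) simp
        ultimately show ?thesis using False by (simp add: tamed_def)
      qed
    qed
  qed
  also have "\<dots> \<le> liminf (\<lambda>n. mgf n y l)"
    unfolding mgf_def by (rule nn_integral_liminf) measurable
  also have "\<dots> \<le> limsup (\<lambda>n. mgf n y l)" by (rule Liminf_le_Limsup) simp
  also have "\<dots> \<le> ennreal (exp (2 * l))" by (rule Limsup_bounded) (simp add: mgf)
  finally show ?thesis .
qed

text \<open>Union bound and Chernoff bound: either some subtree is bad, or all are tamed and their
  exponential moments multiply.\<close>

lemma Forest_siblings_le:
  assumes B: "B = 2 / a\<^sup>2 * exp (2 * L) / (1 - 1 / a)"
    and y: "y > 0" and l: "l \<ge> 0" "l * y \<le> L" "B * l * E2 y \<le> ln 2"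
  shows "(\<integral>\<^sup>+\<xi>. (if z < (\<Sum>i\<in>{..<n} - {j}. W (\<xi> i)) then 1 else 0) \<partial>Forest)
    \<le> ennreal (real n * (a / (a - 1) * K (y / a) / y) + exp (2 * l * real n - l * z))"
proof -
  let ?S = "{..<n} - {j}"
  let ?b = "a / (a - 1) * K (y / a) / y"
  have b0: "?b \<ge> 0" using a_gt_1 K_nonneg y by simp
  have "(\<integral>\<^sup>+\<xi>. (if z < (\<Sum>i\<in>?S. W (\<xi> i)) then 1 else 0) \<partial>Forest)
    \<le> (\<integral>\<^sup>+\<xi>. (\<Sum>i<n. if ever_bad y (\<xi> i) then 1 else 0) +
        ennreal (exp (- l * z)) * (\<Prod>i\<in>?S. ennreal (exp (l * tamed y (\<xi> i)))) \<partial>Forest)"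
  proof (rule nn_integral_mono)
    fix \<xi> :: "nat \<Rightarrow> nat list \<Rightarrow> nat"
    show "(if z < (\<Sum>i\<in>?S. W (\<xi> i)) then 1 else 0) \<le> (\<Sum>i<n. if ever_bad y (\<xi> i) then 1 else 0) +
        ennreal (exp (- l * z)) * (\<Prod>i\<in>?S. ennreal (exp (l * tamed y (\<xi> i))))"
    proof (cases "z < (\<Sum>i\<in>?S. W (\<xi> i))")
      case True
      show ?thesis
      proof (cases "\<exists>i<n. ever_bad y (\<xi> i)")
        case bad: True
        then obtain i where "i < n" "ever_bad y (\<xi> i)" by blast
        then have "(1::ennreal) \<le> (\<Sum>i<n. if ever_bad y (\<xi> i) then 1 else 0)"
          using member_le_sum[of i "{..<n}" "\<lambda>i. if ever_bad y (\<xi> i) then 1 else 0 :: ennreal"] by simp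
        then show ?thesis using True by (simp add: add_increasing2)
      next
        case False
        then have "(\<Sum>i\<in>?S. l * tamed y (\<xi> i)) = l * (\<Sum>i\<in>?S. W (\<xi> i))"
          unfolding sum_distrib_left by (intro sum.cong) (auto simp: tamed_def)
        then have "exp (- l * z) * (\<Prod>i\<in>?S. exp (l * tamed y (\<xi> i))) = exp (l * ((\<Sum>i\<in>?S. W (\<xi> i)) - z))"
          by (simp add: exp_sum[symmetric] mult_exp_exp algebra_simps)
        also have "1 \<le> \<dots>" using True l(1) by simp
        finally have "1 \<le> ennreal (exp (- l * z)) * (\<Prod>i\<in>?S. ennreal (exp (l * tamed y (\<xi> i))))"
          by (simp add: prod_ennreal ennreal_mult[symmetric] prod_nonneg del: exp_sum)
        then show ?thesis using True by (simp add: add_increasing)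
      qed
    qed simp
  qed
  also have "\<dots> = (\<Sum>i<n. \<integral>\<^sup>+\<nu>. (if ever_bad y \<nu> then 1 else 0) \<partial>GW) +
      ennreal (exp (- l * z)) * (\<integral>\<^sup>+\<nu>. ennreal (exp (l * tamed y \<nu>)) \<partial>GW) ^ card ?S"
    by (subst nn_integral_add) (simp_all add: nn_integral_sum nn_integral_cmult
        nn_integral_Forest_component[where f = "\<lambda>\<nu>. if ever_bad y \<nu> then 1 else 0"]
        nn_integral_Forest_prod[where f = "\<lambda>\<nu>. ennreal (exp (l * tamed y \<nu>))"] del: card_Diff_insert)
  also have "\<dots> \<le> (\<Sum>i<n. ennreal ?b) + ennreal (exp (- l * z)) * ennreal (exp (2 * l)) ^ card ?S"
    by (intro add_mono sum_mono mult_left_mono power_mono ever_bad_probability exp_tamed_le[OF B y l] y) simp_all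
  also have "\<dots> \<le> ennreal (real n * ?b) + ennreal (exp (2 * l * real n - l * z))"
  proof (rule add_mono)
    have "(\<Sum>i<n. ennreal ?b) = ennreal (real n) * ennreal ?b"
      by (simp add: ennreal_of_nat_eq_real_of_nat)
    also have "\<dots> = ennreal (real n * ?b)"
      using b0 by (intro ennreal_mult[symmetric]) simp_all
    finally show "(\<Sum>i<n. ennreal ?b) \<le> ennreal (real n * ?b)" by (rule eq_refl)
    have "real (card ?S) \<le> real n"
      using card_mono[of "{..<n}" ?S] by simp
    then have "2 * l * real (card ?S) \<le> 2 * l * real n"
      using l(1) by (intro mult_left_mono) simp_all
    moreover have "exp (- l * z) * exp (2 * l) ^ card ?S = exp (2 * l * real (card ?S) - l * z)"
      by (simp add: exp_of_nat_mult[symmetric] mult_exp_exp algebra_simps)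
    ultimately have "exp (- l * z) * exp (2 * l) ^ card ?S \<le> exp (2 * l * real n - l * z)" by simp
    then show "ennreal (exp (- l * z)) * ennreal (exp (2 * l)) ^ card ?S \<le> ennreal (exp (2 * l * real n - l * z))"
      by (simp add: ennreal_power ennreal_mult[symmetric] ennreal_leI)
  qed
  also have "\<dots> = ennreal (real n * ?b + exp (2 * l * real n - l * z))"
    using b0 by (intro ennreal_plus[symmetric] mult_nonneg_nonneg) simp_all
  finally show ?thesis .
qed

lemma siblings_split:
  assumes [measurable]: "B \<in> sets borel"
  shows "(\<integral>\<^sup>+\<nu>. (\<Sum>j<\<nu> []. if siblings j \<nu> \<in> B then 1 else 0) \<partial>GW)
      = (\<integral>\<^sup>+n. (\<Sum>j<n. \<integral>\<^sup>+\<xi>. (if (\<Sum>l\<in>{..<n} - {j}. W (\<xi> l)) \<in> B then 1 else 0) \<partial>Forest) \<partial>p)"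
proof -
  have "(\<integral>\<^sup>+\<nu>. (\<Sum>j<\<nu> []. if siblings j \<nu> \<in> B then 1 else 0) \<partial>GW)
      = (\<integral>\<^sup>+n. \<integral>\<^sup>+\<xi>. (\<Sum>j<n. if (\<Sum>l\<in>{..<n} - {j}. W (\<xi> l)) \<in> B then 1 else 0) \<partial>Forest \<partial>p)"
    by (subst nn_integral_GW_split) (simp_all add: measurable_sum_children siblings_def cong: if_cong)
  also have "\<dots> = (\<integral>\<^sup>+n. (\<Sum>j<n. \<integral>\<^sup>+\<xi>. (if (\<Sum>l\<in>{..<n} - {j}. W (\<xi> l)) \<in> B then 1 else 0) \<partial>Forest) \<partial>p)"
    by (intro nn_integral_cong nn_integral_sum) measurable
  finally show ?thesis .
qed

text \<open>A root with more than \<open>y = d * x\<close> children is counted in full by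
  \<open>tail y\<close>. With at most \<open>y\<close> children, the sibling sum must exceed
  \<open>y\<close> by a large constant factor, and both terms of \<open>Forest_siblings_le\<close>
  are then of the order of \<open>K\<close>.\<close>

theorem siblings_upper:
  assumes e: "e > 0"
  obtains C where "C > 0"
    "\<forall>\<^sub>F x in at_top. (\<integral>\<^sup>+\<nu>. (\<Sum>j<\<nu> []. if siblings j \<nu> \<in> {e * x<..} then 1 else 0) \<partial>GW) \<le> ennreal (C * K x)"
proof -
  obtain s C0 where s: "s > 0" and C0: "C0 > 0" and E2: "\<forall>\<^sub>F y in at_top. E2 y / y \<le> C0 * K y powr s"
    by (rule E2_le_powr)
  \<comment> \<open>With this \<open>d\<close>, \<open>e * x = (2 + 4 / s) * y\<close>. The part
    \<open>2 * y\<close> pays for the factors \<open>exp (2 * l)\<close> of up to \<open>y\<close>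
    tamed trees; the rest, \<open>(4 / s) * y\<close>, turns the Chernoff term into
    \<open>K y\<close>.\<close>
  define d where "d = e / (2 + 4 / s)"
  have d: "d > 0" using e s by (simp add: d_def add_pos_pos)
  define b where "b = 2 / a\<^sup>2 / (1 - 1 / a)"
  have b: "b > 0" using a_gt_1 by (simp add: b_def)
  define c where "c = a / (a - 1)"
  have c: "c > 0" using a_gt_1 by (simp add: c_def)
  have main: "(\<integral>\<^sup>+\<nu>. (\<Sum>j<\<nu> []. if siblings j \<nu> \<in> {e * x<..} then 1 else 0) \<partial>GW)
      \<le> ennreal (2 * K (d * x / 2) + a * (c * K (d * x / a) + K (d * x)))"
    if y: "d * x > 0" and E: "E2 (d * x) / (d * x) \<le> C0 * K (d * x) powr s" and K1: "K (d * x) < 1"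
      and small: "b * C0 * K (d * x) powr (s / 4) < ln 2" for x
  proof -
    \<comment> \<open>With \<open>L = (s / 4) * ln (1 / K y)\<close>, the quotient
      \<open>E2 y / y\<close> is at most a multiple of \<open>exp (- 4 * L)\<close>, which beats the
      factors \<open>exp (2 * L)\<close> and \<open>L\<close> in the condition for the exponential
      moments. What remains is \<open>exp (- L)\<close>, hence the exponent \<open>s / 4\<close> in
      \<open>small\<close>.\<close>
    define y k L where "y = d * x" and "k = K y" and "L = - (s / 4) * ln k"
    define l where "l = L / y"
    have y0: "y > 0" using y by (simp add: y_def)
    have k: "0 < k" "k < 1" using K_pos K1 by (simp_all add: k_def y_def)
    have L0: "L \<ge> 0" using k s by (simp add: L_def mult_nonneg_nonpos)
    have l0: "l \<ge> 0" using L0 y0 by (simp add: l_def)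
    have ly: "l * y = L" using y0 by (simp add: l_def)
    have ks: "k powr s = exp (- 4 * L)" "k powr (s / 4) = exp (- L)"
      using k by (simp_all add: powr_def L_def)
    have "b * exp (2 * L) * l * E2 y = b * exp (2 * L) * L * (E2 y / y)" by (simp add: l_def)
    also have "\<dots> \<le> b * exp (2 * L) * L * (C0 * exp (- 4 * L))"
    proof (rule mult_left_mono)
      show "E2 y / y \<le> C0 * exp (- 4 * L)"
        using E unfolding ks(1)[symmetric] by (simp add: k_def y_def)
    qed (use b L0 in simp)
    also have "\<dots> = b * C0 * (L * exp (- 2 * L))"
      by (simp add: mult_exp_exp mult_ac)
    also have "\<dots> \<le> b * C0 * exp (- L)"
    proof (rule mult_left_mono)
      have "L * exp (- 2 * L) \<le> exp L * exp (- 2 * L)"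
        using exp_ge_add_one_self[of L] by (intro mult_right_mono, linarith, simp)
      then show "L * exp (- 2 * L) \<le> exp (- L)" by (simp add: mult_exp_exp)
    qed (use b C0 in simp)
    also have "\<dots> \<le> ln 2" using small unfolding ks(2)[symmetric] by (simp add: k_def y_def)
    finally have small': "(2 / a\<^sup>2 * exp (2 * L) / (1 - 1 / a)) * l * E2 y \<le> ln 2"
      by (simp add: b_def mult_ac)
    have bound: "(\<integral>\<^sup>+\<xi>. (if (\<Sum>i\<in>{..<n} - {j}. W (\<xi> i)) \<in> {e * x<..} then 1 else 0) \<partial>Forest)
        \<le> ennreal (c * K (y / a) + k)" if n: "real n \<le> y" for n j
    proof -
      have "(\<integral>\<^sup>+\<xi>. (if e * x < (\<Sum>i\<in>{..<n} - {j}. W (\<xi> i)) then 1 else 0) \<partial>Forest)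
          \<le> ennreal (real n * (a / (a - 1) * K (y / a) / y) + exp (2 * l * real n - l * (e * x)))"
        using y0 l0 ly small' by (intro Forest_siblings_le[OF refl]) simp_all
      also have "\<dots> \<le> ennreal (c * K (y / a) + k)"
      proof (intro ennreal_leI add_mono)
        have "real n * (a / (a - 1) * K (y / a) / y) \<le> y * (a / (a - 1) * K (y / a) / y)"
          using n y0 K_nonneg a_gt_1 by (intro mult_right_mono) simp_all
        then show "real n * (a / (a - 1) * K (y / a) / y) \<le> c * K (y / a)"
          using y0 by (simp add: c_def)
        have "2 + 4 / s > 0" using s by (simp add: add_pos_pos)
        then have "e * x = (2 + 4 / s) * y" by (simp add: y_def d_def)
        then have "l * (e * x) = (2 + 4 / s) * L" using ly by (simp add: mult_ac)
        moreover have "2 * l * real n \<le> 2 * L"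
          using mult_left_mono[OF n l0] ly by simp
        ultimately have "2 * l * real n - l * (e * x) \<le> - (4 / s) * L" by (simp add: algebra_simps)
        also have "- (4 / s) * L = ln k" using s by (simp add: L_def)
        finally have "exp (2 * l * real n - l * (e * x)) \<le> exp (ln k)" by simp
        then show "exp (2 * l * real n - l * (e * x)) \<le> k" using k by simp
      qed
      finally show ?thesis by simp
    qed
    have ck: "c * K (y / a) + k \<ge> 0" using c K_nonneg k by (simp add: add_nonneg_nonneg)
    have "(\<integral>\<^sup>+\<nu>. (\<Sum>j<\<nu> []. if siblings j \<nu> \<in> {e * x<..} then 1 else 0) \<partial>GW)
      = (\<integral>\<^sup>+n. (\<Sum>j<n. \<integral>\<^sup>+\<xi>. (if (\<Sum>l\<in>{..<n} - {j}. W (\<xi> l)) \<in> {e * x<..} then 1 else 0) \<partial>Forest) \<partial>p)"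
      by (rule siblings_split) simp
    also have "\<dots> \<le> (\<integral>\<^sup>+n. (if real n > y then ennreal (real n) else 0) + ennreal (real n) * ennreal (c * K (y / a) + k) \<partial>p)"
    proof (rule nn_integral_mono)
      fix n
      show "(\<Sum>j<n. \<integral>\<^sup>+\<xi>. (if (\<Sum>l\<in>{..<n} - {j}. W (\<xi> l)) \<in> {e * x<..} then 1 else 0) \<partial>Forest)
          \<le> (if real n > y then ennreal (real n) else 0) + ennreal (real n) * ennreal (c * K (y / a) + k)"
      proof (cases "real n \<le> y")
        case True
        have "(\<Sum>j<n. \<integral>\<^sup>+\<xi>. (if (\<Sum>l\<in>{..<n} - {j}. W (\<xi> l)) \<in> {e * x<..} then 1 else 0) \<partial>Forest)
          \<le> (\<Sum>j<n. ennreal (c * K (y / a) + k))"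
          by (intro sum_mono bound[OF True])
        also have "\<dots> = ennreal (real n) * ennreal (c * K (y / a) + k)"
          by (simp add: ennreal_of_nat_eq_real_of_nat)
        finally show ?thesis using True by simp
      next
        case False
        have "(\<Sum>j<n. \<integral>\<^sup>+\<xi>. (if (\<Sum>l\<in>{..<n} - {j}. W (\<xi> l)) \<in> {e * x<..} then 1 else 0) \<partial>Forest)
          \<le> (\<Sum>j<n. \<integral>\<^sup>+\<xi>. 1 \<partial>Forest)"
          by (intro sum_mono nn_integral_mono) simp
        also have "\<dots> = ennreal (real n)" by (simp add: ennreal_of_nat_eq_real_of_nat)
        finally show ?thesis using False by (simp add: add_increasing2)
      qed
    qed
    also have "\<dots> = tail y + ennreal a * ennreal (c * K (y / a) + k)"
      by (subst nn_integral_add) (simp_all add: measurable_p_any tail_def nn_integral_GW_eval)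
    also have "\<dots> \<le> ennreal (2 * K (y / 2)) + ennreal a * ennreal (c * K (y / a) + k)"
      using y0 by (intro add_right_mono tail_le_K) simp
    also have "\<dots> = ennreal (2 * K (y / 2) + a * (c * K (y / a) + k))"
      using a_pos ck K_nonneg by (simp add: ennreal_mult[symmetric] ennreal_plus[symmetric] del: ennreal_plus)
    finally show ?thesis by (simp add: y_def k_def)
  qed
  have at_top: "filterlim (\<lambda>x. d * x) at_top at_top"
    using d by (intro filterlim_tendsto_pos_mult_at_top[OF tendsto_const]) (auto intro: filterlim_ident)
  have "((\<lambda>y. b * C0 * K y powr (s / 4)) \<longlongrightarrow> b * C0 * 0) at_top"
    using s by (intro tendsto_mult tendsto_const tendsto_K_powr) simp
  then have "\<forall>\<^sub>F y in at_top. b * C0 * K y powr (s / 4) < ln 2"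
    by (rule order_tendstoD(2)) simp
  then have "\<forall>\<^sub>F y in at_top. y > 0 \<and> E2 y / y \<le> C0 * K y powr s \<and> K y < 1 \<and> b * C0 * K y powr (s / 4) < ln 2"
    by (intro eventually_conj eventually_gt_at_top E2 eventually_K_less) simp_all
  then have ev: "\<forall>\<^sub>F x in at_top. d * x > 0 \<and> E2 (d * x) / (d * x) \<le> C0 * K (d * x) powr s \<and> K (d * x) < 1 \<and>
      b * C0 * K (d * x) powr (s / 4) < ln 2"
    using at_top by (rule eventually_compose_filterlim)
  \<comment> \<open>The arguments \<open>d * x / 2\<close>, \<open>d * x / a\<close> and
    \<open>d * x\<close> are brought back to \<open>x\<close>.\<close>
  obtain C1 where C1: "C1 > 0" "\<And>x. x \<ge> 0 \<Longrightarrow> K x \<le> C1 * K (2 / d * x)"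
    using scaling[of "2 / d"] by blast
  obtain C2 where C2: "C2 > 0" "\<And>x. x \<ge> 0 \<Longrightarrow> K x \<le> C2 * K (a / d * x)"
    using scaling[of "a / d"] by blast
  obtain C3 where C3: "C3 > 0" "\<And>x. x \<ge> 0 \<Longrightarrow> K x \<le> C3 * K (1 / d * x)"
    using scaling[of "1 / d"] by blast
  have "\<forall>\<^sub>F x in at_top. (\<integral>\<^sup>+\<nu>. (\<Sum>j<\<nu> []. if siblings j \<nu> \<in> {e * x<..} then 1 else 0) \<partial>GW)
      \<le> ennreal ((2 * C1 + a * (c * C2 + C3)) * K x)"
    using ev
  proof eventually_elim
    case (elim x)
    have "K (d * x / 2) \<le> C1 * K x" using C1(2)[of "d * x / 2"] elim d by simp
    moreover have "K (d * x / a) \<le> C2 * K x" using C2(2)[of "d * x / a"] elim d a_pos by simp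
    moreover have "K (d * x) \<le> C3 * K x" using C3(2)[of "d * x"] elim d by simp
    ultimately have "2 * K (d * x / 2) + a * (c * K (d * x / a) + K (d * x)) \<le> 2 * (C1 * K x) + a * (c * (C2 * K x) + C3 * K x)"
      using a_pos c by (intro add_mono mult_left_mono) simp_all
    also have "\<dots> = (2 * C1 + a * (c * C2 + C3)) * K x" by (simp add: algebra_simps)
    finally show ?case using main[of x] elim by (meson ennreal_leI order_trans)
  qed
  moreover have "2 * C1 + a * (c * C2 + C3) > 0"
    using C1(1) C2(1) C3(1) c a_pos by (simp add: add_pos_pos)
  ultimately show thesis using that by blast
qed

end

context dominated_law
begin

section \<open>Nontriviality of the limit\<close>

definition large :: "real \<Rightarrow> real" where
  "large y = (\<integral>n. (if real n > y then real n else 0) \<partial>p)"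

text \<open>Sums up \<open>large (a ^ k * y)\<close> over all levels \<open>k\<close>, and so bounds the mean loss caused by the truncation in \<open>Zt\<close>;
  it tends to \<open>0\<close> because \<open>E(N log N)\<close> is finite.\<close>
definition J :: "real \<Rightarrow> real" where
  "J y = (\<integral>n. real n * max 0 (log a (real n / y) + 1) \<partial>p) / a"

lemma integrable_large: "integrable p (\<lambda>n. if real n > y then real n else 0)"
  by (rule integrable_p_bound[of _ 1 0]) simp

lemma ln_a_pos: "ln a > 0"
  using a_gt_1 by simp

lemma J_integrand_bound:
  assumes "y \<ge> 1"
  shows "\<bar>real n * max 0 (log a (real n / y) + 1)\<bar> \<le> real n * ln (real n) / ln a + real n"
proof (cases "n = 0")
  case False
  then have n: "real n \<ge> 1" by simp
  have "log a (real n / y) = (ln (real n) - ln y) / ln a"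
    using n assms by (simp add: log_def ln_div)
  also have "\<dots> \<le> ln (real n) / ln a"
    using assms ln_a_pos by (intro divide_right_mono) simp_all
  finally have "max 0 (log a (real n / y) + 1) \<le> ln (real n) / ln a + 1"
    using n ln_a_pos by simp
  then have "real n * max 0 (log a (real n / y) + 1) \<le> real n * (ln (real n) / ln a + 1)"
    by (rule mult_left_mono) simp
  then show ?thesis by (simp add: abs_mult algebra_simps)
qed simp

lemma integrable_J_bound: "integrable p (\<lambda>n. real n * ln (real n) / ln a + real n)"
  using xlogx integrable_p by simp

lemma integrable_J: "y \<ge> 1 \<Longrightarrow> integrable p (\<lambda>n. real n * max 0 (log a (real n / y) + 1))"
proof (rule Bochner_Integration.integrable_bound[OF integrable_J_bound])
  assume "y \<ge> 1"
  then show "AE n in p. norm (real n * max 0 (log a (real n / y) + 1)) \<le> norm (real n * ln (real n) / ln a + real n)"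
    using order_trans[OF J_integrand_bound abs_ge_self] by (intro AE_I2) simp
qed (simp add: measurable_p_any)

text \<open>With \<open>q = log a (n / y)\<close>, passing to \<open>a * y\<close> lowers
  \<open>q\<close> by 1, and where \<open>n > y\<close>, \<open>max 0 (q + 1)\<close> exceeds
  \<open>max 0 q\<close> by 1.\<close>

lemma J_recursion:
  assumes y: "y \<ge> 1"
  shows "large y / a + J (a * y) \<le> J y"
proof -
  have ay: "a * y \<ge> 1" using mult_mono[of 1 a 1 y] y a_gt_1 by simp
  have "(\<integral>n. (if real n > y then real n else 0) + real n * max 0 (log a (real n / (a * y)) + 1) \<partial>p)
      \<le> (\<integral>n. real n * max 0 (log a (real n / y) + 1) \<partial>p)"
  proof (rule integral_mono)
    fix n
    show "(if real n > y then real n else 0) + real n * max 0 (log a (real n / (a * y)) + 1)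
        \<le> real n * max 0 (log a (real n / y) + 1)"
    proof (cases "n = 0")
      case False
      define q where "q = log a (real n / y)"
      have "log a (real n / (a * y)) = q - 1"
      proof -
        have "log a (real n / y / a) = q - log a a"
          unfolding q_def using False y a_gt_1 by (subst log_divide) simp_all
        then show ?thesis using a_gt_1 by (simp add: mult.commute)
      qed
      moreover have "real n > y \<longleftrightarrow> q > 0"
        using False y a_gt_1 by (simp add: q_def)
      moreover have "(if q > 0 then 1 else 0) + max 0 (q - 1 + 1) \<le> max 0 (q + 1)" by simp
      then have "real n * ((if q > 0 then 1 else 0) + max 0 (q - 1 + 1)) \<le> real n * max 0 (q + 1)"
        by (rule mult_left_mono) simp
      ultimately show ?thesis by (simp add: q_def[symmetric] distrib_left split: if_splits)
    qed (use y in simp)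
  qed (intro Bochner_Integration.integrable_add integrable_large integrable_J ay y)+
  then have "large y + a * J (a * y) \<le> a * J y"
    using a_pos integrable_large integrable_J[OF ay] by (simp add: large_def J_def)
  then show ?thesis using a_pos by (simp add: field_simps)
qed

lemma J_tendsto_0: "(J \<longlongrightarrow> 0) at_top"
proof -
  have "((\<lambda>y. \<integral>n. real n * max 0 (log a (real n / y) + 1) \<partial>p) \<longlongrightarrow> (\<integral>n. 0 \<partial>p)) at_top"
  proof (rule integral_dominated_convergence_at_top[OF _ _ integrable_J_bound])
    show "\<forall>\<^sub>F y in at_top. AE n in p. norm (real n * max 0 (log a (real n / y) + 1)) \<le> real n * ln (real n) / ln a + real n"
      using J_integrand_bound by (intro eventually_mono[OF eventually_ge_at_top[of 1]] AE_I2) simp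
    show "AE n in p. ((\<lambda>y. real n * max 0 (log a (real n / y) + 1)) \<longlongrightarrow> 0) at_top"
    proof (rule AE_I2)
      fix n
      have "real n * max 0 (log a (real n / y) + 1) = 0" if y: "y \<ge> max 1 (a * real n)" for y
      proof (cases "n = 0")
        case False
        have "real n / y \<le> 1 / a" using y a_pos by (simp add: field_simps)
        then have "log a (real n / y) \<le> log a (1 / a)"
          using False y a_gt_1 by (subst log_le_cancel_iff) simp_all
        also have "\<dots> = - 1" using a_gt_1 by (simp add: log_divide)
        finally show ?thesis by simp
      qed simp
      then have "\<forall>\<^sub>F y in at_top. real n * max 0 (log a (real n / y) + 1) = 0"
        by (intro eventually_mono[OF eventually_ge_at_top[of "max 1 (a * real n)"]]) blast
      then show "((\<lambda>y. real n * max 0 (log a (real n / y) + 1)) \<longlongrightarrow> 0) at_top"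
        by (rule tendsto_eventually)
    qed
  qed (simp_all add: measurable_p_any)
  then have "((\<lambda>y. (\<integral>n. real n * max 0 (log a (real n / y) + 1) \<partial>p) / a) \<longlongrightarrow> 0 / a) at_top"
    using a_pos by (intro tendsto_divide tendsto_const) simp_all
  then show ?thesis by (simp add: J_def[abs_def])
qed

text \<open>The root loses the share \<open>large y / a\<close> of its offspring, the subtrees lose
  at most \<open>J (a * y)\<close>, and \<open>J_recursion\<close> adds the two losses.\<close>

lemma Zt_mean_ge:
  assumes "y \<ge> 1"
  shows "ennreal (1 - J y) \<le> (\<integral>\<^sup>+\<nu>. ennreal (real (Zt n y \<nu>) / a ^ n) \<partial>GW)"
  using assms
proof (induction n arbitrary: y)
  case 0
  have "J y \<ge> 0" unfolding J_def using a_pos by (intro divide_nonneg_pos integral_nonneg_AE) simp_all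
  then have "ennreal (1 - J y) \<le> ennreal 1" by (intro ennreal_leI) simp
  then show ?case by simp
next
  case (Suc n)
  have ay: "a * y \<ge> 1" using mult_mono[of 1 a 1 y] Suc.prems a_gt_1 by simp
  let ?f = "\<lambda>\<nu>. ennreal (real (Zt n (a * y) \<nu>) / a ^ n)"
  have "(\<integral>\<^sup>+\<nu>. ?f \<nu> \<partial>GW) \<le> 1"
  proof -
    have "(\<integral>\<^sup>+\<nu>. ?f \<nu> \<partial>GW) \<le> (\<integral>\<^sup>+\<nu>. ennreal (real (Z n \<nu>)) * ennreal (1 / a ^ n) \<partial>GW)"
    proof (rule nn_integral_mono)
      fix \<nu>
      have le: "real (Zt n (a * y) \<nu>) / a ^ n \<le> real (Z n \<nu>) * (1 / a ^ n)"
        using Zt_le_Z[of n "a * y" \<nu>] a_pos by (simp add: divide_right_mono)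
      show "?f \<nu> \<le> ennreal (real (Z n \<nu>)) * ennreal (1 / a ^ n)"
      proof -
        have "ennreal (real (Z n \<nu>)) * ennreal (1 / a ^ n) = ennreal (real (Z n \<nu>) * (1 / a ^ n))"
          using a_pos by (intro ennreal_mult[symmetric]) simp_all
        with ennreal_leI[OF le] show ?thesis by (simp only:)
      qed
    qed
    also have "\<dots> = (\<integral>\<^sup>+\<nu>. ennreal (real (Z n \<nu>)) \<partial>GW) * ennreal (1 / a ^ n)"
      by (rule nn_integral_multc) simp
    also have "\<dots> = 1" using a_pos by (simp add: nn_integral_Z ennreal_mult[symmetric])
    finally show ?thesis .
  qed
  \<comment> \<open>Since the subtree mean \<open>r\<close> is at most 1, the loss
    \<open>large y / a * r\<close> is at most \<open>large y / a\<close>.\<close>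
  then obtain r where r: "(\<integral>\<^sup>+\<nu>. ?f \<nu> \<partial>GW) = ennreal r" "r \<ge> 0" "r \<le> 1"
    by (cases "\<integral>\<^sup>+\<nu>. ?f \<nu> \<partial>GW") (auto simp: top_unique)
  have r_ge: "1 - J (a * y) \<le> r"
    using Suc.IH[OF ay] r by (auto simp: ennreal_le_iff)
  have int: "integrable p (\<lambda>k. if real k \<le> y then real k else 0)"
    by (rule integrable_p_bound[of _ 1 0]) simp
  have "(\<integral>k. (if real k \<le> y then real k else 0) + (if real k > y then real k else 0) \<partial>p) = a"
    by (rule Bochner_Integration.integral_cong) auto
  then have small: "(\<integral>k. (if real k \<le> y then real k else 0) \<partial>p) = a - large y"
    using int integrable_large by (simp add: large_def)
  have small0: "a - large y \<ge> 0" unfolding small[symmetric] by (rule integral_nonneg_AE) simp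
  have large0: "large y \<ge> 0" unfolding large_def by (rule integral_nonneg_AE) simp
  have pw: "ennreal (real (Zt (Suc n) y (join k \<xi>)) / a ^ Suc n) =
      ennreal (1 / a) * (if real k \<le> y then \<Sum>i<k. ?f (\<xi> i) else 0)" for k \<xi>
    using a_pos by (simp add: sum_ennreal ennreal_mult[symmetric] sum_nonneg sum_divide_distrib mult.commute)
  have "(\<integral>\<^sup>+\<nu>. ennreal (real (Zt (Suc n) y \<nu>) / a ^ Suc n) \<partial>GW)
      = (\<integral>\<^sup>+k. \<integral>\<^sup>+\<xi>. ennreal (1 / a) * (if real k \<le> y then \<Sum>i<k. ?f (\<xi> i) else 0) \<partial>Forest \<partial>p)"
    by (subst nn_integral_GW_split) (measurable, simp only: pw)
  also have "\<dots> = (\<integral>\<^sup>+k. ennreal (1 / a) * (ennreal (if real k \<le> y then real k else 0) * ennreal r) \<partial>p)"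
  proof (rule nn_integral_cong)
    fix k
    show "(\<integral>\<^sup>+\<xi>. ennreal (1 / a) * (if real k \<le> y then \<Sum>i<k. ?f (\<xi> i) else 0) \<partial>Forest)
        = ennreal (1 / a) * (ennreal (if real k \<le> y then real k else 0) * ennreal r)"
    proof (cases "real k \<le> y")
      case True
      have "(\<integral>\<^sup>+\<xi>. (\<Sum>i<k. ?f (\<xi> i)) \<partial>Forest) = (\<Sum>i<k. \<integral>\<^sup>+\<xi>. ?f (\<xi> i) \<partial>Forest)"
        by (rule nn_integral_sum) simp
      also have "\<dots> = ennreal (real k) * ennreal r"
        by (simp add: nn_integral_Forest_component[where f = ?f] r(1) ennreal_of_nat_eq_real_of_nat)
      finally show ?thesis
        using True by (subst nn_integral_cmult) (simp_all del: sum_ennreal)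
    qed simp
  qed
  also have "\<dots> = ennreal (1 / a) * (ennreal (a - large y) * ennreal r)"
    by (simp add: nn_integral_cmult nn_integral_multc measurable_p_any small[symmetric]
        nn_integral_eq_integral[OF int, symmetric])
  also have "\<dots> = ennreal (1 / a * ((a - large y) * r))"
    using a_pos small0 r(2) by (simp add: ennreal_mult[symmetric])
  also have "ennreal (1 - J y) \<le> \<dots>"
  proof (rule ennreal_leI)
    have "1 - J y \<le> 1 - J (a * y) - large y / a" using J_recursion[OF Suc.prems] by simp
    also have "\<dots> \<le> r - large y / a * r"
      using r_ge r(2,3) large0 a_pos mult_left_mono[OF r(3), of "large y / a"] by simp
    also have "\<dots> = 1 / a * ((a - large y) * r)" using a_pos by (simp add: field_simps)
    finally show "1 - J y \<le> 1 / a * ((a - large y) * r)" .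
  qed
  finally show ?case .
qed

text \<open>The normalized truncated generation sizes have means at least 1/2 and a bounded
  exponential moment, so they are uniformly integrable, and cutting at a fixed \<open>T\<close>
  leaves a mean of at least 1/4. This passes to the limit by dominated convergence.\<close>

theorem W_nontrivial: "(\<integral>\<^sup>+\<nu>. ennreal (min (W \<nu>) 1) \<partial>GW) > 0"
proof -
  obtain s C0 where s: "s > 0" and C0: "C0 > 0" and E2: "\<forall>\<^sub>F y in at_top. E2 y / y \<le> C0 * K y powr s"
    by (rule E2_le_powr)
  define B where "B = 2 / a\<^sup>2 * exp (2 * 1) / (1 - 1 / a)"
  have B: "B > 0" using a_gt_1 by (simp add: B_def)
  have "((\<lambda>y. B * C0 * K y powr s) \<longlongrightarrow> B * C0 * 0) at_top"
    by (intro tendsto_mult tendsto_const tendsto_K_powr s)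
  then have "\<forall>\<^sub>F y in at_top. B * C0 * K y powr s < ln 2"
    by (rule order_tendstoD(2)) simp
  moreover have "\<forall>\<^sub>F y in at_top. J y < 1 / 2"
    by (rule order_tendstoD(2)[OF J_tendsto_0]) simp
  ultimately have "\<forall>\<^sub>F y in at_top. y \<ge> 1 \<and> J y < 1 / 2 \<and> E2 y / y \<le> C0 * K y powr s \<and> B * C0 * K y powr s < ln 2"
    by (intro eventually_conj eventually_ge_at_top E2)
  then obtain y where y: "y \<ge> 1" "J y < 1 / 2" "E2 y / y \<le> C0 * K y powr s" "B * C0 * K y powr s < ln 2"
    using eventually_happens trivial_limit_at_top_linorder by blast
  define l where "l = 1 / y"
  have l: "l > 0" "l * y \<le> 1" using y(1) by (simp_all add: l_def)
  have "B * l * E2 y = B * (E2 y / y)" by (simp add: l_def)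
  also have "\<dots> \<le> B * (C0 * K y powr s)" using y(3) B by (intro mult_left_mono) simp_all
  also have "\<dots> \<le> ln 2" using y(4) by (simp add: mult_ac)
  finally have small: "B * l * E2 y \<le> ln 2" .
  have mgf: "mgf n y l \<le> ennreal (exp (2 * l))" for n
  proof -
    have "exp (B * l * E2 y) \<le> 2" using small by (metis exp_le_cancel_iff exp_ln zero_less_numeral)
    then have "l * exp (B * l * E2 y) \<le> l * 2" using l(1) by (intro mult_left_mono) simp_all
    then have "ennreal (exp (l * exp (B * l * E2 y))) \<le> ennreal (exp (2 * l))"
      by (intro ennreal_leI) simp
    moreover have "mgf n y l \<le> ennreal (exp (l * exp (B * l * E2 y)))"
      using B_def y(1) l small by (intro mgf_le[where L = 1]) simp_all
    ultimately show ?thesis by (rule order_trans[rotated])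
  qed
  \<comment> \<open>Chosen such that \<open>2 / (l\<^sup>2 * T) * exp (2 * l) = 1 / 4\<close>:
    cutting at \<open>T\<close> costs at most half of the guaranteed mean.\<close>
  define T where "T = 8 * exp (2 * l) / l\<^sup>2"
  have T: "T > 0" using l by (simp add: T_def)
  have quarter: "ennreal (1 / 4) \<le> (\<integral>\<^sup>+\<nu>. ennreal (min (real (Z n \<nu>) / a ^ n) T) \<partial>GW)" for n
  proof -
    let ?X = "\<lambda>\<nu>. real (Zt n y \<nu>) / a ^ n"
    let ?c = "2 / (l\<^sup>2 * T)"
    have c: "?c \<ge> 0" using T by simp
    have "(\<integral>\<^sup>+\<nu>. ennreal (?X \<nu>) \<partial>GW) \<le>
      (\<integral>\<^sup>+\<nu>. ennreal (min (real (Z n \<nu>) / a ^ n) T) + ennreal ?c * ennreal (exp (l * ?X \<nu>)) \<partial>GW)"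
    proof (rule nn_integral_mono)
      fix \<nu>
      have X0: "?X \<nu> \<ge> 0" using a_pos by simp
      have XZ: "?X \<nu> \<le> real (Z n \<nu>) / a ^ n"
        using Zt_le_Z[of n y \<nu>] a_pos by (simp add: divide_right_mono)
      have sq: "(?X \<nu>)\<^sup>2 / T \<le> ?c * exp (l * ?X \<nu>)"
      proof -
        have "0 \<le> l * ?X \<nu>" using X0 l by simp
        then have "(l * ?X \<nu>)\<^sup>2 / 2 \<le> exp (l * ?X \<nu>)"
          using exp_lower_Taylor_quadratic[of "l * ?X \<nu>"] by linarith
        then have "?c * ((l * ?X \<nu>)\<^sup>2 / 2) \<le> ?c * exp (l * ?X \<nu>)" using c by (rule mult_left_mono)
        moreover have "?c * ((l * x)\<^sup>2 / 2) = x\<^sup>2 / T" for x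
          using l T by (simp add: power_mult_distrib)
        ultimately show ?thesis by (simp only:)
      qed
      \<comment> \<open>The excess over \<open>T\<close> is at most \<open>x\<^sup>2 / T\<close>,
        and the square is dominated by the exponential through \<open>sq\<close>.\<close>
      have "x \<le> min x T + x\<^sup>2 / T" if "x \<ge> 0" for x
      proof (cases "x \<le> T")
        case False
        then have "x * T \<le> x * x" using that by (intro mult_left_mono) simp_all
        then have "x \<le> x\<^sup>2 / T" using T by (simp add: pos_le_divide_eq power2_eq_square)
        then show ?thesis using False T by simp
      qed (use T in simp)
      from this[OF X0] have "?X \<nu> \<le> min (?X \<nu>) T + (?X \<nu>)\<^sup>2 / T" .
      also have "\<dots> \<le> min (real (Z n \<nu>) / a ^ n) T + ?c * exp (l * ?X \<nu>)"
        using XZ sq by (intro add_mono) simp_all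
      finally have "ennreal (?X \<nu>) \<le> ennreal (min (real (Z n \<nu>) / a ^ n) T + ?c * exp (l * ?X \<nu>))" by (rule ennreal_leI)
      also have "\<dots> = ennreal (min (real (Z n \<nu>) / a ^ n) T) + ennreal (?c * exp (l * ?X \<nu>))"
        using c T a_pos by (intro ennreal_plus mult_nonneg_nonneg) simp_all
      also have "ennreal (?c * exp (l * ?X \<nu>)) = ennreal ?c * ennreal (exp (l * ?X \<nu>))"
        using c by (intro ennreal_mult) simp_all
      finally show "ennreal (?X \<nu>) \<le> ennreal (min (real (Z n \<nu>) / a ^ n) T) + ennreal ?c * ennreal (exp (l * ?X \<nu>))" .
    qed
    also have "\<dots> = (\<integral>\<^sup>+\<nu>. ennreal (min (real (Z n \<nu>) / a ^ n) T) \<partial>GW) + ennreal ?c * mgf n y l"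
      unfolding mgf_def by (subst nn_integral_add) (simp_all add: nn_integral_cmult)
    also have "\<dots> \<le> (\<integral>\<^sup>+\<nu>. ennreal (min (real (Z n \<nu>) / a ^ n) T) \<partial>GW) + ennreal ?c * ennreal (exp (2 * l))"
      by (intro add_left_mono mult_left_mono mgf) simp
    also have "ennreal ?c * ennreal (exp (2 * l)) = ennreal (1 / 4)"
      using c l by (simp add: ennreal_mult[symmetric] T_def)
    finally have "(\<integral>\<^sup>+\<nu>. ennreal (?X \<nu>) \<partial>GW) \<le> (\<integral>\<^sup>+\<nu>. ennreal (min (real (Z n \<nu>) / a ^ n) T) \<partial>GW) + ennreal (1 / 4)" .
    moreover have "ennreal (1 / 4) + ennreal (1 / 4) \<le> (\<integral>\<^sup>+\<nu>. ennreal (?X \<nu>) \<partial>GW)"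
    proof -
      have "ennreal (1 / 4) + ennreal (1 / 4) = ennreal (1 / 2)" by (subst ennreal_plus[symmetric]) simp_all
      also have "\<dots> \<le> ennreal (1 - J y)" using y(2) by (intro ennreal_leI) simp
      also have "\<dots> \<le> (\<integral>\<^sup>+\<nu>. ennreal (?X \<nu>) \<partial>GW)" using y(1) by (rule Zt_mean_ge)
      finally show ?thesis .
    qed
    ultimately have "ennreal (1 / 4) + ennreal (1 / 4) \<le> (\<integral>\<^sup>+\<nu>. ennreal (min (real (Z n \<nu>) / a ^ n) T) \<partial>GW) + ennreal (1 / 4)"
      by (rule order_trans[rotated])
    then have "ennreal (1 / 4) + ennreal (1 / 4) \<le> ennreal (1 / 4) + (\<integral>\<^sup>+\<nu>. ennreal (min (real (Z n \<nu>) / a ^ n) T) \<partial>GW)"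
      by (subst add.commute[of "ennreal (1 / 4)" "\<integral>\<^sup>+\<nu>. _ \<nu> \<partial>_"])
    then show ?thesis
      unfolding ennreal_add_left_cancel_le by (rule disjE) (simp_all only: infinity_ennreal_def ennreal_neq_top)
  qed
  have "(\<lambda>n. \<integral>\<^sup>+\<nu>. ennreal (min (real (Z n \<nu>) / a ^ n) T) \<partial>GW) \<longlonglongrightarrow> (\<integral>\<^sup>+\<nu>. ennreal (min (W \<nu>) T) \<partial>GW)"
  proof (rule nn_integral_dominated_convergence[where w = "\<lambda>_. ennreal T"])
    show "AE \<nu> in GW. (\<lambda>n. ennreal (min (real (Z n \<nu>) / a ^ n) T)) \<longlonglongrightarrow> ennreal (min (W \<nu>) T)"
      using AE_regular by eventually_elim (intro tendsto_ennrealI tendsto_min tendsto_W tendsto_const)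
    show "AE \<nu> in GW. ennreal (min (real (Z n \<nu>) / a ^ n) T) \<le> ennreal T" for n
      by (intro AE_I2 ennreal_leI) simp
  qed simp_all
  then have "ennreal (1 / 4) \<le> (\<integral>\<^sup>+\<nu>. ennreal (min (W \<nu>) T) \<partial>GW)"
    by (rule tendsto_lowerbound) (simp_all add: quarter)
  also have "\<dots> \<le> (\<integral>\<^sup>+\<nu>. ennreal (max T 1) * ennreal (min (W \<nu>) 1) \<partial>GW)"
  proof (rule nn_integral_mono_AE)
    show "AE \<nu> in GW. ennreal (min (W \<nu>) T) \<le> ennreal (max T 1) * ennreal (min (W \<nu>) 1)"
      using AE_regular
    proof eventually_elim
      case (elim \<nu>)
      have W0: "W \<nu> \<ge> 0" using elim by (rule W_nonneg)
      have "min (W \<nu>) T \<le> max T 1 * min (W \<nu>) 1"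
      proof (cases "W \<nu> \<le> 1")
        case True
        then have "1 * W \<nu> \<le> max T 1 * W \<nu>" using W0 by (intro mult_right_mono) simp_all
        then show ?thesis using True by (simp add: min_def split: if_splits)
      qed simp
      then show ?case using W0 by (simp add: ennreal_mult'[symmetric] ennreal_leI del: ennreal_max_0)
    qed
  qed
  also have "\<dots> = ennreal (max T 1) * (\<integral>\<^sup>+\<nu>. ennreal (min (W \<nu>) 1) \<partial>GW)"
    by (rule nn_integral_cmult) simp
  finally have "ennreal (1 / 4) \<le> ennreal (max T 1) * (\<integral>\<^sup>+\<nu>. ennreal (min (W \<nu>) 1) \<partial>GW)" .
  then show ?thesis
    by (metis ennreal_eq_0_iff gr_zeroI le_zero_eq mult_zero_right not_le zero_less_divide_1_iff zero_less_numeral)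
qed

end

context dominated_law
begin

section \<open>Lower bound for sibling sums\<close>

text \<open>A reverse Markov inequality. The sum of \<open>min (W _) 1\<close> over the
  \<open>m\<close> siblings has mean \<open>m * r\<close> and is at most \<open>m\<close>; where the
  sibling sum is at most \<open>z\<close>, it is at most \<open>m * r / 2\<close>. So the complement
  has probability at least \<open>r / 2\<close>.\<close>

lemma Forest_siblings_ge:
  assumes r: "(\<integral>\<^sup>+\<nu>. ennreal (min (W \<nu>) 1) \<partial>GW) = ennreal r" "r > 0"
    and j: "j < n" and z: "z \<ge> 0" "2 * z < (real n - 1) * r"
  shows "ennreal (r / 2) \<le> (\<integral>\<^sup>+\<xi>. (if (\<Sum>l\<in>{..<n} - {j}. W (\<xi> l)) \<in> {z<..} then 1 else 0) \<partial>Forest)"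
proof -
  let ?S = "{..<n} - {j}"
  let ?P = "\<integral>\<^sup>+\<xi>. (if (\<Sum>l\<in>?S. W (\<xi> l)) \<in> {z<..} then 1 else 0) \<partial>Forest"
  define m where "m = real n - 1"
  have card: "real (card ?S) = m" using j by (simp add: m_def of_nat_diff)
  have m: "m > 0"
  proof (rule ccontr)
    assume "\<not> m > 0"
    then have "m * r \<le> 0" using r(2) by (intro mult_nonpos_nonneg) simp_all
    then show False using z by (simp add: m_def)
  qed
  have "?P \<le> 1"
    using nn_integral_mono[of Forest "\<lambda>\<xi>. if (\<Sum>l\<in>?S. W (\<xi> l)) \<in> {z<..} then 1 else 0" "\<lambda>_. 1"] by simp
  then obtain q where q: "?P = ennreal q" "q \<ge> 0" by (cases ?P) (auto simp: top_unique)
  have "ennreal (m * r) = (\<Sum>l\<in>?S. ennreal r)"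
    using m r(2) card by (simp add: ennreal_mult ennreal_of_nat_eq_real_of_nat del: card_Diff_insert card_Diff_singleton)
  also have "\<dots> = (\<integral>\<^sup>+\<xi>. (\<Sum>l\<in>?S. ennreal (min (W (\<xi> l)) 1)) \<partial>Forest)"
    by (subst nn_integral_sum) (simp_all add: nn_integral_Forest_component[where f = "\<lambda>\<nu>. ennreal (min (W \<nu>) 1)"] r(1))
  also have "\<dots> \<le> (\<integral>\<^sup>+\<xi>. ennreal m * (if (\<Sum>l\<in>?S. W (\<xi> l)) \<in> {z<..} then 1 else 0) + ennreal (m * r / 2) \<partial>Forest)"
  proof (rule nn_integral_mono_AE)
    show "AE \<xi> in Forest. (\<Sum>l\<in>?S. ennreal (min (W (\<xi> l)) 1)) \<le>
        ennreal m * (if (\<Sum>l\<in>?S. W (\<xi> l)) \<in> {z<..} then 1 else 0) + ennreal (m * r / 2)"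
      using AE_Forest[OF AE_regular]
    proof eventually_elim
      case (elim \<xi>)
      have W0: "W (\<xi> l) \<ge> 0" for l using elim W_nonneg by blast
      have eq: "(\<Sum>l\<in>?S. ennreal (min (W (\<xi> l)) 1)) = ennreal (\<Sum>l\<in>?S. min (W (\<xi> l)) 1)"
        using W0 by (intro sum_ennreal) simp
      show ?case
      proof (cases "z < (\<Sum>l\<in>?S. W (\<xi> l))")
        case True
        have "(\<Sum>l\<in>?S. min (W (\<xi> l)) 1) \<le> (\<Sum>l\<in>?S. 1)" by (intro sum_mono) simp
        also have "\<dots> = m" using card by simp
        finally have "(\<Sum>l\<in>?S. ennreal (min (W (\<xi> l)) 1)) \<le> ennreal m" unfolding eq by (rule ennreal_leI)
        then show ?thesis using True by (simp add: add_increasing2)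
      next
        case False
        have "(\<Sum>l\<in>?S. min (W (\<xi> l)) 1) \<le> (\<Sum>l\<in>?S. W (\<xi> l))" by (intro sum_mono) simp
        also have "\<dots> \<le> m * r / 2" using False z by (simp add: m_def)
        finally have "(\<Sum>l\<in>?S. ennreal (min (W (\<xi> l)) 1)) \<le> ennreal (m * r / 2)" unfolding eq by (rule ennreal_leI)
        then show ?thesis using False by simp
      qed
    qed
  qed
  also have "\<dots> = ennreal m * ennreal q + ennreal (m * r / 2)"
    unfolding q(1)[symmetric] by (subst nn_integral_add) (simp_all add: nn_integral_cmult)
  also have "\<dots> = ennreal (m * q + m * r / 2)"
    using m q(2) r(2) by (simp add: ennreal_mult[symmetric])
  finally have "m * r \<le> m * q + m * r / 2"
    using m q(2) r(2) by (subst (asm) ennreal_le_iff) simp_all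
  then have "m * (r / 2) \<le> m * q" by simp
  then have "r / 2 \<le> q" using m by simp
  then show ?thesis unfolding q(1) by (rule ennreal_leI)
qed

theorem siblings_lower:
  obtains c where "c > 0"
    "\<And>x. x \<ge> 0 \<Longrightarrow> ennreal (c * K x) \<le> (\<integral>\<^sup>+\<nu>. (\<Sum>j<\<nu> []. if siblings j \<nu> \<in> {b * x<..} then 1 else 0) \<partial>GW)"
proof -
  have "(\<integral>\<^sup>+\<nu>. ennreal (min (W \<nu>) 1) \<partial>GW) \<le> (\<integral>\<^sup>+\<nu>. 1 \<partial>GW)"
    by (rule nn_integral_mono) (simp add: ennreal_leI[of _ 1, simplified])
  then have "(\<integral>\<^sup>+\<nu>. ennreal (min (W \<nu>) 1) \<partial>GW) \<noteq> \<infinity>" by (auto simp: top_unique)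
  then obtain r where r: "(\<integral>\<^sup>+\<nu>. ennreal (min (W \<nu>) 1) \<partial>GW) = ennreal r" "r > 0"
    using W_nontrivial by (cases "\<integral>\<^sup>+\<nu>. ennreal (min (W \<nu>) 1) \<partial>GW") auto
  \<comment> \<open>\<open>b\<close> may be negative; a larger nonnegative factor only makes the
    event smaller.\<close>
  define b' where "b' = max b 0"
  have b': "b' \<ge> 0" "b \<le> b'" by (simp_all add: b'_def)
  have low: "ennreal (r / 2 * K (1 + 2 * b' * x / r)) \<le>
      (\<integral>\<^sup>+\<nu>. (\<Sum>j<\<nu> []. if siblings j \<nu> \<in> {b * x<..} then 1 else 0) \<partial>GW)" if x: "x \<ge> 0" for x
  proof -
    \<comment> \<open>Chosen such that \<open>n > ?y\<close> amounts to the condition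
      \<open>2 * (b' * x) < (n - 1) * r\<close> of \<open>Forest_siblings_ge\<close>.\<close>
    let ?y = "1 + 2 * b' * x / r"
    have y0: "?y \<ge> 0" using b' x r by simp
    have "ennreal (r / 2 * K ?y) = ennreal (r / 2) * ennreal (K ?y)"
      using r K_nonneg by (intro ennreal_mult) simp_all
    also have "\<dots> \<le> ennreal (r / 2) * tail ?y"
      using y0 by (intro mult_left_mono K_le_tail) simp_all
    also have "\<dots> = (\<integral>\<^sup>+n. ennreal (r / 2) * (if real n > ?y then ennreal (real n) else 0) \<partial>p)"
      unfolding tail_def by (rule nn_integral_cmult[symmetric]) (simp add: measurable_p_any)
    also have "\<dots> \<le> (\<integral>\<^sup>+n. (\<Sum>j<n. \<integral>\<^sup>+\<xi>. (if (\<Sum>l\<in>{..<n} - {j}. W (\<xi> l)) \<in> {b * x<..} then 1 else 0) \<partial>Forest) \<partial>p)"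
    proof (rule nn_integral_mono)
      fix n
      show "ennreal (r / 2) * (if real n > ?y then ennreal (real n) else 0)
          \<le> (\<Sum>j<n. \<integral>\<^sup>+\<xi>. (if (\<Sum>l\<in>{..<n} - {j}. W (\<xi> l)) \<in> {b * x<..} then 1 else 0) \<partial>Forest)"
      proof (cases "real n > ?y")
        case True
        then have z: "2 * (b' * x) < (real n - 1) * r" using r(2) by (simp add: field_simps)
        have "ennreal (r / 2) \<le> (\<integral>\<^sup>+\<xi>. (if (\<Sum>l\<in>{..<n} - {j}. W (\<xi> l)) \<in> {b * x<..} then 1 else 0) \<partial>Forest)"
          if "j < n" for j
        proof -
          have "ennreal (r / 2) \<le> (\<integral>\<^sup>+\<xi>. (if (\<Sum>l\<in>{..<n} - {j}. W (\<xi> l)) \<in> {b' * x<..} then 1 else 0) \<partial>Forest)"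
            using b' x z by (intro Forest_siblings_ge r that) simp_all
          also have "\<dots> \<le> (\<integral>\<^sup>+\<xi>. (if (\<Sum>l\<in>{..<n} - {j}. W (\<xi> l)) \<in> {b * x<..} then 1 else 0) \<partial>Forest)"
          proof (rule nn_integral_mono)
            have "b * x \<le> b' * x" using b' x by (intro mult_right_mono)
            then show "(if (\<Sum>l\<in>{..<n} - {j}. W (\<xi> l)) \<in> {b' * x<..} then 1 else 0)
                \<le> (if (\<Sum>l\<in>{..<n} - {j}. W (\<xi> l)) \<in> {b * x<..} then 1 else 0 :: ennreal)" for \<xi>
              by simp
          qed
          finally show ?thesis .
        qed
        then have "(\<Sum>j<n. ennreal (r / 2)) \<le>
            (\<Sum>j<n. \<integral>\<^sup>+\<xi>. (if (\<Sum>l\<in>{..<n} - {j}. W (\<xi> l)) \<in> {b * x<..} then 1 else 0) \<partial>Forest)"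
          by (intro sum_mono) simp
        moreover have "(\<Sum>j<n. ennreal (r / 2)) = ennreal (r / 2) * ennreal (real n)"
          by (simp add: ennreal_of_nat_eq_real_of_nat mult.commute)
        ultimately show ?thesis using True by simp
      qed simp
    qed
    also have "\<dots> = (\<integral>\<^sup>+\<nu>. (\<Sum>j<\<nu> []. if siblings j \<nu> \<in> {b * x<..} then 1 else 0) \<partial>GW)"
      by (rule siblings_split[symmetric]) simp
    finally show ?thesis .
  qed
  define q where "q = 1 + 2 * b' / r"
  have q: "q \<ge> 1" using b' r by (simp add: q_def)
  obtain C where C: "C > 0" "\<And>x. x \<ge> 0 \<Longrightarrow> K x \<le> C * K (q * x)" using scaling[of q] by blast
  \<comment> \<open>Two ranges: for \<open>x \<ge> 1\<close> the summand 1 is absorbed into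
    \<open>q * x\<close>, for \<open>x < 1\<close> the argument stays below \<open>q\<close> and
    \<open>K x \<le> a\<close>.\<close>
  define d where "d = min (1 / C) (K q / a)"
  have d: "d > 0" using C(1) K_pos a_pos by (simp add: d_def)
  have dK: "d * K x \<le> K (1 + 2 * b' * x / r)" if x: "x \<ge> 0" for x
  proof (cases "x \<ge> 1")
    case True
    have "d * K x \<le> 1 / C * K x" using K_nonneg by (intro mult_right_mono) (simp_all add: d_def)
    also have "\<dots> \<le> K (q * x)" using C(1) C(2)[OF x] by (simp add: pos_divide_le_eq mult.commute)
    also have "\<dots> \<le> K (1 + 2 * b' * x / r)" using True by (intro K_antimono) (simp add: q_def distrib_right)
    finally show ?thesis .
  next
    case False
    have "d * K x \<le> K q / a * a"
      using K_le_a[OF x] K_nonneg d a_pos by (intro mult_mono) (simp_all add: d_def)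
    also have "\<dots> = K q" using a_pos by simp
    also have "\<dots> \<le> K (1 + 2 * b' * x / r)"
    proof (rule K_antimono)
      have "2 * b' * x \<le> 2 * b'" using False b' mult_left_mono[of x 1 "2 * b'"] by simp
      then show "1 + 2 * b' * x / r \<le> q" using r(2) by (simp add: q_def divide_right_mono)
    qed
    finally show ?thesis .
  qed
  have "ennreal (r / 2 * d * K x) \<le> (\<integral>\<^sup>+\<nu>. (\<Sum>j<\<nu> []. if siblings j \<nu> \<in> {b * x<..} then 1 else 0) \<partial>GW)"
    if x: "x \<ge> 0" for x
  proof -
    have "ennreal (r / 2 * d * K x) \<le> ennreal (r / 2 * K (1 + 2 * b' * x / r))"
      using mult_left_mono[OF dK[OF x], of "r / 2"] r(2) by (intro ennreal_leI) (simp add: mult.assoc)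
    also note low[OF x]
    finally show ?thesis .
  qed
  moreover have "r / 2 * d > 0" using r d by simp
  ultimately show thesis using that by blast
qed

lemma keep_add_compl:
  assumes [measurable]: "B \<in> sets borel"
  shows "keep B + (\<integral>\<^sup>+\<nu>. (\<Sum>j<\<nu> []. if siblings j \<nu> \<in> - B then 1 else 0) \<partial>GW) * ennreal (1 / a) = 1"
proof -
  have meas: "(\<lambda>\<nu>. \<Sum>j<\<nu> []. if siblings j \<nu> \<in> A then 1 else 0 :: ennreal) \<in> borel_measurable GW"
    if [measurable]: "A \<in> sets borel" for A
    by (rule measurable_sum_children) measurable
  have "(\<integral>\<^sup>+\<nu>. (\<Sum>j<\<nu> []. if siblings j \<nu> \<in> B then 1 else 0) \<partial>GW) + (\<integral>\<^sup>+\<nu>. (\<Sum>j<\<nu> []. if siblings j \<nu> \<in> - B then 1 else 0) \<partial>GW)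
     = (\<integral>\<^sup>+\<nu>. (\<Sum>j<\<nu> []. if siblings j \<nu> \<in> UNIV then 1 else 0) \<partial>GW)"
  proof (subst nn_integral_add[symmetric])
    have "(\<Sum>j<\<nu> []. if siblings j \<nu> \<in> B then 1 else 0) + (\<Sum>j<\<nu> []. if siblings j \<nu> \<in> - B then 1 else 0)
        = (\<Sum>j<\<nu> []. if siblings j \<nu> \<in> UNIV then 1 else 0 :: ennreal)" for \<nu>
      unfolding sum.distrib[symmetric] by (rule sum.cong) auto
    then show "(\<integral>\<^sup>+\<nu>. (\<Sum>j<\<nu> []. if siblings j \<nu> \<in> B then 1 else 0) + (\<Sum>j<\<nu> []. if siblings j \<nu> \<in> - B then 1 else 0) \<partial>GW)
        = (\<integral>\<^sup>+\<nu>. (\<Sum>j<\<nu> []. if siblings j \<nu> \<in> UNIV then 1 else 0) \<partial>GW)"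
      by (simp only:)
  qed (simp_all add: meas)
  then show ?thesis
    using keep_UNIV unfolding keep_def distrib_right[symmetric] by simp
qed

text \<open>The complement has probability at least a multiple of \<open>K x\<close>, and
  \<open>1 - t \<le> exp (- t)\<close>. In exponential form, products over levels become sums of
  \<open>K\<close>.\<close>

theorem keep_le_exp:
  obtains c where "c > 0" "\<And>x. x \<ge> 0 \<Longrightarrow> keep {..b * x} \<le> ennreal (exp (- c * K x))"
proof -
  obtain c where c: "c > 0"
    "\<And>x. x \<ge> 0 \<Longrightarrow> ennreal (c * K x) \<le> (\<integral>\<^sup>+\<nu>. (\<Sum>j<\<nu> []. if siblings j \<nu> \<in> {b * x<..} then 1 else 0) \<partial>GW)"
    using siblings_lower by blast
  have "keep {..b * x} \<le> ennreal (exp (- (c / a) * K x))" if x: "x \<ge> 0" for x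
  proof -
    have compl: "- {..b * x} = {b * x<..}" by auto
    have "keep {..b * x} + ennreal (c * K x) * ennreal (1 / a) \<le> keep {..b * x} +
        (\<integral>\<^sup>+\<nu>. (\<Sum>j<\<nu> []. if siblings j \<nu> \<in> {b * x<..} then 1 else 0) \<partial>GW) * ennreal (1 / a)"
      by (intro add_left_mono mult_right_mono c(2)[OF x]) simp
    also have "\<dots> = 1" using keep_add_compl[of "{..b * x}"] unfolding compl by simp
    finally have "keep {..b * x} + ennreal (c * K x) * ennreal (1 / a) \<le> 1" .
    moreover have "ennreal (c * K x) * ennreal (1 / a) = ennreal (c / a * K x)"
      using c(1) K_nonneg a_pos by (simp add: ennreal_mult[symmetric])
    ultimately have le: "keep {..b * x} + ennreal (c / a * K x) \<le> 1" by simp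
    have "keep {..b * x} \<le> keep {..b * x} + ennreal (c / a * K x)" by simp
    with le have "keep {..b * x} \<le> 1" by (rule order_trans[rotated])
    then obtain k where k: "keep {..b * x} = ennreal k" "k \<ge> 0"
      by (cases "keep {..b * x}") (auto simp: top_unique)
    have "c / a * K x \<ge> 0" using c(1) K_nonneg a_pos by simp
    with le k have "k + c / a * K x \<le> 1"
      by (simp add: ennreal_plus[symmetric] ennreal_1[symmetric] del: ennreal_plus ennreal_1)
    then have "k \<le> 1 + - (c / a) * K x" by simp
    also have "\<dots> \<le> exp (- (c / a) * K x)" by (rule exp_ge_add_one_self)
    finally show ?thesis unfolding k(1) by (rule ennreal_leI)
  qed
  moreover have "c / a > 0" using c(1) a_pos by simp
  ultimately show thesis using that by blast
qed

section \<open>Extinction\<close>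

definition extinct :: "(nat list \<Rightarrow> nat) \<Rightarrow> bool" where
  "extinct \<nu> \<longleftrightarrow> (\<exists>n. Z n \<nu> = 0)"

lemma Z_eq_0_mono:
  assumes "Z n \<nu> = 0" "n \<le> m"
  shows "Z m \<nu> = 0"
  using assms(2)
proof (induction m rule: dec_induct)
  case base
  show ?case by (rule assms(1))
next
  case (step m)
  then have "generation m \<nu> = {}" by (simp add: Z_eq_card)
  then show ?case by (simp only: Z_Suc_snoc sum.empty)
qed

lemma extinct_iff_children: "extinct \<nu> \<longleftrightarrow> (\<forall>k<\<nu> []. extinct (sub k \<nu>))"
proof
  assume "extinct \<nu>"
  then obtain n where n: "Z n \<nu> = 0" by (auto simp: extinct_def)
  then obtain m where m: "n = Suc m" by (cases n) simp_all
  have "Z m (sub k \<nu>) = 0" if "k < \<nu> []" for k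
    using n that by (simp add: m)
  then show "\<forall>k<\<nu> []. extinct (sub k \<nu>)" by (auto simp: extinct_def)
next
  assume "\<forall>k<\<nu> []. extinct (sub k \<nu>)"
  then obtain n where n: "\<And>k. k < \<nu> [] \<Longrightarrow> Z (n k) (sub k \<nu>) = 0"
    unfolding extinct_def by metis
  \<comment> \<open>Without children, \<open>Max\<close> is taken of the empty set and has an
    unspecified value, but then \<open>Z (Suc m) \<nu>\<close> is an empty sum for any
    \<open>m\<close>.\<close>
  define m where "m = Max (n ` {..<\<nu> []})"
  have "Z m (sub k \<nu>) = 0" if "k < \<nu> []" for k
    using n[OF that] that by (rule_tac Z_eq_0_mono) (auto simp: m_def)
  then have "Z (Suc m) \<nu> = 0" by simp
  then show "extinct \<nu>" by (auto simp only: extinct_def)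
qed

lemma measurable_extinct [measurable]: "Measurable.pred GW extinct"
proof -
  have "extinct = (\<lambda>\<nu>. \<exists>n. real (Z n \<nu>) = 0)" by (simp add: extinct_def[abs_def])
  also have "Measurable.pred GW \<dots>" by measurable
  finally show ?thesis .
qed

text \<open>The subtrees of the root are independent, so given \<open>n\<close> children the
  property has probability \<open>q ^ n\<close>: its probability is a fixed point of the offspring
  generating function.\<close>

lemma hereditary_fixed_point:
  assumes Q[measurable]: "Measurable.pred GW Q"
    and her: "AE \<nu> in GW. Q \<nu> \<longleftrightarrow> (\<forall>k<\<nu> []. Q (sub k \<nu>))"
  shows "(\<integral>n. GW.prob {\<nu>. Q \<nu>} ^ n \<partial>p) = GW.prob {\<nu>. Q \<nu>}"
proof -
  let ?q = "GW.prob {\<nu>. Q \<nu>}"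
  let ?I = "\<lambda>\<nu>. if Q \<nu> then 1 else 0 :: ennreal"
  have q: "(\<integral>\<^sup>+\<nu>. ?I \<nu> \<partial>GW) = ennreal ?q"
  proof -
    have "{\<nu>. Q \<nu>} \<in> sets GW" using Q by (simp add: pred_def)
    moreover have "(\<integral>\<^sup>+\<nu>. ?I \<nu> \<partial>GW) = (\<integral>\<^sup>+\<nu>. indicator {\<nu>. Q \<nu>} \<nu> \<partial>GW)"
      by (rule nn_integral_cong) (simp add: indicator_def)
    ultimately show ?thesis by (simp add: GW.emeasure_eq_measure)
  qed
  have int: "integrable p (\<lambda>n. ?q ^ n)"
    by (rule integrable_p_bound[of _ 0 1]) (simp add: power_le_one)
  have meas: "(\<lambda>\<nu>. \<Prod>k<\<nu> []. ?I (sub k \<nu>)) \<in> borel_measurable GW"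
    by (rule measurable_children[where F = "\<lambda>r \<nu>. \<Prod>k<r. ?I (sub k \<nu>)"]) measurable
  have "ennreal ?q = (\<integral>\<^sup>+\<nu>. (\<Prod>k<\<nu> []. ?I (sub k \<nu>)) \<partial>GW)"
    unfolding q[symmetric]
  proof (rule nn_integral_cong_AE)
    show "AE \<nu> in GW. ?I \<nu> = (\<Prod>k<\<nu> []. ?I (sub k \<nu>))"
      using her
    proof eventually_elim
      case (elim \<nu>)
      show ?case
      proof (cases "\<forall>k<\<nu> []. Q (sub k \<nu>)")
        case False
        then obtain k where "k < \<nu> []" "\<not> Q (sub k \<nu>)" by blast
        then have "(\<Prod>k<\<nu> []. ?I (sub k \<nu>)) = 0" by (intro prod_zero bexI[of _ k]) simp_all
        then show ?thesis using False elim by simp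
      qed (use elim in simp)
    qed
  qed
  also have "\<dots> = (\<integral>\<^sup>+n. \<integral>\<^sup>+\<xi>. (\<Prod>k<n. ?I (\<xi> k)) \<partial>Forest \<partial>p)"
    by (subst nn_integral_GW_split[OF meas]) simp
  also have "\<dots> = (\<integral>\<^sup>+n. ennreal (?q ^ n) \<partial>p)"
  proof (rule nn_integral_cong)
    fix n
    have "(\<integral>\<^sup>+\<xi>. (\<Prod>k\<in>{..<n}. ?I (\<xi> k)) \<partial>Forest) = ennreal ?q ^ n"
      by (subst nn_integral_Forest_prod) (simp_all add: q)
    then show "(\<integral>\<^sup>+\<xi>. (\<Prod>k<n. ?I (\<xi> k)) \<partial>Forest) = ennreal (?q ^ n)"
      by (simp add: ennreal_power)
  qed
  also have "\<dots> = ennreal (\<integral>n. ?q ^ n \<partial>p)"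
    by (rule nn_integral_eq_integral[OF int]) simp
  finally show ?thesis
    by (subst (asm) ennreal_inj) (simp_all add: integral_nonneg_AE)
qed

text \<open>Dividing by \<open>1 - s\<close> turns the fixed point equation into
  \<open>E (\<Sum>k<N. s ^ k) = 1\<close>. The left side is strictly increasing in \<open>s\<close>
  unless \<open>N \<le> 1\<close> almost surely, which a mean above 1 forbids.\<close>

lemma fixed_point_unique:
  fixes q r :: real
  assumes q: "0 \<le> q" "q \<le> r" and r: "r < 1"
    and fix_q: "(\<integral>n. q ^ n \<partial>p) = q" and fix_r: "(\<integral>n. r ^ n \<partial>p) = r"
  shows "q = r"
proof (rule ccontr)
  assume "q \<noteq> r"
  then have lt: "q < r" using q(2) by (simp add: less_le)
  have int: "integrable p (\<lambda>n. s ^ n)" if "0 \<le> s" "s \<le> 1" for s :: real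
    using that by (intro integrable_p_bound[of _ 0 1]) (simp add: power_le_one)
  have bound: "\<bar>\<Sum>k<n. s ^ k\<bar> \<le> 1 * real n + 0" if "0 \<le> s" "s \<le> 1" for s :: real and n :: nat
  proof -
    have "\<bar>\<Sum>k<n. s ^ k\<bar> \<le> (\<Sum>k<n. \<bar>s ^ k\<bar>)" by (rule sum_abs)
    also have "\<dots> \<le> (\<Sum>k<n. 1)" using that by (intro sum_mono) (simp add: power_le_one)
    finally show ?thesis by simp
  qed
  have geo: "(\<integral>n. (\<Sum>k<n. s ^ k) \<partial>p) = 1" if s: "0 \<le> s" "s < 1" "(\<integral>n. s ^ n \<partial>p) = s" for s :: real
  proof -
    have "(1 - s) * (\<integral>n. (\<Sum>k<n. s ^ k) \<partial>p) = (\<integral>n. 1 - s ^ n \<partial>p)"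
      by (simp add: one_diff_power_eq flip: integral_mult_right_zero)
    also have "\<dots> = 1 - s" using s int[of s] by (simp add: p.prob_space)
    finally show ?thesis using s by simp
  qed
  let ?d = "\<lambda>n. (\<Sum>k<n. r ^ k) - (\<Sum>k<n. q ^ k)"
  have int': "integrable p (\<lambda>n. \<Sum>k<n. s ^ k)" if "0 \<le> s" "s \<le> 1" for s :: real
    by (rule integrable_p_bound[OF bound[OF that]])
  have d0: "?d n \<ge> 0" for n
    using q by (simp add: sum_mono power_mono)
  have "(\<integral>n. ?d n \<partial>p) = 0"
    using geo[of q] geo[of r] q r fix_q fix_r lt int'[of q] int'[of r] by simp
  then have "AE n in p. ?d n = 0"
    using integral_nonneg_eq_0_iff_AE[of p ?d] d0 int'[of q] int'[of r] q r by simp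
  then have "AE n in p. real n \<le> 1"
  proof eventually_elim
    case (elim n)
    show ?case
    proof (rule ccontr)
      assume "\<not> real n \<le> 1"
      then have n: "1 \<in> {..<n}" by simp
      have "(\<Sum>k<n. q ^ k) < (\<Sum>k<n. r ^ k)"
      proof (rule sum_strict_mono_ex1)
        show "\<forall>k\<in>{..<n}. q ^ k \<le> r ^ k" using q by (intro ballI power_mono)
        show "\<exists>k\<in>{..<n}. q ^ k < r ^ k" using lt by (intro bexI[OF _ n]) simp
      qed simp
      with elim show False by simp
    qed
  qed
  then have "a \<le> (\<integral>n. 1 \<partial>p)"
    using integrable_p by (intro integral_mono_AE) simp_all
  then show False using a_gt_1 by (simp add: p.prob_space)
qed

text \<open>Extinction and \<open>W = 0\<close> are both hereditary and have probability below 1, as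
  \<open>W\<close> is nontrivial and extinction implies \<open>W = 0\<close>. So both probabilities
  are the same fixed point, and the two events differ by a null set.\<close>

theorem AE_extinct_if_W_eq_0: "AE \<nu> in GW. W \<nu> = 0 \<longrightarrow> extinct \<nu>"
proof -
  let ?q = "GW.prob {\<nu>. extinct \<nu>}" and ?r = "GW.prob {\<nu>. W \<nu> = 0}"
  have sets: "{\<nu>. extinct \<nu>} \<in> sets GW" "{\<nu>. W \<nu> = 0} \<in> sets GW"
  proof -
    show "{\<nu>. extinct \<nu>} \<in> sets GW" using measurable_extinct by (simp add: pred_def)
    have "{\<nu> \<in> space GW. W \<nu> = 0} \<in> sets GW" by measurable
    then show "{\<nu>. W \<nu> = 0} \<in> sets GW" by simp
  qed
  have ext_W: "W \<nu> = 0" if "regular \<nu>" "extinct \<nu>" for \<nu>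
  proof -
    obtain n where "Z n \<nu> = 0" using \<open>extinct \<nu>\<close> by (auto simp: extinct_def)
    then have "\<forall>\<^sub>F m in sequentially. real (Z m \<nu>) / a ^ m = 0"
      using Z_eq_0_mono by (intro eventually_sequentiallyI[of n]) simp
    then have "(\<lambda>m. real (Z m \<nu>) / a ^ m) \<longlonglongrightarrow> 0" by (rule tendsto_eventually)
    then show ?thesis using tendsto_W[OF \<open>regular \<nu>\<close>] LIMSEQ_unique by blast
  qed
  have fix_q: "(\<integral>n. ?q ^ n \<partial>p) = ?q"
    by (rule hereditary_fixed_point[OF measurable_extinct], rule AE_I2, rule extinct_iff_children)
  have fix_r: "(\<integral>n. ?r ^ n \<partial>p) = ?r"
  proof (rule hereditary_fixed_point)
    show "AE \<nu> in GW. (W \<nu> = 0) = (\<forall>k<\<nu> []. W (sub k \<nu>) = 0)"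
      using AE_regular
    proof eventually_elim
      case (elim \<nu>)
      have "W \<nu> = 0 \<longleftrightarrow> (\<Sum>k<\<nu> []. W (sub k \<nu>)) = 0"
        using W_eq_sum_children[OF elim] a_pos by simp
      also have "\<dots> \<longleftrightarrow> (\<forall>k<\<nu> []. W (sub k \<nu>) = 0)"
        using W_nonneg[OF regular_sub[OF elim]] by (subst sum_nonneg_eq_0_iff) auto
      finally show ?case .
    qed
  qed measurable
  have qr: "?q \<le> ?r"
  proof (rule GW.finite_measure_mono_AE)
    show "AE \<nu> in GW. \<nu> \<in> {\<nu>. extinct \<nu>} \<longrightarrow> \<nu> \<in> {\<nu>. W \<nu> = 0}"
      using AE_regular by eventually_elim (use ext_W in blast)
  qed (rule sets)
  have r1: "?r < 1"
  proof (rule ccontr)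
    assume "\<not> ?r < 1"
    then have "?r = 1" using GW.prob_le_1[of "{\<nu>. W \<nu> = 0}"] by simp
    then have "AE \<nu> in GW. W \<nu> = 0"
      using GW.AE_prob_1[of "{\<nu>. W \<nu> = 0}"] by simp
    then have "(\<integral>\<^sup>+\<nu>. ennreal (min (W \<nu>) 1) \<partial>GW) = (\<integral>\<^sup>+\<nu>. 0 \<partial>GW)"
      by (intro nn_integral_cong_AE) (auto elim!: eventually_mono)
    then show False using W_nontrivial by simp
  qed
  have eq: "?q = ?r" by (rule fixed_point_unique[OF measure_nonneg qr r1 fix_q fix_r])
  have "AE \<nu> in GW. \<nu> \<notin> {\<nu>. W \<nu> = 0} - {\<nu>. extinct \<nu>}"
  proof (rule AE_not_in)
    have "{\<nu>. W \<nu> = 0} - {\<nu>. extinct \<nu>} \<in> sets GW" using sets by blast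
    moreover have "GW.prob ({\<nu>. W \<nu> = 0} - {\<nu>. extinct \<nu>}) = 0"
    proof -
      have "GW.prob {\<nu>. extinct \<nu>} = GW.prob ({\<nu>. W \<nu> = 0} \<inter> {\<nu>. extinct \<nu>})"
      proof (rule GW.finite_measure_eq_AE)
        show "AE \<nu> in GW. \<nu> \<in> {\<nu>. extinct \<nu>} \<longleftrightarrow> \<nu> \<in> {\<nu>. W \<nu> = 0} \<inter> {\<nu>. extinct \<nu>}"
          using AE_regular by eventually_elim (use ext_W in blast)
      qed (use sets in blast)+
      then have "?r - GW.prob ({\<nu>. W \<nu> = 0} \<inter> {\<nu>. extinct \<nu>}) = 0" using eq by linarith
      then show ?thesis using GW.finite_measure_Diff'[OF sets(2,1)] by linarith
    qed
    ultimately show "{\<nu>. W \<nu> = 0} - {\<nu>. extinct \<nu>} \<in> null_sets GW"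
      by (simp add: null_sets_def GW.emeasure_eq_measure)
  qed
  then show ?thesis by eventually_elim auto
qed

lemma AE_W_pos_if_bdry: "AE \<nu> in GW. bdry \<nu> \<noteq> {} \<longrightarrow> W \<nu> > 0"
  using AE_extinct_if_W_eq_0 AE_regular
proof eventually_elim
  case (elim \<nu>)
  show ?case
  proof
    assume "bdry \<nu> \<noteq> {}"
    then obtain x where x: "\<And>n. stake n x \<in> tree \<nu>" by (auto simp: bdry_def)
    have "Z n \<nu> \<noteq> 0" for n
    proof -
      have "stake n x \<in> generation n \<nu>" using x by (simp add: generation_def)
      then show ?thesis by (auto simp: Z_eq_card)
    qed
    then have "\<not> extinct \<nu>" by (simp add: extinct_def)
    then have "W \<nu> \<noteq> 0" using elim(1) by blast
    then show "W \<nu> > 0" using W_nonneg[OF elim(2)] by simp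
  qed
qed

lemma not_AE_W_eq_0: "\<not> (AE \<nu> in GW. W \<nu> = 0)"
proof
  assume "AE \<nu> in GW. W \<nu> = 0"
  then have "(\<integral>\<^sup>+\<nu>. ennreal (min (W \<nu>) 1) \<partial>GW) = (\<integral>\<^sup>+\<nu>. 0 \<partial>GW)"
    by (intro nn_integral_cong_AE) (auto elim!: eventually_mono)
  then show False using W_nontrivial by simp
qed

end

section \<open>Almost sure behaviour along the boundary for a given gauge\<close>

locale gauge = dominated_law +
  fixes g \<phi> :: "real \<Rightarrow> real"
  assumes gauge_rep: "gauge_rep a g \<phi>"
begin

section \<open>The gauge function\<close>

text \<open>The gauge of a cylinder of level \<open>n\<close>. Its mass being
  \<open>W / a ^ n\<close>, mass over \<open>G\<close> is \<open>W / g\<close>.\<close>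

definition G :: "nat \<Rightarrow> real" where
  "G n = g (real n) / a ^ n"

lemma g_pos: "g (real n) > 0"
  using gauge_rep by (simp add: gauge_rep_def class_G_def)

lemma G_pos: "G n > 0"
  using g_pos a_pos by (simp add: G_def)

lemma \<phi>_exp: "\<phi> (exp (- real n)) = G n"
proof -
  have "\<phi> (exp (- real n)) = exp (- real n) powr ln a * g \<bar>ln (exp (- real n))\<bar>"
    using gauge_rep exp_gt_zero by (simp only: gauge_rep_def)
  also have "exp (- real n) powr ln a = exp (- (real n * ln a))"
    by (simp add: powr_def mult.commute)
  also have "\<dots> = 1 / a ^ n"
    using a_pos by (simp add: exp_minus exp_of_nat_mult inverse_eq_divide)
  finally show ?thesis by (simp add: G_def)
qed

lemma G_lim: "G \<longlonglongrightarrow> 0"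
proof -
  have "(\<phi> \<longlongrightarrow> 0) (at_right 0)" using gauge_rep by (simp add: gauge_rep_def)
  moreover have "filterlim (\<lambda>n. exp (- real n)) (at_right 0) sequentially"
    unfolding filterlim_at_right_to_top by (rule filterlim_at_withinI) (real_asymp, simp)
  ultimately have "(\<lambda>n. \<phi> (exp (- real n))) \<longlonglongrightarrow> 0" by (rule filterlim_compose)
  then show ?thesis by (simp add: \<phi>_exp)
qed

text \<open>The limsup is strictly below \<open>a\<close>, which leaves room for a factor
  \<open>b < a\<close>; it makes the recursion for \<open>W / g\<close> contract.\<close>

lemma g_growth:
  obtains b n0 where "b > 0" "b < a" "\<And>n. n \<ge> n0 \<Longrightarrow> g (real (Suc n)) \<le> b * g (real n)"
proof -
  have "limsup (\<lambda>n. ereal (g (real (Suc n)) / g (real n))) < ereal a"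
    using gauge_rep by (simp add: gauge_rep_def class_G_def)
  then obtain b where b: "limsup (\<lambda>n. ereal (g (real (Suc n)) / g (real n))) < ereal b" "ereal b < ereal a"
    using ereal_dense2 by blast
  have "\<forall>\<^sub>F n in sequentially. ereal (g (real (Suc n)) / g (real n)) < ereal b"
    using b(1) by (rule Limsup_lessD)
  then obtain n0 where n0: "\<And>n. n \<ge> n0 \<Longrightarrow> g (real (Suc n)) / g (real n) < b"
    by (auto simp: eventually_sequentially)
  have "g (real (Suc n)) \<le> b * g (real n)" if "n \<ge> n0" for n
    using n0[OF that] g_pos[of n] by (simp add: pos_divide_less_eq less_imp_le del: of_nat_Suc)
  moreover have "b > 0"
    using n0[of n0] g_pos[of n0] g_pos[of "Suc n0"]
    by (meson divide_pos_pos less_trans order_refl)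
  ultimately show thesis using that b(2) by auto
qed

lemma cylinder_density: "regular \<nu> \<Longrightarrow> cylinder_density (bm \<nu>) \<phi> G"
  using gauge_rep
  by (intro cylinder_density.intro cylinder_density_axioms.intro finite_bm sets_bm \<phi>_exp G_pos G_lim)
     (simp_all add: gauge_rep_def)

section \<open>Masses and sibling sums along a path\<close>

definition pathW :: "(nat list \<Rightarrow> nat) \<Rightarrow> nat \<Rightarrow> nat stream \<Rightarrow> real" where
  "pathW \<nu> n x = W (shift (stake n x) \<nu>)"

definition pathS :: "(nat list \<Rightarrow> nat) \<Rightarrow> nat \<Rightarrow> nat stream \<Rightarrow> real" where
  "pathS \<nu> n x = siblings (x !! n) (shift (stake n x) \<nu>)"

lemma pathW_nonneg: "regular \<nu> \<Longrightarrow> pathW \<nu> n x \<ge> 0"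
  unfolding pathW_def by (intro W_nonneg regular_shift)

lemma mass_eq:
  assumes "regular \<nu>" "x \<in> bdry \<nu>"
  shows "measure (bm \<nu>) (cylinder (stake n x)) = pathW \<nu> n x / a ^ n"
  using measure_bm_cylinder[OF assms(1), of "stake n x"] assms(2) by (simp add: bdry_def pathW_def)

lemma mass_div_G:
  assumes "regular \<nu>" "x \<in> bdry \<nu>"
  shows "measure (bm \<nu>) (cylinder (stake n x)) / G n = pathW \<nu> n x / g (real n)"
  using a_pos by (simp add: mass_eq[OF assms] G_def)

lemma pathW_Suc:
  assumes reg: "regular \<nu>" and x: "x \<in> bdry \<nu>"
  shows "pathW \<nu> n x = (pathS \<nu> n x + pathW \<nu> (Suc n) x) / a"
proof -
  let ?i = "stake n x"
  have st: "stake (Suc n) x = ?i @ [x !! n]" by (rule stake_Suc)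
  have "stake (Suc n) x \<in> tree \<nu>" using x by (simp only: bdry_def mem_Collect_eq)
  then have lt: "x !! n < \<nu> ?i" unfolding st by (simp add: tree_snoc)
  have "W (shift ?i \<nu>) = (\<Sum>k<\<nu> ?i. W (shift (?i @ [k]) \<nu>)) / a" by (rule W_shift_eq_sum[OF reg])
  also have "(\<Sum>k<\<nu> ?i. W (shift (?i @ [k]) \<nu>)) =
      W (shift (?i @ [x !! n]) \<nu>) + (\<Sum>k\<in>{..<\<nu> ?i} - {x !! n}. W (shift (?i @ [k]) \<nu>))"
    using lt by (intro sum.remove) simp_all
  also have "(\<Sum>k\<in>{..<\<nu> ?i} - {x !! n}. W (shift (?i @ [k]) \<nu>)) = pathS \<nu> n x"
    by (simp add: pathS_def siblings_def sub_shift shift_at)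
  finally show ?thesis by (simp add: pathW_def st add.commute del: stake.simps)
qed

lemma pathS_nonneg: "regular \<nu> \<Longrightarrow> pathS \<nu> n x \<ge> 0"
  unfolding pathS_def siblings_def by (intro sum_nonneg W_nonneg regular_sub regular_shift)

lemma siblings_stake:
  "m < n \<Longrightarrow> siblings (stake n x ! m) (shift (take m (stake n x)) \<nu>) = pathS \<nu> m x"
  by (simp add: pathS_def take_stake_le stake_nth)

definition path_event :: "(nat list \<Rightarrow> nat) \<Rightarrow> nat \<Rightarrow> (nat \<Rightarrow> real set) \<Rightarrow> ((nat list \<Rightarrow> nat) \<Rightarrow> bool) \<Rightarrow> nat stream set" where
  "path_event \<nu> n B Q = {x. stake n x \<in> tree \<nu> \<and> (\<forall>m<n. pathS \<nu> m x \<in> B m) \<and> Q (shift (stake n x) \<nu>)}"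

text \<open>The condition of \<open>path_event\<close> on prefixes instead of infinite words: a
  finite set, over which \<open>R\<close> is a sum.\<close>

definition path_words :: "(nat list \<Rightarrow> nat) \<Rightarrow> nat \<Rightarrow> (nat \<Rightarrow> real set) \<Rightarrow> ((nat list \<Rightarrow> nat) \<Rightarrow> bool) \<Rightarrow> nat list set" where
  "path_words \<nu> n B Q = {i \<in> generation n \<nu>. (\<forall>m<n. siblings (i ! m) (shift (take m i) \<nu>) \<in> B m) \<and> Q (shift i \<nu>)}"

lemma path_event_iff: "x \<in> path_event \<nu> n B Q \<longleftrightarrow> stake n x \<in> path_words \<nu> n B Q"
proof -
  have "(\<forall>m<n. siblings (stake n x ! m) (shift (take m (stake n x)) \<nu>) \<in> B m) \<longleftrightarrow> (\<forall>m<n. pathS \<nu> m x \<in> B m)"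
    by (rule iff_allI) (auto simp only: siblings_stake)
  then show ?thesis
    unfolding path_event_def path_words_def generation_def by simp
qed

lemma path_event_eq_UN: "path_event \<nu> n B Q = (\<Union>i\<in>path_words \<nu> n B Q. cylinder i)"
proof -
  have "x \<in> cylinder i \<longleftrightarrow> stake n x = i" if "i \<in> path_words \<nu> n B Q" for x i
    using that by (simp add: path_words_def generation_def mem_cylinder_iff)
  then show ?thesis by (auto simp: path_event_iff)
qed

lemma path_event_borel: "path_event \<nu> n B Q \<in> sets borel"
  using borel_pred_stake[of "\<lambda>i. i \<in> path_words \<nu> n B Q" n] by (simp add: pred_def path_event_iff[symmetric])

lemma finite_path_words: "finite (path_words \<nu> n B Q)"
  by (rule finite_subset[OF _ finite_generation[of n \<nu>]]) (auto simp: path_words_def)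

lemma R_eq_path_words:
  "R n B (\<lambda>\<nu>. if Q \<nu> then f \<nu> else 0) \<nu> = (\<Sum>i\<in>path_words \<nu> n B Q. f (shift i \<nu>)) * ennreal ((1 / a) ^ n)"
proof -
  have "(\<Sum>i\<in>generation n \<nu>. if \<forall>m<n. siblings (i ! m) (shift (take m i) \<nu>) \<in> B m
      then if Q (shift i \<nu>) then f (shift i \<nu>) else 0 else 0) = (\<Sum>i\<in>path_words \<nu> n B Q. f (shift i \<nu>))"
    unfolding path_words_def by (rule sum.mono_neutral_cong_right) auto
  then show ?thesis by (simp only: R_eq_sum)
qed

text \<open>The link from the branching measure of a fixed tree to averages over trees:
  \<open>nn_integral_path_event\<close> computes the mean of the right side.\<close>

lemma emeasure_path_event:
  assumes reg: "regular \<nu>"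
  shows "emeasure (bm \<nu>) (path_event \<nu> n B Q) = R n B (\<lambda>\<nu>. if Q \<nu> then ennreal (W \<nu>) else 0) \<nu>"
proof -
  have "emeasure (bm \<nu>) (path_event \<nu> n B Q) = (\<Sum>i\<in>path_words \<nu> n B Q. emeasure (bm \<nu>) (cylinder i))"
    unfolding path_event_eq_UN
  proof (rule sum_emeasure[symmetric])
    show "disjoint_family_on cylinder (path_words \<nu> n B Q)"
      by (auto simp: disjoint_family_on_def path_words_def generation_def mem_cylinder_iff)
  qed (auto simp: sets_bm[OF reg] finite_path_words)
  also have "\<dots> = (\<Sum>i\<in>path_words \<nu> n B Q. ennreal (W (shift i \<nu>)) * ennreal ((1 / a) ^ n))"
  proof (rule sum.cong)
    fix i assume "i \<in> path_words \<nu> n B Q"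
    then have i: "i \<in> tree \<nu>" "length i = n" by (simp_all add: path_words_def generation_def)
    have "W (shift i \<nu>) / a ^ n = W (shift i \<nu>) * (1 / a) ^ n" by (simp add: power_one_over)
    then show "emeasure (bm \<nu>) (cylinder i) = ennreal (W (shift i \<nu>)) * ennreal ((1 / a) ^ n)"
      using i a_pos W_nonneg[OF regular_shift[OF reg]]
      by (simp add: emeasure_bm_cylinder[OF reg] ennreal_mult)
  qed simp
  finally show ?thesis by (simp add: R_eq_path_words sum_distrib_right)
qed

lemma nn_integral_path_event:
  assumes [measurable]: "\<And>m. B m \<in> sets borel" "Measurable.pred GW Q"
  shows "(\<integral>\<^sup>+\<nu>. R n B (\<lambda>\<nu>. if Q \<nu> then ennreal (W \<nu>) else 0) \<nu> \<partial>GW)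
    = (\<Prod>m<n. keep (B m)) * (\<integral>\<^sup>+\<nu>. (if Q \<nu> then ennreal (W \<nu>) else 0) \<partial>GW)"
  by (rule nn_integral_R) measurable

text \<open>Fatou. Smallness along a subsequence is enough in the applications, where the quantity
  bounds a number that does not depend on \<open>n\<close>.\<close>

lemma AE_liminf_eq_0:
  assumes [measurable]: "\<And>n. f n \<in> borel_measurable GW" and "liminf (\<lambda>n. \<integral>\<^sup>+\<nu>. f n \<nu> \<partial>GW) = (0::ennreal)"
  shows "AE \<nu> in GW. liminf (\<lambda>n. f n \<nu>) = 0"
proof -
  have "(\<integral>\<^sup>+\<nu>. liminf (\<lambda>n. f n \<nu>) \<partial>GW) \<le> 0"
    using nn_integral_liminf[of f GW] assms by simp
  then show ?thesis by (subst (asm) le_zero_eq, subst (asm) nn_integral_0_iff_AE) simp_all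
qed

lemma le_0_if_liminf:
  assumes "liminf f = (0::ennreal)" "\<forall>\<^sub>F n in sequentially. c \<le> f n"
  shows "c = 0"
  using Liminf_bounded[OF assms(2)] assms(1) by simp

section \<open>The convergent case\<close>

text \<open>The expected mass of the paths with \<open>W > e * a ^ n\<close> at level
  \<open>n\<close> is the mean of \<open>W\<close> over \<open>W > e * a ^ n\<close>, which tends to
  0. The masses of the cylinders around a path decrease, so being small once means staying small.
  They are the remainder when the recursion for \<open>W\<close> is unrolled.\<close>

lemma AE_no_atoms: "AE \<nu> in GW. AE x in bm \<nu>. (\<lambda>n. pathW \<nu> n x / a ^ n) \<longlonglongrightarrow> 0"
proof -
  let ?f = "\<lambda>e n. R n (\<lambda>_. UNIV) (\<lambda>\<nu>. if W \<nu> > e * a ^ n then ennreal (W \<nu>) else 0)"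
  have meas: "?f e n \<in> borel_measurable GW" for e n
    by (rule measurable_R) measurable
  have lim0: "liminf (\<lambda>n. \<integral>\<^sup>+\<nu>. ?f e n \<nu> \<partial>GW) = 0" if e: "e > 0" for e
  proof -
    have eq: "(\<integral>\<^sup>+\<nu>. ?f e n \<nu> \<partial>GW) = (\<integral>\<^sup>+\<nu>. (if W \<nu> > e * a ^ n then ennreal (W \<nu>) else 0) \<partial>GW)" for n
      by (subst nn_integral_path_event) (simp_all add: keep_UNIV)
    have "(\<lambda>n. \<integral>\<^sup>+\<nu>. (if W \<nu> > e * a ^ n then ennreal (W \<nu>) else 0) \<partial>GW) \<longlonglongrightarrow> (\<integral>\<^sup>+\<nu>. 0 \<partial>GW)"
    proof (rule nn_integral_dominated_convergence[where w = "\<lambda>\<nu>. ennreal (W \<nu>)"])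
      have "(\<integral>\<^sup>+\<nu>. ennreal (W \<nu>) \<partial>GW) \<le> 1" by (rule nn_integral_W_le)
      then show "(\<integral>\<^sup>+\<nu>. ennreal (W \<nu>) \<partial>GW) < \<infinity>" by (rule le_less_trans) simp
      show "AE \<nu> in GW. (\<lambda>n. if W \<nu> > e * a ^ n then ennreal (W \<nu>) else 0) \<longlonglongrightarrow> 0"
      proof (rule AE_I2)
        fix \<nu>
        have "filterlim (\<lambda>n. e * a ^ n) at_top sequentially"
        proof -
          have "filterlim (\<lambda>n. e * c ^ n) at_top sequentially" if "c > 1" for c :: real
            using that e by real_asymp
          then show ?thesis using a_gt_1 by blast
        qed
        then have "\<forall>\<^sub>F n in sequentially. W \<nu> \<le> e * a ^ n" by (simp add: filterlim_at_top)
        then have "\<forall>\<^sub>F n in sequentially. (if W \<nu> > e * a ^ n then ennreal (W \<nu>) else 0) = 0"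
          by (rule eventually_mono) simp
        then show "(\<lambda>n. if W \<nu> > e * a ^ n then ennreal (W \<nu>) else 0) \<longlonglongrightarrow> 0"
          by (rule tendsto_eventually)
      qed
    qed (auto intro!: AE_I2)
    then show ?thesis unfolding eq by (simp add: lim_imp_Liminf)
  qed
  have "AE \<nu> in GW. \<forall>k. liminf (\<lambda>n. ?f (1 / real (Suc k)) n \<nu>) = 0"
    unfolding AE_all_countable
  proof
    fix k
    have "0 < 1 / real (Suc k)" by simp
    then show "AE \<nu> in GW. liminf (\<lambda>n. ?f (1 / real (Suc k)) n \<nu>) = 0"
      by (rule AE_liminf_eq_0[OF meas lim0])
  qed
  with AE_regular show ?thesis
  proof eventually_elim
    case (elim \<nu>)
    note reg = elim(1)
    have "AE x in bm \<nu>. \<exists>n. pathW \<nu> n x \<le> 1 / real (Suc k) * a ^ n" for k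
    proof -
      let ?S = "\<lambda>n. path_event \<nu> n (\<lambda>_. UNIV) (\<lambda>\<nu>. W \<nu> > 1 / real (Suc k) * a ^ n)"
      have S: "?S n \<in> sets (bm \<nu>)" for n by (simp add: sets_bm[OF reg] path_event_borel)
      have "emeasure (bm \<nu>) (\<Inter>n. ?S n) = 0"
      proof (rule le_0_if_liminf)
        show "liminf (\<lambda>n. ?f (1 / real (Suc k)) n \<nu>) = 0" using elim(2) by blast
        have "emeasure (bm \<nu>) (\<Inter>n. ?S n) \<le> ?f (1 / real (Suc k)) n \<nu>" for n
          unfolding emeasure_path_event[OF reg, symmetric] using S by (intro emeasure_mono INT_lower) simp_all
        then show "\<forall>\<^sub>F n in sequentially. emeasure (bm \<nu>) (\<Inter>n. ?S n) \<le> ?f (1 / real (Suc k)) n \<nu>"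
          by (intro always_eventually allI)
      qed
      then have "AE x in bm \<nu>. x \<notin> (\<Inter>n. ?S n)"
        using S by (intro AE_not_in) (simp add: null_sets_def)
      with AE_bm_bdry[OF reg] show ?thesis
      proof eventually_elim
        case (elim x)
        then obtain n where "x \<notin> ?S n" by blast
        then have "pathW \<nu> n x \<le> 1 / real (Suc k) * a ^ n"
          using elim(1) by (simp add: path_event_def bdry_def pathW_def not_less del: of_nat_Suc)
        then show ?case ..
      qed
    qed
    then have "AE x in bm \<nu>. \<forall>k. \<exists>n. pathW \<nu> n x \<le> 1 / real (Suc k) * a ^ n"
      unfolding AE_all_countable by blast
    with AE_bm_bdry[OF reg] show ?case
    proof eventually_elim
      case (elim x)
      have "decseq (\<lambda>n. pathW \<nu> n x / a ^ n)"
      proof (rule decseq_SucI)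
        fix n
        have "pathW \<nu> (Suc n) x / a \<le> pathW \<nu> n x"
          unfolding pathW_Suc[OF reg elim(1), of n] using pathS_nonneg[OF reg, of n x] a_pos
          by (intro divide_right_mono) simp_all
        then have "pathW \<nu> (Suc n) x / a / a ^ n \<le> pathW \<nu> n x / a ^ n"
          using a_pos by (intro divide_right_mono) simp_all
        then show "pathW \<nu> (Suc n) x / a ^ Suc n \<le> pathW \<nu> n x / a ^ n" by simp
      qed
      show ?case
      proof (rule LIMSEQ_I)
        fix e :: real assume "e > 0"
        then obtain k where k: "1 / real (Suc k) < e" using nat_approx_posE by blast
        obtain n0 where "pathW \<nu> n0 x \<le> 1 / real (Suc k) * a ^ n0" using elim(2) by blast
        then have n0: "pathW \<nu> n0 x / a ^ n0 \<le> 1 / real (Suc k)"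
          using a_pos by (simp add: pos_divide_le_eq del: of_nat_Suc)
        have "norm (pathW \<nu> n x / a ^ n - 0) < e" if "n \<ge> n0" for n
        proof -
          have "pathW \<nu> n x / a ^ n \<le> pathW \<nu> n0 x / a ^ n0"
            using \<open>decseq _\<close> that by (simp add: decseq_def)
          moreover have "pathW \<nu> n x / a ^ n \<ge> 0" using pathW_nonneg[OF reg] a_pos by simp
          ultimately show ?thesis using n0 k by simp
        qed
        then show "\<exists>n0. \<forall>n\<ge>n0. norm (pathW \<nu> n x / a ^ n - 0) < e" by blast
      qed
    qed
  qed
qed

text \<open>Since \<open>K\<close> is positive and decreasing, small values \<open>K (g n)\<close>
  force large \<open>g n\<close>. The upper bound for sibling sums is available for large arguments
  only.\<close>

lemma g_at_top:
  assumes "summable (\<lambda>n. K (g (real n)))"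
  shows "filterlim (\<lambda>n. g (real n)) at_top sequentially"
  unfolding filterlim_at_top
proof
  fix c
  have "\<forall>\<^sub>F n in sequentially. K (g (real n)) < K c"
    using order_tendstoD(2)[OF summable_LIMSEQ_zero[OF assms] K_pos] .
  then show "\<forall>\<^sub>F n in sequentially. c \<le> g (real n)"
  proof (rule eventually_mono)
    fix n assume "K (g (real n)) < K c"
    then show "c \<le> g (real n)" using K_antimono[of "g (real n)" c] by linarith
  qed
qed

text \<open>The expected masses of the exceptional events are summable, so for almost every tree the
  masses are summable, and Borel-Cantelli applies to the branching measure of that tree.\<close>

lemma AE_pathS_small:
  assumes sum: "summable (\<lambda>n. K (g (real n)))" and e: "e > 0"
  shows "AE \<nu> in GW. AE x in bm \<nu>. \<forall>\<^sub>F n in sequentially. pathS \<nu> n x \<le> e * g (real n)"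
proof -
  obtain C where C: "C > 0" and ev: "\<forall>\<^sub>F x in at_top.
      (\<integral>\<^sup>+\<nu>. (\<Sum>j<\<nu> []. if siblings j \<nu> \<in> {e * x<..} then 1 else 0) \<partial>GW) \<le> ennreal (C * K x)"
    using siblings_upper[OF e] by blast
  have "\<forall>\<^sub>F n in sequentially. (\<integral>\<^sup>+\<nu>. (\<Sum>j<\<nu> []. if siblings j \<nu> \<in> {e * g (real n)<..} then 1 else 0) \<partial>GW) \<le> ennreal (C * K (g (real n)))"
    using ev g_at_top[OF sum] by (rule eventually_compose_filterlim)
  then obtain N where N: "\<And>n. n \<ge> N \<Longrightarrow>
      (\<integral>\<^sup>+\<nu>. (\<Sum>j<\<nu> []. if siblings j \<nu> \<in> {e * g (real n)<..} then 1 else 0) \<partial>GW) \<le> ennreal (C * K (g (real n)))"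
    by (auto simp: eventually_sequentially)
  \<comment> \<open>Only level \<open>n\<close> is constrained, so the product over the levels
    reduces to one factor.\<close>
  define B where "B n m = (if m = n then {e * g (real n)<..} else UNIV)" for n m :: nat
  have B_sets: "B n m \<in> sets borel" for n m by (simp add: B_def)
  let ?f = "\<lambda>n. R (Suc n) (B n) (\<lambda>\<nu>. if True then ennreal (W \<nu>) else 0)"
  have meas: "?f n \<in> borel_measurable GW" for n
    by (rule measurable_R) (use B_sets in measurable)
  have int: "(\<integral>\<^sup>+\<nu>. ?f n \<nu> \<partial>GW) \<le> ennreal (C / a * K (g (real n)))" if "n \<ge> N" for n
  proof -
    have "(\<integral>\<^sup>+\<nu>. ?f n \<nu> \<partial>GW) = (\<Prod>m<Suc n. keep (B n m)) * (\<integral>\<^sup>+\<nu>. ennreal (W \<nu>) \<partial>GW)"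
      by (subst nn_integral_path_event[OF B_sets]) simp_all
    also have "(\<Prod>m<Suc n. keep (B n m)) = keep {e * g (real n)<..}"
    proof -
      have "(\<Prod>m<n. keep (B n m)) = 1" by (rule prod.neutral) (simp add: B_def keep_UNIV)
      then show ?thesis by (simp add: B_def)
    qed
    also have "keep {e * g (real n)<..} * (\<integral>\<^sup>+\<nu>. ennreal (W \<nu>) \<partial>GW) \<le> keep {e * g (real n)<..} * 1"
      by (intro mult_left_mono nn_integral_W_le) simp
    also have "\<dots> \<le> ennreal (C * K (g (real n))) * ennreal (1 / a)"
      unfolding keep_def using mult_right_mono[OF N[OF that], of "ennreal (1 / a)"] by simp
    also have "\<dots> = ennreal (C / a * K (g (real n)))"
      using C K_nonneg a_pos by (simp add: ennreal_mult[symmetric])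
    finally show ?thesis .
  qed
  have "(\<integral>\<^sup>+\<nu>. (\<Sum>n. ?f (n + N) \<nu>) \<partial>GW) = (\<Sum>n. \<integral>\<^sup>+\<nu>. ?f (n + N) \<nu> \<partial>GW)"
    by (rule nn_integral_suminf[OF meas])
  also have "\<dots> \<le> (\<Sum>n. ennreal (C / a * K (g (real (n + N)))))"
    by (intro suminf_le int) simp_all
  also have "\<dots> = ennreal (\<Sum>n. C / a * K (g (real (n + N))))"
    using C K_nonneg a_pos sum by (intro suminf_ennreal2 summable_mult summable_ignore_initial_segment[of "\<lambda>n. K (g (real n))"]) simp_all
  also have "\<dots> < \<infinity>" by simp
  finally have "AE \<nu> in GW. (\<Sum>n. ?f (n + N) \<nu>) \<noteq> \<infinity>"
    by (intro nn_integral_PInf_AE borel_measurable_suminf_order meas) simp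
  with AE_regular show ?thesis
  proof eventually_elim
    case (elim \<nu>)
    note reg = elim(1)
    interpret fm: finite_measure "bm \<nu>" by (rule finite_bm[OF reg])
    let ?S = "\<lambda>n. path_event \<nu> (Suc (n + N)) (B (n + N)) (\<lambda>_. True)"
    have S: "?S n \<in> sets (bm \<nu>)" for n by (simp add: sets_bm[OF reg] path_event_borel)
    have fin: "(\<Sum>n. emeasure (bm \<nu>) (?S n)) \<noteq> \<infinity>"
      unfolding emeasure_path_event[OF reg] using elim(2) by simp
    have "AE x in bm \<nu>. \<forall>\<^sub>F n in sequentially. x \<in> space (bm \<nu>) - ?S n"
    proof (rule borel_cantelli_AE1[OF S])
      show "summable (\<lambda>n. measure (bm \<nu>) (?S n))"
        using fin by (intro summable_suminf_not_top) (simp_all add: fm.emeasure_eq_measure)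
    qed (simp add: fm.emeasure_eq_measure)
    with AE_bm_bdry[OF reg] show ?case
    proof eventually_elim
      case (elim x)
      have "\<forall>\<^sub>F n in sequentially. pathS \<nu> (n + N) x \<le> e * g (real (n + N))"
        using elim(2)
      proof (rule eventually_mono)
        fix n assume "x \<in> space (bm \<nu>) - ?S n"
        then have "\<exists>m<Suc (n + N). pathS \<nu> m x \<notin> B (n + N) m"
          using elim(1) unfolding path_event_def bdry_def by blast
        then show "pathS \<nu> (n + N) x \<le> e * g (real (n + N))"
          by (auto simp: B_def split: if_splits)
      qed
      then show ?case by (rule eventually_sequentially_seg[THEN iffD1])
    qed
  qed
qed

text \<open>Unrolling \<open>W_n = (S_n + W_{n+1}) / a\<close> with \<open>S_n \<le> e * g n\<close>
  and \<open>g (n + 1) \<le> b * g n\<close> gives a geometric series with sum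
  \<open>e * g n / (a - b)\<close>, and a remainder that vanishes by
  \<open>AE_no_atoms\<close>.\<close>

theorem AE_pathW_small:
  assumes sum: "summable (\<lambda>n. K (g (real n)))"
  shows "AE \<nu> in GW. AE x in bm \<nu>. (\<lambda>n. pathW \<nu> n x / g (real n)) \<longlonglongrightarrow> 0"
proof -
  obtain b n0 where b: "b > 0" "b < a" and n0: "\<And>n. n \<ge> n0 \<Longrightarrow> g (real (Suc n)) \<le> b * g (real n)"
    using g_growth by blast
  have "AE \<nu> in GW. \<forall>k. AE x in bm \<nu>. \<forall>\<^sub>F n in sequentially. pathS \<nu> n x \<le> 1 / real (Suc k) * g (real n)"
    unfolding AE_all_countable by (intro allI AE_pathS_small sum) simp
  with AE_regular AE_no_atoms show ?thesis
  proof eventually_elim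
    case (elim \<nu>)
    note reg = elim(1)
    have "AE x in bm \<nu>. \<forall>k. \<forall>\<^sub>F n in sequentially. pathS \<nu> n x \<le> 1 / real (Suc k) * g (real n)"
      using elim(3) unfolding AE_all_countable by blast
    with elim(2) AE_bm_bdry[OF reg] show ?case
    proof eventually_elim
      case (elim x)
      note x = elim(2)
      have bound: "\<forall>\<^sub>F n in sequentially. pathW \<nu> n x / g (real n) \<le> 1 / real (Suc k) / (a - b)" for k
      proof -
        let ?e = "1 / real (Suc k)"
        obtain N where N: "\<And>n. n \<ge> N \<Longrightarrow> pathS \<nu> n x \<le> ?e * g (real n)"
          using elim(3) unfolding eventually_sequentially by blast
        \<comment> \<open>The bound reproduces itself because
          \<open>(1 + b / (a - b)) / a = 1 / (a - b)\<close>.\<close>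
        have step: "pathW \<nu> n x \<le> ?e * g (real n) / (a - b) + pathW \<nu> (n + m) x / a ^ m"
          if "n \<ge> max N n0" for n m
          using that
        proof (induction m arbitrary: n)
          case 0
          have "?e * g (real n) / (a - b) \<ge> 0" using b g_pos[of n] by simp
          then show ?case by simp
        next
          case (Suc m)
          have "pathW \<nu> n x = (pathS \<nu> n x + pathW \<nu> (Suc n) x) / a" by (rule pathW_Suc[OF reg x])
          also have "\<dots> \<le> (?e * g (real n) + (?e * (b * g (real n)) / (a - b) + pathW \<nu> (Suc n + m) x / a ^ m)) / a"
          proof (intro divide_right_mono add_mono)
            show "pathS \<nu> n x \<le> ?e * g (real n)" using N Suc.prems by simp
            have "pathW \<nu> (Suc n) x \<le> ?e * g (real (Suc n)) / (a - b) + pathW \<nu> (Suc n + m) x / a ^ m"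
              using Suc.prems by (intro Suc.IH) simp
            also have "?e * g (real (Suc n)) / (a - b) \<le> ?e * (b * g (real n)) / (a - b)"
              using n0[of n] Suc.prems b by (intro divide_right_mono mult_left_mono) simp_all
            finally show "pathW \<nu> (Suc n) x \<le> ?e * (b * g (real n)) / (a - b) + pathW \<nu> (Suc n + m) x / a ^ m"
              by simp
          qed (use a_pos in simp)
          also have "\<dots> = ?e * g (real n) / (a - b) + pathW \<nu> (Suc n + m) x / a ^ Suc m"
          proof -
            have "(c + c * b / (a - b) + z) / a = c / (a - b) + z / a" for c z
              using b a_pos by (simp add: field_simps)
            from this[of "?e * g (real n)" "pathW \<nu> (Suc n + m) x / a ^ m"] show ?thesis
              by (simp add: mult_ac add.assoc)
          qed
          finally show ?case by simp
        qed
        have "pathW \<nu> n x / g (real n) \<le> ?e / (a - b)" if n: "n \<ge> max N n0" for n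
        proof -
          have "(\<lambda>m. pathW \<nu> (m + n) x / a ^ (m + n)) \<longlonglongrightarrow> 0"
            using elim(1) by (rule LIMSEQ_ignore_initial_segment)
          then have "(\<lambda>m. ?e * g (real n) / (a - b) + a ^ n * (pathW \<nu> (m + n) x / a ^ (m + n))) \<longlonglongrightarrow>
              ?e * g (real n) / (a - b) + a ^ n * 0"
            by (intro tendsto_intros)
          moreover have "a ^ n * (pathW \<nu> (m + n) x / a ^ (m + n)) = pathW \<nu> (n + m) x / a ^ m" for m
            using a_pos by (simp add: power_add add.commute)
          ultimately have "(\<lambda>m. ?e * g (real n) / (a - b) + pathW \<nu> (n + m) x / a ^ m) \<longlonglongrightarrow> ?e * g (real n) / (a - b)"
            by simp
          then have "pathW \<nu> n x \<le> ?e * g (real n) / (a - b)"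
            by (rule LIMSEQ_le_const) (use step[OF n] in blast)
          then show ?thesis using g_pos[of n] by (simp add: pos_divide_le_eq mult.commute)
        qed
        then show ?thesis unfolding eventually_sequentially by blast
      qed
      show ?case
      proof (rule LIMSEQ_I)
        fix e :: real assume "e > 0"
        then have "e * (a - b) > 0" using b by simp
        then obtain k where "1 / real (Suc k) < e * (a - b)" using nat_approx_posE by blast
        then have k: "1 / real (Suc k) / (a - b) < e" using b by (simp add: pos_divide_less_eq mult_ac del: of_nat_Suc)
        obtain N where N: "\<And>n. n \<ge> N \<Longrightarrow> pathW \<nu> n x / g (real n) \<le> 1 / real (Suc k) / (a - b)"
          using bound[of k] unfolding eventually_sequentially by blast
        have "norm (pathW \<nu> n x / g (real n) - 0) < e" if "n \<ge> N" for n
        proof -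
          have "pathW \<nu> n x / g (real n) \<ge> 0" using pathW_nonneg[OF reg] g_pos[of n] by simp
          then show ?thesis using N[OF that] k by simp
        qed
        then show "\<exists>N. \<forall>n\<ge>N. norm (pathW \<nu> n x / g (real n) - 0) < e" by blast
      qed
    qed
  qed
qed

text \<open>The set \<open>D\<close> is quantified inside the almost sure statement, so that it may
  depend on the tree in any way. Removing it does not change the mass of the boundary, which is
  positive when the boundary is nonempty.\<close>

theorem convergent_case:
  assumes sum: "summable (\<lambda>n. K (g (real n)))"
  shows "AE \<nu> in GW. \<forall>D\<in>sets borel. emeasure (bm \<nu>) D = 0 \<longrightarrow> bdry \<nu> \<noteq> {} \<longrightarrow> hausdorff \<phi> (bdry \<nu> - D) = \<infinity>"
  using AE_regular AE_pathW_small[OF sum] AE_W_pos_if_bdry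
proof eventually_elim
  case (elim \<nu>)
  note reg = elim(1)
  interpret cylinder_density "bm \<nu>" \<phi> G by (rule cylinder_density[OF reg])
  show ?case
  proof (intro ballI impI)
    fix D assume D: "D \<in> sets borel" "emeasure (bm \<nu>) D = 0" and ne: "bdry \<nu> \<noteq> {}"
    show "hausdorff \<phi> (bdry \<nu> - D) = \<infinity>"
    proof (rule hausdorff_infinite)
      show "bdry \<nu> - D \<in> sets borel" using D(1) bdry_borel by blast
      have "D \<in> null_sets (bm \<nu>)" using D sets_bm[OF reg] by (simp add: null_sets_def)
      then have "emeasure (bm \<nu>) (bdry \<nu> - D) = emeasure (bm \<nu>) (bdry \<nu>)"
        using bdry_borel sets_bm[OF reg] by (intro emeasure_Diff_null_set) simp_all
      also have "\<dots> = ennreal (W \<nu>)" by (rule emeasure_bm_bdry[OF reg])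
      finally show "emeasure (bm \<nu>) (bdry \<nu> - D) \<noteq> 0" using elim(3) ne by simp
      show "AE x in bm \<nu>. x \<in> bdry \<nu> - D \<longrightarrow> (\<lambda>n. mass n x / G n) \<longlonglongrightarrow> 0"
        using elim(2) by eventually_elim (simp add: mass_div_G[OF reg])
    qed
  qed
qed

end

lemma filterlim_sum_at_top:
  fixes f :: "nat \<Rightarrow> real"
  assumes "\<And>n. f n \<ge> 0" "\<not> summable f"
  shows "filterlim (\<lambda>n. \<Sum>m<n. f m) at_top sequentially"
  unfolding filterlim_at_top
proof
  fix c
  have "\<exists>N. c < (\<Sum>m<N. f m)"
  proof (rule ccontr)
    assume "\<nexists>N. c < (\<Sum>m<N. f m)"
    then have "summable f"
      by (intro summableI_nonneg_bounded[where x = c] assms(1)) (simp add: not_less)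
    with assms(2) show False by blast
  qed
  then obtain N where N: "c < (\<Sum>m<N. f m)" ..
  show "\<forall>\<^sub>F n in sequentially. c \<le> (\<Sum>m<n. f m)"
  proof (rule eventually_sequentiallyI)
    fix n assume "N \<le> n"
    then have "(\<Sum>m<N. f m) \<le> (\<Sum>m<n. f m)" by (intro sum_mono2) (use assms(1) in auto)
    with N show "c \<le> (\<Sum>m<n. f m)" by simp
  qed
qed

lemma liminf_eq_0I:
  fixes f :: "nat \<Rightarrow> ennreal"
  assumes "\<And>e. e > 0 \<Longrightarrow> \<exists>\<^sub>F n in sequentially. f n \<le> ennreal e"
  shows "liminf f = 0"
proof -
  have "liminf f \<le> 0 + ennreal e" if "e > 0" for e
  proof (rule ccontr)
    assume "\<not> liminf f \<le> 0 + ennreal e"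
    then have "ennreal e < liminf f" by (simp add: not_le)
    then have "\<forall>\<^sub>F n in sequentially. ennreal e < f n" by (rule less_LiminfD)
    then have "\<forall>\<^sub>F n in sequentially. \<not> f n \<le> ennreal e" by (rule eventually_mono) (simp add: not_le)
    with assms[OF that] show False by (simp add: frequently_def)
  qed
  then have "liminf f \<le> 0" by (rule ennreal_le_epsilon)
  then show ?thesis by simp
qed

context gauge
begin

section \<open>The divergent case\<close>

lemma not_summable_scaled:
  assumes "\<not> summable (\<lambda>n. K (g (real n)))"
  shows "\<not> summable (\<lambda>n. K (d * g (real n)))"
proof
  assume *: "summable (\<lambda>n. K (d * g (real n)))"
  obtain C where C: "C > 0" "\<And>x. x \<ge> 0 \<Longrightarrow> K x \<le> C * K (d * x)" using scaling[of d] by blast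
  have "summable (\<lambda>n. K (g (real n)))"
  proof (rule summable_comparison_test')
    show "summable (\<lambda>n. C * K (d * g (real n)))" using * by (rule summable_mult)
    show "norm (K (g (real n))) \<le> C * K (d * g (real n))" if "n \<ge> 0" for n
      using C(2)[of "g (real n)"] g_pos[of n] K_nonneg[of "g (real n)"] by simp
  qed
  with assms show False ..
qed

text \<open>The first \<open>k\<close> levels are free, so that a union over \<open>k\<close>
  expresses a bound that holds eventually.\<close>

definition capped :: "nat \<Rightarrow> real \<Rightarrow> nat \<Rightarrow> real set" where
  "capped k b m = (if m < k then UNIV else {..b * g (real m)})"

lemma capped_borel: "capped k b m \<in> sets borel"
  by (simp add: capped_def)

text \<open>A free level has factor 1, while the sum on the right counts it with a term of at most
  \<open>a\<close>; this is corrected by \<open>a * k\<close>.\<close>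

lemma prod_keep_le:
  assumes c: "c > 0" "\<And>x. x \<ge> 0 \<Longrightarrow> keep {..b * x} \<le> ennreal (exp (- c * K x))" and d: "d \<ge> 0"
  shows "(\<Prod>m<n. keep (capped k (b * d) m)) \<le> ennreal (exp (- c * ((\<Sum>m<n. K (d * g (real m))) - a * real k)))"
proof -
  let ?t = "\<lambda>m. if m < k then a else 0 :: real"
  have "(\<Prod>m<n. keep (capped k (b * d) m)) \<le> (\<Prod>m<n. ennreal (exp (- c * (K (d * g (real m)) - ?t m))))"
  proof (rule prod_mono_ennreal)
    fix m
    have x: "d * g (real m) \<ge> 0" using d g_pos[of m] by simp
    show "keep (capped k (b * d) m) \<le> ennreal (exp (- c * (K (d * g (real m)) - ?t m)))"
    proof (cases "m < k")
      case True
      have "c * K (d * g (real m)) \<le> c * a" using c(1) K_le_a[OF x] by (intro mult_left_mono) simp_all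
      then have "1 \<le> exp (- c * (K (d * g (real m)) - a))" by (simp add: right_diff_distrib)
      then show ?thesis using True keep_UNIV by (simp add: capped_def ennreal_leI[of 1, simplified])
    next
      case False
      then show ?thesis using c(2)[OF x] by (simp add: capped_def mult.assoc)
    qed
  qed
  also have "\<dots> = ennreal (exp (\<Sum>m<n. - c * (K (d * g (real m)) - ?t m)))"
    by (simp add: prod_ennreal exp_sum)
  also have "\<dots> \<le> ennreal (exp (- c * ((\<Sum>m<n. K (d * g (real m))) - a * real k)))"
  proof -
    have "(\<Sum>m<n. ?t m) = a * real (card ({..<n} \<inter> {..<k}))"
      by (simp add: sum.If_cases lessThan_def Int_def)
    also have "\<dots> \<le> a * real k"
      using card_mono[of "{..<k}" "{..<n} \<inter> {..<k}"] a_pos by simp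
    finally have "(\<Sum>m<n. K (d * g (real m))) - a * real k \<le> (\<Sum>m<n. K (d * g (real m)) - ?t m)"
      by (simp add: sum_subtractf)
    then have "- c * (\<Sum>m<n. K (d * g (real m)) - ?t m) \<le> - c * ((\<Sum>m<n. K (d * g (real m))) - a * real k)"
      using c(1) by (intro mult_left_mono_neg) simp_all
    then show ?thesis by (intro ennreal_leI) (simp only: sum_distrib_left[symmetric] exp_le_cancel_iff)
  qed
  finally show ?thesis .
qed

lemma pathS_le: "regular \<nu> \<Longrightarrow> x \<in> bdry \<nu> \<Longrightarrow> pathS \<nu> n x \<le> a * pathW \<nu> n x"
  using pathW_Suc[of \<nu> x n] pathW_nonneg[of \<nu> "Suc n" x] a_pos by simp

text \<open>The second Borel-Cantelli lemma in product form: the expected mass of the paths along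
  which all sibling sums from level \<open>k\<close> on stay below the bound is at most a product
  that tends to 0.\<close>

lemma AE_pathW_large:
  assumes div: "\<not> summable (\<lambda>n. K (g (real n)))"
  shows "AE \<nu> in GW. AE x in bm \<nu>. \<forall>C::nat. \<exists>\<^sub>F n in sequentially. real C * g (real n) \<le> pathW \<nu> n x"
proof -
  \<comment> \<open>The factor \<open>a\<close> comes from \<open>pathS_le\<close>: a sibling sum
    above \<open>a * C * g\<close> forces \<open>W\<close> above \<open>C * g\<close>.\<close>
  let ?f = "\<lambda>C k n. R n (capped k (a * real C)) (\<lambda>\<nu>. if True then ennreal (W \<nu>) else 0)"
  have meas: "?f C k n \<in> borel_measurable GW" for C k n
    by (rule measurable_R[OF _ capped_borel]) measurable
  have lim0: "liminf (\<lambda>n. \<integral>\<^sup>+\<nu>. ?f C k n \<nu> \<partial>GW) = 0" for C k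
  proof (rule liminf_eq_0I)
    fix e :: real assume e: "e > 0"
    obtain c where c: "c > 0" "\<And>x. x \<ge> 0 \<Longrightarrow> keep {..a * real C * x} \<le> ennreal (exp (- c * K x))"
      using keep_le_exp by blast
    have le: "(\<integral>\<^sup>+\<nu>. ?f C k n \<nu> \<partial>GW) \<le> ennreal (exp (- c * ((\<Sum>m<n. K (g (real m))) - a * real k)))" for n
    proof -
      have "(\<integral>\<^sup>+\<nu>. ?f C k n \<nu> \<partial>GW) = (\<Prod>m<n. keep (capped k (a * real C) m)) * (\<integral>\<^sup>+\<nu>. (if True then ennreal (W \<nu>) else 0) \<partial>GW)"
        by (rule nn_integral_path_event[OF capped_borel]) simp
      also have "\<dots> \<le> (\<Prod>m<n. keep (capped k (a * real C) m)) * 1"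
        using nn_integral_W_le by (intro mult_left_mono) simp_all
      also have "\<dots> \<le> ennreal (exp (- c * ((\<Sum>m<n. K (g (real m))) - a * real k)))"
        using prod_keep_le[OF c zero_le_one, of k n] by simp
      finally show ?thesis .
    qed
    have "filterlim (\<lambda>n. \<Sum>m<n. K (g (real m))) at_top sequentially"
      using div K_nonneg by (intro filterlim_sum_at_top) simp_all
    then have "\<forall>\<^sub>F n in sequentially. a * real k - ln e / c \<le> (\<Sum>m<n. K (g (real m)))"
      unfolding filterlim_at_top by blast
    then have "\<forall>\<^sub>F n in sequentially. (\<integral>\<^sup>+\<nu>. ?f C k n \<nu> \<partial>GW) \<le> ennreal e"
    proof (rule eventually_mono)
      fix n assume "a * real k - ln e / c \<le> (\<Sum>m<n. K (g (real m)))"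
      then have "c * (a * real k - ln e / c) \<le> c * (\<Sum>m<n. K (g (real m)))"
        using c(1) by (intro mult_left_mono) simp_all
      then have "- c * ((\<Sum>m<n. K (g (real m))) - a * real k) \<le> ln e"
        using c(1) by (simp add: right_diff_distrib)
      then have "exp (- c * ((\<Sum>m<n. K (g (real m))) - a * real k)) \<le> exp (ln e)"
        by (simp only: exp_le_cancel_iff)
      then have "exp (- c * ((\<Sum>m<n. K (g (real m))) - a * real k)) \<le> e"
        using e by (simp only: exp_ln)
      then show "(\<integral>\<^sup>+\<nu>. ?f C k n \<nu> \<partial>GW) \<le> ennreal e"
        using order_trans[OF le ennreal_leI] by blast
    qed
    then show "\<exists>\<^sub>F n in sequentially. (\<integral>\<^sup>+\<nu>. ?f C k n \<nu> \<partial>GW) \<le> ennreal e"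
      by (rule eventually_frequently[rotated]) simp
  qed
  have "AE \<nu> in GW. \<forall>C k. liminf (\<lambda>n. ?f C k n \<nu>) = 0"
    unfolding AE_all_countable by (intro allI AE_liminf_eq_0[OF meas lim0])
  with AE_regular show ?thesis
  proof eventually_elim
    case (elim \<nu>)
    note reg = elim(1)
    have "AE x in bm \<nu>. \<exists>m\<ge>k. real C * g (real m) \<le> pathW \<nu> m x" for C k
    proof -
      let ?S = "\<lambda>n. path_event \<nu> n (capped k (a * real C)) (\<lambda>_. True)"
      have S: "?S n \<in> sets (bm \<nu>)" for n by (simp add: sets_bm[OF reg] path_event_borel)
      have "emeasure (bm \<nu>) (\<Inter>n. ?S n) = 0"
      proof (rule le_0_if_liminf)
        show "liminf (\<lambda>n. ?f C k n \<nu>) = 0" using elim(2) by blast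
        have "emeasure (bm \<nu>) (\<Inter>n. ?S n) \<le> ?f C k n \<nu>" for n
          unfolding emeasure_path_event[OF reg, symmetric] using S by (intro emeasure_mono INT_lower) simp_all
        then show "\<forall>\<^sub>F n in sequentially. emeasure (bm \<nu>) (\<Inter>n. ?S n) \<le> ?f C k n \<nu>"
          by (intro always_eventually allI)
      qed
      then have "AE x in bm \<nu>. x \<notin> (\<Inter>n. ?S n)"
        using S by (intro AE_not_in) (simp add: null_sets_def)
      with AE_bm_bdry[OF reg] show ?thesis
      proof eventually_elim
        case (elim x)
        then obtain n where "x \<notin> ?S n" by blast
        then obtain m where "pathS \<nu> m x \<notin> capped k (a * real C) m"
          using elim(1) unfolding path_event_def bdry_def by blast
        then have m: "m \<ge> k" "a * real C * g (real m) < pathS \<nu> m x"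
          by (auto simp: capped_def split: if_splits)
        note m(2)
        also have "pathS \<nu> m x \<le> a * pathW \<nu> m x" by (rule pathS_le[OF reg elim(1)])
        finally have "real C * g (real m) \<le> pathW \<nu> m x" using a_pos by (simp add: mult.assoc)
        with m(1) show ?case by blast
      qed
    qed
    then have "AE x in bm \<nu>. \<forall>C k. \<exists>m\<ge>k. real C * g (real m) \<le> pathW \<nu> m x"
      unfolding AE_all_countable by blast
    then show ?case unfolding frequently_sequentially by simp
  qed
qed

definition thin :: "(nat list \<Rightarrow> nat) \<Rightarrow> nat stream set" where
  "thin \<nu> = {x \<in> bdry \<nu>. (\<lambda>n. pathW \<nu> n x / g (real n)) \<longlonglongrightarrow> 0}"

lemma thin_borel: "thin \<nu> \<in> sets borel"
proof -
  have [measurable]: "(\<lambda>x. pathW \<nu> n x / g (real n)) \<in> borel_measurable borel" for n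
    unfolding pathW_def by (rule measurable_compose[OF borel_stake]) simp
  have "thin \<nu> = bdry \<nu> \<inter> {x. \<forall>k. \<exists>N. \<forall>n\<ge>N. \<bar>pathW \<nu> n x / g (real n)\<bar> < 1 / real (Suc k)}"
  proof -
    have "(\<lambda>n. pathW \<nu> n x / g (real n)) \<longlonglongrightarrow> 0 \<longleftrightarrow>
        (\<forall>k. \<exists>N. \<forall>n\<ge>N. \<bar>pathW \<nu> n x / g (real n)\<bar> < 1 / real (Suc k))" (is "?l \<longleftrightarrow> ?r") for x
    proof
      assume l: ?l
      show ?r
      proof
        fix k
        have "0 < 1 / real (Suc k)" by simp
        from LIMSEQ_D[OF l this] show "\<exists>N. \<forall>n\<ge>N. \<bar>pathW \<nu> n x / g (real n)\<bar> < 1 / real (Suc k)"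
          by (simp only: diff_zero real_norm_def)
      qed
    next
      assume r: ?r
      show ?l
      proof (rule LIMSEQ_I)
        fix e :: real assume "e > 0"
        then obtain k where k: "1 / real (Suc k) < e" using nat_approx_posE by blast
        obtain N where N: "\<And>n. n \<ge> N \<Longrightarrow> \<bar>pathW \<nu> n x / g (real n)\<bar> < 1 / real (Suc k)" using r by blast
        have "norm (pathW \<nu> n x / g (real n) - 0) < e" if "n \<ge> N" for n
          using less_trans[OF N[OF that] k] by (simp only: diff_zero real_norm_def)
        then show "\<exists>N. \<forall>n\<ge>N. norm (pathW \<nu> n x / g (real n) - 0) < e" by blast
      qed
    qed
    then show ?thesis by (auto simp: thin_def)
  qed
  moreover have "{x\<in>space borel. \<forall>k. \<exists>N. \<forall>n\<ge>N. \<bar>pathW \<nu> n x / g (real n)\<bar> < 1 / real (Suc k)} \<in> sets borel"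
    by measurable
  ultimately show ?thesis using sets.Int[OF bdry_borel] by (simp only: space_borel UNIV_I simp_thms)
qed

text \<open>Outside \<open>thin\<close> the ratio of mass to gauge does not tend to 0, so the upper
  density is positive; by \<open>AE_pathW_large\<close> it is infinite almost everywhere. These are
  the two hypotheses of \<open>hausdorff_null\<close>.\<close>

theorem divergent_case:
  assumes div: "\<not> summable (\<lambda>n. K (g (real n)))"
  shows "AE \<nu> in GW. hausdorff \<phi> (bdry \<nu> - thin \<nu>) = 0 \<and> emeasure (bm \<nu>) (thin \<nu>) = 0"
  using AE_regular AE_pathW_large[OF div]
proof eventually_elim
  case (elim \<nu>)
  note reg = elim(1)
  interpret cylinder_density "bm \<nu>" \<phi> G by (rule cylinder_density[OF reg])
  have G_le: "c * g (real n) \<le> pathW \<nu> n x \<longleftrightarrow> c * G n \<le> mass n x" if "x \<in> bdry \<nu>" for c n x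
    using a_pos by (simp add: mass_eq[OF reg that] G_def divide_le_cancel)
  have "hausdorff \<phi> (bdry \<nu> - thin \<nu>) = 0"
  proof (rule hausdorff_null)
    show "AE x in bm \<nu>. \<forall>C. \<exists>\<^sub>F m in sequentially. C * G m \<le> mass m x"
      using elim(2) AE_bm_bdry[OF reg]
    proof eventually_elim
      case (elim x)
      show ?case
      proof
        fix C
        obtain C' :: nat where C': "C \<le> real C'" using real_arch_simple by blast
        have "\<exists>\<^sub>F m in sequentially. real C' * g (real m) \<le> pathW \<nu> m x" using elim(1) by blast
        then show "\<exists>\<^sub>F m in sequentially. C * G m \<le> mass m x"
        proof (rule frequently_elim1)
          fix m assume *: "real C' * g (real m) \<le> pathW \<nu> m x"
          have "C * g (real m) \<le> real C' * g (real m)" using C' g_pos[of m] by (intro mult_right_mono) simp_all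
          also note *
          finally show "C * G m \<le> mass m x" using G_le[OF elim(2)] by blast
        qed
      qed
    qed
    fix x assume x: "x \<in> bdry \<nu> - thin \<nu>"
    show "\<exists>c>0. \<exists>\<^sub>F m in sequentially. c * G m \<le> mass m x"
    proof (rule ccontr)
      assume no: "\<not> ?thesis"
      have "(\<lambda>n. pathW \<nu> n x / g (real n)) \<longlonglongrightarrow> 0"
      proof (rule LIMSEQ_I)
        fix e :: real assume e: "e > 0"
        then have "\<forall>\<^sub>F m in sequentially. \<not> e * G m \<le> mass m x" using no by (simp add: frequently_def)
        then obtain N where N: "\<And>m. m \<ge> N \<Longrightarrow> \<not> e * G m \<le> mass m x" by (auto simp: eventually_sequentially)
        have "norm (pathW \<nu> n x / g (real n) - 0) < e" if "n \<ge> N" for n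
        proof -
          have "pathW \<nu> n x < e * g (real n)" using N[OF that] G_le[of x e n] x by auto
          then have "pathW \<nu> n x / g (real n) < e" using g_pos[of n] by (simp add: pos_divide_less_eq)
          moreover have "pathW \<nu> n x / g (real n) \<ge> 0" using pathW_nonneg[OF reg] g_pos[of n] by simp
          ultimately show ?thesis by simp
        qed
        then show "\<exists>N. \<forall>n\<ge>N. norm (pathW \<nu> n x / g (real n) - 0) < e" by blast
      qed
      with x show False by (simp add: thin_def)
    qed
  qed
  moreover have "emeasure (bm \<nu>) (thin \<nu>) = 0"
  proof -
    have "AE x in bm \<nu>. x \<notin> thin \<nu>"
      using elim(2)
    proof eventually_elim
      case (elim x)
      have fr: "\<exists>\<^sub>F m in sequentially. real 1 * g (real m) \<le> pathW \<nu> m x" using elim by blast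
      show ?case
      proof
        assume "x \<in> thin \<nu>"
        then have "(\<lambda>n. pathW \<nu> n x / g (real n)) \<longlonglongrightarrow> 0" by (simp add: thin_def)
        then have "\<forall>\<^sub>F n in sequentially. pathW \<nu> n x / g (real n) < 1"
          by (rule order_tendstoD(2)) simp
        then have "\<forall>\<^sub>F n in sequentially. \<not> real 1 * g (real n) \<le> pathW \<nu> n x"
          by (rule eventually_mono) (use g_pos in \<open>simp add: pos_divide_less_eq not_le\<close>)
        with fr show False by (simp add: frequently_def)
      qed
    qed
    then have "emeasure (bm \<nu>) (thin \<nu>) = emeasure (bm \<nu>) {}"
      using thin_borel sets_bm[OF reg] by (intro emeasure_eq_AE) simp_all
    then show ?thesis by simp
  qed
  ultimately show ?case by blast
qed

section \<open>Covering the thin part of the boundary\<close>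

text \<open>With \<open>f = 1\<close>, \<open>R\<close> times \<open>g n\<close> is exactly the cost
  of the cylinders of level \<open>n\<close> whose words satisfy the conditions: their number times
  \<open>G n\<close>.\<close>

lemma hausdorff_path_events_null:
  assumes "liminf (\<lambda>n. R n B (\<lambda>\<nu>. if True then 1 else 0) \<nu> * ennreal (g (real n))) = 0"
  shows "hausdorff \<phi> (\<Inter>n. path_event \<nu> n B (\<lambda>_. True)) = 0"
proof -
  let ?E = "\<Inter>n. path_event \<nu> n B (\<lambda>_. True)"
  have "hausdorff_pre \<phi> \<delta> ?E = 0" if \<delta>: "\<delta> > 0" for \<delta>
  proof (rule le_0_if_liminf[OF assms])
    have "(\<lambda>n. exp (- real n)) \<longlonglongrightarrow> 0" by real_asymp
    then have "\<forall>\<^sub>F n in sequentially. exp (- real n) < \<delta>" using \<delta> by (rule order_tendstoD(2))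
    then show "\<forall>\<^sub>F n in sequentially. hausdorff_pre \<phi> \<delta> ?E \<le> R n B (\<lambda>\<nu>. if True then 1 else 0) \<nu> * ennreal (g (real n))"
    proof (rule eventually_mono)
      fix n assume n: "exp (- real n) < \<delta>"
      let ?V = "path_words \<nu> n B (\<lambda>_. True)"
      have len: "length i = n" if "i \<in> ?V" for i using that by (simp add: path_words_def generation_def)
      have "hausdorff_pre \<phi> \<delta> ?E \<le>
        (\<Sum>m. if list_decode m \<in> ?V then ennreal (\<phi> (exp (- real (length (list_decode m))))) else 0)"
      proof (rule hausdorff_pre_le_cylinders)
        show "\<phi> 0 = 0" using gauge_rep by (simp add: gauge_rep_def)
        show "?E \<subseteq> (\<Union>i\<in>?V. cylinder i)" unfolding path_event_eq_UN[symmetric] by blast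
      qed (use \<delta> n len in simp_all)
      also have "\<dots> = (\<Sum>i\<in>?V. ennreal (\<phi> (exp (- real (length i)))))"
        by (rule suminf_list_decode[OF finite_path_words])
      also have "\<dots> = (\<Sum>i\<in>?V. 1 * (ennreal ((1 / a) ^ n) * ennreal (g (real n))))"
      proof (rule sum.cong)
        fix i assume "i \<in> ?V"
        then have "\<phi> (exp (- real (length i))) = (1 / a) ^ n * g (real n)"
          by (simp add: len \<phi>_exp G_def power_one_over)
        then show "ennreal (\<phi> (exp (- real (length i)))) = 1 * (ennreal ((1 / a) ^ n) * ennreal (g (real n)))"
          using a_pos g_pos[of n] by (simp add: ennreal_mult)
      qed simp
      also have "\<dots> = R n B (\<lambda>\<nu>. if True then 1 else 0) \<nu> * ennreal (g (real n))"
        unfolding R_eq_path_words[where Q = "\<lambda>_. True" and f = "\<lambda>_. 1"]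
        by (simp only: sum_distrib_right[symmetric] mult.assoc)
      finally show "hausdorff_pre \<phi> \<delta> ?E \<le> R n B (\<lambda>\<nu>. if True then 1 else 0) \<nu> * ennreal (g (real n))" .
    qed
  qed
  then have "hausdorff \<phi> ?E \<le> 0"
    unfolding hausdorff_eq_SUP by (intro SUP_least) (simp only: greaterThan_iff order_refl)
  then show ?thesis by simp
qed

text \<open>The expected cost at level \<open>n\<close> is at most a constant times
  \<open>exp (- c * T n) * g n\<close>. The hypothesis provides a \<open>\<delta>\<close> and
  infinitely many \<open>n\<close> with \<open>g n \<le> exp (c * T n / 2)\<close>, and the other
  half of the exponent tends to infinity because the series diverges.\<close>

theorem thin_null:
  assumes div: "\<not> summable (\<lambda>n. K (g (real n)))"
    and lim: "Limsup (at_right 0) (\<lambda>\<delta>. limsup (\<lambda>n.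
         ereal ((\<Sum>k\<le>n. K (\<delta> * g (real k))) / ln (max (g (real n)) (exp 1))))) = \<infinity>"
  shows "AE \<nu> in GW. hausdorff \<phi> (thin \<nu>) = 0"
proof -
  obtain c where c: "c > 0" "\<And>x. x \<ge> 0 \<Longrightarrow> keep {..a * x} \<le> ennreal (exp (- c * K x))"
    using keep_le_exp by blast
  let ?q = "\<lambda>\<delta> n. ereal ((\<Sum>k\<le>n. K (\<delta> * g (real k))) / ln (max (g (real n)) (exp 1)))"
  \<comment> \<open>The rate \<open>c\<close> does not depend on \<open>\<delta>\<close>, so the
    limsup can be compared with \<open>2 / c\<close> before \<open>\<delta>\<close> is fixed. The
    factor 2 is what splits the exponent into halves.\<close>
  have "\<exists>\<delta>>0. ereal (2 / c) < limsup (?q \<delta>)"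
  proof (rule ccontr)
    assume no: "\<not> ?thesis"
    have "limsup (?q \<delta>) \<le> ereal (2 / c)" if "\<delta> > 0" for \<delta>
    proof -
      have "\<not> ereal (2 / c) < limsup (?q \<delta>)" using no that by blast
      then show ?thesis by (simp only: not_less)
    qed
    then have "\<forall>\<^sub>F \<delta> in at_right 0. limsup (?q \<delta>) \<le> ereal (2 / c)"
      unfolding eventually_at_right_field using zero_less_one by blast
    then have "Limsup (at_right 0) (\<lambda>\<delta>. limsup (?q \<delta>)) \<le> ereal (2 / c)" by (rule Limsup_bounded)
    with lim show False by simp
  qed
  then obtain \<delta> where \<delta>: "\<delta> > 0" "ereal (2 / c) < limsup (?q \<delta>)" by blast
  define T where "T n = (\<Sum>k\<le>n. K (\<delta> * g (real k)))" for n
  have freq: "\<exists>\<^sub>F n in sequentially. 2 / c * ln (max (g (real n)) (exp 1)) < T n"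
  proof (rule ccontr)
    assume "\<not> ?thesis"
    then have "\<forall>\<^sub>F n in sequentially. T n \<le> 2 / c * ln (max (g (real n)) (exp 1))"
      by (simp add: frequently_def not_less)
    then have "\<forall>\<^sub>F n in sequentially. ?q \<delta> n \<le> ereal (2 / c)"
    proof (rule eventually_mono)
      fix n assume *: "T n \<le> 2 / c * ln (max (g (real n)) (exp 1))"
      \<comment> \<open>The maximum with \<open>exp 1\<close> keeps the denominator at least 1, so
        it can be cleared.\<close>
      have "1 \<le> ln (max (g (real n)) (exp 1))" using ln_le_cancel_iff[of "exp 1" "max (g (real n)) (exp 1)"] by (simp add: less_max_iff_disj)
      with * show "?q \<delta> n \<le> ereal (2 / c)" by (simp add: T_def pos_divide_le_eq)
    qed
    then have "limsup (?q \<delta>) \<le> ereal (2 / c)" by (rule Limsup_bounded)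
    with \<delta>(2) show False by simp
  qed
  let ?B = "\<lambda>k. capped k (a * \<delta>)"
  let ?f = "\<lambda>k n \<nu>. R n (?B k) (\<lambda>\<nu>. if True then 1 else 0) \<nu> * ennreal (g (real n))"
  have R_meas: "R n (?B k) (\<lambda>\<nu>. if True then 1 else 0) \<in> borel_measurable GW" for k n
    by (rule measurable_R[OF _ capped_borel]) measurable
  then have meas: "?f k n \<in> borel_measurable GW" for k n by measurable
  have lim0: "liminf (\<lambda>n. \<integral>\<^sup>+\<nu>. ?f k n \<nu> \<partial>GW) = 0" for k
  proof (rule liminf_eq_0I)
    fix e :: real assume e: "e > 0"
    \<comment> \<open>The conditions concern the levels below \<open>n\<close>, but
      \<open>T n\<close> includes level \<open>n\<close>. Its term is at most \<open>a\<close>,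
      whence \<open>k + 1\<close> in place of \<open>k\<close>.\<close>
    have le: "(\<integral>\<^sup>+\<nu>. ?f k n \<nu> \<partial>GW) \<le> ennreal (exp (c * a * (real k + 1)) * exp (- c * T n) * g (real n))" for n
    proof -
      have "(\<integral>\<^sup>+\<nu>. ?f k n \<nu> \<partial>GW) = (\<integral>\<^sup>+\<nu>. R n (?B k) (\<lambda>\<nu>. if True then 1 else 0) \<nu> \<partial>GW) * ennreal (g (real n))"
        by (rule nn_integral_multc[OF R_meas])
      also have "(\<integral>\<^sup>+\<nu>. R n (?B k) (\<lambda>\<nu>. if True then 1 else 0) \<nu> \<partial>GW) = (\<Prod>m<n. keep (?B k m)) * (\<integral>\<^sup>+\<nu>. (if True then 1 else 0) \<partial>GW)"
        by (rule nn_integral_R[OF _ capped_borel]) simp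
      also have "(\<integral>\<^sup>+\<nu>. (if True then 1 else 0) \<partial>GW) = (1 :: ennreal)" by simp
      also have "(\<Prod>m<n. keep (?B k m)) * 1 * ennreal (g (real n)) \<le>
          ennreal (exp (- c * ((\<Sum>m<n. K (\<delta> * g (real m))) - a * real k))) * ennreal (g (real n))"
        unfolding mult_1_right using c \<delta>(1) by (intro mult_right_mono prod_keep_le) simp_all
      also have "\<dots> = ennreal (exp (- c * ((\<Sum>m<n. K (\<delta> * g (real m))) - a * real k)) * g (real n))"
        using g_pos[of n] by (intro ennreal_mult[symmetric]) simp_all
      also have "\<dots> \<le> ennreal (exp (c * a * (real k + 1)) * exp (- c * T n) * g (real n))"
      proof (intro ennreal_leI mult_right_mono)
        have "T n = (\<Sum>m<n. K (\<delta> * g (real m))) + K (\<delta> * g (real n))"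
          by (simp add: T_def lessThan_Suc_atMost[symmetric])
        moreover have "K (\<delta> * g (real n)) \<le> a" using \<delta>(1) g_pos[of n] by (intro K_le_a) simp
        ultimately have "T n - a * (real k + 1) \<le> (\<Sum>m<n. K (\<delta> * g (real m))) - a * real k"
          by (simp add: algebra_simps)
        then have "- c * ((\<Sum>m<n. K (\<delta> * g (real m))) - a * real k) \<le> - c * (T n - a * (real k + 1))"
          using c(1) by (intro mult_left_mono_neg) simp_all
        then have "exp (- c * ((\<Sum>m<n. K (\<delta> * g (real m))) - a * real k)) \<le> exp (- c * (T n - a * (real k + 1)))"
          by (simp only: exp_le_cancel_iff)
        also have "\<dots> = exp (c * a * (real k + 1)) * exp (- c * T n)"
          by (simp add: mult_exp_exp algebra_simps)
        finally show "exp (- c * ((\<Sum>m<n. K (\<delta> * g (real m))) - a * real k)) \<le> exp (c * a * (real k + 1)) * exp (- c * T n)" .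
      qed (use g_pos[of n] in simp)
      finally show ?thesis .
    qed
    have "filterlim (\<lambda>n. \<Sum>m<n. K (\<delta> * g (real m))) at_top sequentially"
      using not_summable_scaled[OF div, of \<delta>] K_nonneg by (intro filterlim_sum_at_top) simp_all
    then have "\<forall>\<^sub>F n in sequentially. 2 / c * (c * a * (real k + 1) - ln e) \<le> (\<Sum>m<n. K (\<delta> * g (real m)))"
      unfolding filterlim_at_top by blast
    then have big: "\<forall>\<^sub>F n in sequentially. 2 / c * (c * a * (real k + 1) - ln e) \<le> T n"
    proof (rule eventually_mono)
      fix n assume "2 / c * (c * a * (real k + 1) - ln e) \<le> (\<Sum>m<n. K (\<delta> * g (real m)))"
      also have "\<dots> \<le> T n" using K_nonneg by (simp add: T_def lessThan_Suc_atMost[symmetric])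
      finally show "2 / c * (c * a * (real k + 1) - ln e) \<le> T n" .
    qed
    have "\<exists>\<^sub>F n in sequentially. 2 / c * ln (max (g (real n)) (exp 1)) < T n \<and> 2 / c * (c * a * (real k + 1) - ln e) \<le> T n"
      using frequently_eventually_frequently[OF freq big] .
    then show "\<exists>\<^sub>F n in sequentially. (\<integral>\<^sup>+\<nu>. ?f k n \<nu> \<partial>GW) \<le> ennreal e"
    proof (rule frequently_elim1)
      fix n assume *: "2 / c * ln (max (g (real n)) (exp 1)) < T n \<and> 2 / c * (c * a * (real k + 1) - ln e) \<le> T n"
      have "ln (g (real n)) \<le> ln (max (g (real n)) (exp 1))" using g_pos[of n] by simp
      also have "\<dots> \<le> c * T n / 2" using * c(1) by (simp add: field_simps)
      finally have 1: "ln (g (real n)) \<le> c * T n / 2" .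
      have 2: "c * a * (real k + 1) - ln e \<le> c * T n / 2" using * c(1) by (simp add: field_simps)
      have "exp (c * a * (real k + 1)) * exp (- c * T n) * g (real n) = exp (c * a * (real k + 1) - c * T n + ln (g (real n)))"
        using g_pos[of n] by (simp add: exp_add exp_diff exp_minus field_simps)
      also have "\<dots> \<le> exp (ln e)" using 1 2 by (simp only: exp_le_cancel_iff)
      also have "\<dots> = e" using e by simp
      finally show "(\<integral>\<^sup>+\<nu>. ?f k n \<nu> \<partial>GW) \<le> ennreal e"
        using order_trans[OF le ennreal_leI] by blast
    qed
  qed
  have "AE \<nu> in GW. \<forall>k. liminf (\<lambda>n. ?f k n \<nu>) = 0"
    unfolding AE_all_countable by (intro allI AE_liminf_eq_0[OF meas lim0])
  with AE_regular show ?thesis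
  proof eventually_elim
    case (elim \<nu>)
    note reg = elim(1)
    let ?E = "\<lambda>k. \<Inter>n. path_event \<nu> n (?B k) (\<lambda>_. True)"
    \<comment> \<open>Where \<open>W / g\<close> is eventually below \<open>\<delta>\<close>, the
      sibling sums are eventually at most \<open>a * \<delta> * g\<close>, which explains the factor
      \<open>a\<close> in \<open>?B\<close>.\<close>
    have "thin \<nu> \<subseteq> (\<Union>k. ?E k)"
    proof
      fix x assume "x \<in> thin \<nu>"
      then have x: "x \<in> bdry \<nu>" "(\<lambda>n. pathW \<nu> n x / g (real n)) \<longlonglongrightarrow> 0" by (simp_all add: thin_def)
      have "\<forall>\<^sub>F n in sequentially. pathW \<nu> n x / g (real n) < \<delta>"
        using x(2) \<delta>(1) by (rule order_tendstoD(2))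
      then obtain k where k: "\<And>m. m \<ge> k \<Longrightarrow> pathW \<nu> m x / g (real m) < \<delta>"
        by (auto simp: eventually_sequentially)
      have "pathS \<nu> m x \<in> ?B k m" for m
      proof (cases "m < k")
        case False
        then have "pathW \<nu> m x \<le> \<delta> * g (real m)"
          using k[of m] g_pos[of m] by (simp add: pos_divide_less_eq)
        then have "a * pathW \<nu> m x \<le> a * (\<delta> * g (real m))" using a_pos by (intro mult_left_mono) simp_all
        with pathS_le[OF reg x(1), of m] show ?thesis using False by (simp add: capped_def mult.assoc)
      qed (simp add: capped_def)
      then have "x \<in> ?E k" using x(1) by (simp add: path_event_def bdry_def)
      then show "x \<in> (\<Union>k. ?E k)" by blast
    qed
    then have "hausdorff \<phi> (thin \<nu>) \<le> hausdorff \<phi> (\<Union>k. ?E k)" by (rule hausdorff_mono)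
    also have "\<dots> = 0"
    proof (rule hausdorff_null_UN)
      show "hausdorff \<phi> (?E k) = 0" for k
        by (rule hausdorff_path_events_null) (use elim(2) in blast)
    qed
    finally show ?case by simp
  qed
qed

end

section \<open>From tree space back to the given random variables\<close>

section \<open>Transfer to an arbitrary probability space\<close>

context galton_watson
begin

definition law :: "nat measure" where
  "law = distr M (count_space UNIV) (N [])"

definition family :: "'w \<Rightarrow> nat list \<Rightarrow> nat" where
  "family \<omega> i = N i \<omega>"

lemma measurable_N [measurable]: "N i \<in> M \<rightarrow>\<^sub>M count_space UNIV"
  using indep by (simp add: indep_vars_def)

lemma integral_law: "(\<integral>n. f n \<partial>law) = expectation (\<lambda>\<omega>. f (N [] \<omega>))" for f :: "nat \<Rightarrow> real"
  unfolding law_def by (rule integral_distr) simp_all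

lemma integrable_law: "integrable law f \<longleftrightarrow> integrable M (\<lambda>\<omega>. f (N [] \<omega>))" for f :: "nat \<Rightarrow> real"
  unfolding law_def by (rule integrable_distr_eq) simp_all

sublocale offspring_law law
proof -
  interpret law: prob_space law unfolding law_def by (rule prob_space_distr) simp
  show "offspring_law law"
  proof
    show "sets law = sets (count_space UNIV)" by (simp add: law_def)
    have "integrable M (\<lambda>\<omega>. real (N [] \<omega>))"
      using mean not_integrable_integral_eq[of M "\<lambda>\<omega>. real (N [] \<omega>)"] by auto
    then show "integrable law real" by (simp add: integrable_law)
    show "(\<integral>n. real n \<partial>law) > 1" using mean by (simp add: integral_law)
  qed
qed

lemma offspring_mean_eq: "offspring_mean M N = a"
  by (simp add: offspring_mean_def integral_law)

lemma measurable_family [measurable]: "family \<in> M \<rightarrow>\<^sub>M GW"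
  by (rule measurable_into_GW) (simp add: family_def)

text \<open>Independence is joint over all words, so the whole family has a product law; almost sure
  statements on tree space can then be pulled back along \<open>family\<close>.\<close>

lemma distr_family: "distr M GW family = GW"
proof -
  have "distr M (PiM UNIV (\<lambda>_. count_space UNIV)) (\<lambda>\<omega>. \<lambda>i\<in>UNIV. N i \<omega>) = PiM UNIV (\<lambda>i. distr M (count_space UNIV) (N i))"
    using indep by (subst (asm) indep_vars_iff_distr_eq_PiM') simp_all
  also have "(\<lambda>i. distr M (count_space UNIV) (N i)) = (\<lambda>_. law)"
    unfolding law_def using ident by (intro ext)
  also have "PiM UNIV (\<lambda>_. law) = GW" by (simp add: GW_def)
  also have "(\<lambda>\<omega>. \<lambda>i\<in>UNIV. N i \<omega>) = family"
    by (intro ext) (simp add: family_def)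
  finally have eq: "distr M (PiM UNIV (\<lambda>_. count_space UNIV)) family = GW" .
  have "sets GW = sets (PiM UNIV (\<lambda>_. count_space UNIV))"
    unfolding GW_def by (rule sets_PiM_cong) (simp_all add: sets_p)
  then have "distr M GW family = distr M (PiM UNIV (\<lambda>_. count_space UNIV)) family"
    by (intro distr_cong) simp_all
  with eq show ?thesis by simp
qed

lemma AE_family:
  assumes "AE \<nu> in GW. P \<nu>"
  shows "AE \<omega> in M. P (family \<omega>)"
  by (rule AE_distrD[OF measurable_family]) (unfold distr_family, rule assms)

lemma gw_tree_eq: "gw_tree N i \<omega> = tree (shift i (family \<omega>))"
  by (simp add: gw_tree_def shift_def family_def)

lemma limit_W_eq: "limit_W M N i \<omega> = W (shift i (family \<omega>))"
  unfolding limit_W_def W_def gw_tree_eq offspring_mean_eq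
  by (simp only: generation_def[symmetric] Z_eq_card)

lemma boundary_eq: "boundary N \<omega> = bdry (family \<omega>)"
  by (simp add: boundary_def bdry_def gw_tree_eq)

lemma branching_measure_eq: "branching_measure M N \<omega> = bm (family \<omega>)"
  unfolding branching_measure_def bm_def gw_tree_eq limit_W_eq offspring_mean_eq by simp

text \<open>Layer cake formula: by Fubini, the indicator of \<open>x \<le> u < n\<close> is
  integrated over \<open>u\<close> first, which gives the positive part of
  \<open>n - x\<close>.\<close>

lemma integrated_tail_eq:
  assumes x: "x \<ge> 0"
  shows "integrated_tail M N x = K x"
proof -
  have tail: "measure M {\<omega> \<in> space M. real (N [] \<omega>) > u} = measure law {n. real n > u}" for u
    unfolding law_def by (subst measure_distr) (auto intro!: arg_cong[where f = "measure M"])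
  have pair: "(\<lambda>(u, n). if x \<le> u \<and> u < real n then 1 else 0 :: ennreal) \<in> borel_measurable (lborel \<Otimes>\<^sub>M law)"
  proof -
    have [measurable]: "(\<lambda>z. real (snd z)) \<in> borel_measurable (lborel \<Otimes>\<^sub>M law)"
      by (rule measurable_compose[OF measurable_snd]) (simp add: measurable_p_any)
    show ?thesis unfolding case_prod_beta' by measurable
  qed
  have em: "ennreal (indicator {x..} u * measure law {n. real n > u}) = (\<integral>\<^sup>+n. (if x \<le> u \<and> u < real n then 1 else 0) \<partial>law)" for u
  proof -
    have "(\<integral>\<^sup>+n. (if x \<le> u \<and> u < real n then 1 else 0) \<partial>law) = (\<integral>\<^sup>+n. indicator {x..} u * indicator {n. real n > u} n \<partial>law)"
      by (rule nn_integral_cong) (simp add: indicator_def)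
    also have "\<dots> = indicator {x..} u * emeasure law {n. real n > u}"
      by (subst nn_integral_cmult_indicator) (simp_all add: sets_p)
    finally show ?thesis by (simp add: p.emeasure_eq_measure split: split_indicator)
  qed
  have meas: "(\<lambda>u. indicator {x..} u * measure law {n. real n > u}) \<in> borel_measurable lborel"
  proof -
    have "(\<lambda>u. \<integral>\<^sup>+n. (if x \<le> u \<and> u < real n then 1 else 0) \<partial>law) \<in> borel_measurable lborel"
      using p.borel_measurable_nn_integral[OF pair] by simp
    then have "(\<lambda>u. ennreal (indicator {x..} u * measure law {n. real n > u})) \<in> borel_measurable lborel"
      by (simp only: em)
    then have "(\<lambda>u. enn2real (ennreal (indicator {x..} u * measure law {n. real n > u}))) \<in> borel_measurable lborel"
      by (rule measurable_compose) simp
    then show ?thesis by simp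
  qed
  have "(\<integral>\<^sup>+u. ennreal (indicator {x..} u * measure law {n. real n > u}) \<partial>lborel)
      = (\<integral>\<^sup>+n. \<integral>\<^sup>+u. (if x \<le> u \<and> u < real n then 1 else 0) \<partial>lborel \<partial>law)"
  proof -
    interpret pair_sigma_finite lborel law by unfold_locales
    show ?thesis unfolding em using Fubini'[OF pair] by simp
  qed
  also have "\<dots> = (\<integral>\<^sup>+n. ennreal (real n - x) \<partial>law)"
  proof (rule nn_integral_cong)
    fix n
    have "(\<integral>\<^sup>+u. (if x \<le> u \<and> u < real n then 1 else 0) \<partial>lborel) = (\<integral>\<^sup>+u. indicator {x..<real n} u \<partial>lborel)"
      by (rule nn_integral_cong) (simp add: indicator_def)
    also have "\<dots> = ennreal (real n - x)"
      by (cases "x \<le> real n") (simp_all add: ennreal_neg)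
    finally show "(\<integral>\<^sup>+u. (if x \<le> u \<and> u < real n then 1 else 0) \<partial>lborel) = ennreal (real n - x)" .
  qed
  also have "\<dots> = ennreal (K x)" by (rule nn_integral_K)
  finally have nn: "(\<integral>\<^sup>+u. ennreal (indicator {x..} u * measure law {n. real n > u}) \<partial>lborel) = ennreal (K x)" .
  have "integrated_tail M N x = (\<integral>u. indicator {x..} u * measure law {n. real n > u} \<partial>lborel)"
    unfolding integrated_tail_def set_lebesgue_integral_def tail by simp
  also have "\<dots> = enn2real (\<integral>\<^sup>+u. ennreal (indicator {x..} u * measure law {n. real n > u}) \<partial>lborel)"
    by (rule integral_eq_nn_integral[OF meas]) simp
  also have "\<dots> = K x" unfolding nn by (simp add: K_nonneg)
  finally show ?thesis .
qed

text \<open>\<open>K\<close> and the integrated tail agree at nonnegative arguments, and dominated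
  variation looks at no others.\<close>

lemma dominated_law:
  assumes "dominated_variation (integrated_tail M N)"
  shows "dominated_law law"
proof
  show "integrable law (\<lambda>n. real n * ln (real n))" using log_moment by (simp add: integrable_law)
  have "Liminf at_top (\<lambda>x. ereal (K (2 * x) / K x)) =
      Liminf at_top (\<lambda>x. ereal (integrated_tail M N (2 * x) / integrated_tail M N x))"
  proof (rule Liminf_eq)
    show "\<forall>\<^sub>F x in at_top. ereal (K (2 * x) / K x) = ereal (integrated_tail M N (2 * x) / integrated_tail M N x)"
      by (rule eventually_mono[OF eventually_ge_at_top[of 0]]) (simp add: integrated_tail_eq)
  qed
  moreover have "K x > 0" if "x > 0" for x
  proof -
    have "integrated_tail M N x > 0" using assms that by (simp add: dominated_variation_def)
    then show ?thesis using integrated_tail_eq[of x] that by simp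
  qed
  moreover have "antimono_on {0..} K" by (rule monotone_onI) (rule K_antimono)
  ultimately show "dominated_variation K"
    using assms K_nonneg by (simp add: dominated_variation_def)
qed

end

locale dominated_galton_watson = galton_watson M N
  for M :: "'w measure" and N :: "nat list \<Rightarrow> 'w \<Rightarrow> nat" +
  assumes dominated_tail: "dominated_variation (integrated_tail M N)"
begin

sublocale dominated_law law
  by (rule dominated_law[OF dominated_tail])

lemma gauge: "gauge_rep (offspring_mean M N) g \<phi> \<Longrightarrow> gauge law g \<phi>"
  unfolding offspring_mean_eq by (intro gauge.intro gauge_axioms.intro dominated_law_axioms)

lemma tail_gauge:
  assumes "gauge_rep (offspring_mean M N) g \<phi>"
  shows "integrated_tail M N (g (real n)) = K (g (real n))"
proof -
  interpret gauge law g \<phi> by (rule gauge[OF assms])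
  show ?thesis using g_pos[of n] by (simp add: integrated_tail_eq)
qed

lemma exceptional_set_eq:
  assumes "gauge_rep (offspring_mean M N) g \<phi>"
  shows "exceptional_set M N g \<omega> = gauge.thin law g (family \<omega>)"
proof -
  interpret gauge law g \<phi> by (rule gauge[OF assms])
  show ?thesis
    by (simp add: exceptional_set_def thin_def pathW_def boundary_eq limit_W_eq)
qed

lemma case_i:
  assumes rep: "gauge_rep (offspring_mean M N) g \<phi>"
    and sum: "summable (\<lambda>n. integrated_tail M N (g (real n)))"
    and D: "AE \<omega> in M. D \<omega> \<in> sets borel \<and> D \<omega> \<subseteq> boundary N \<omega> \<and> emeasure (branching_measure M N \<omega>) (D \<omega>) = 0"
  shows "AE \<omega> in M. boundary N \<omega> \<noteq> {} \<longrightarrow>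
    hausdorff \<phi> (boundary N \<omega> - D \<omega>) = \<infinity> \<and> hausdorff \<phi> (boundary N \<omega>) = \<infinity>"
proof -
  interpret gauge law g \<phi> by (rule gauge[OF rep])
  have "summable (\<lambda>n. K (g (real n)))" using sum by (simp add: tail_gauge[OF rep])
  from AE_family[OF convergent_case[OF this]] D show ?thesis
  proof eventually_elim
    case (elim \<omega>)
    show ?case
    proof
      assume ne: "boundary N \<omega> \<noteq> {}"
      then have "hausdorff \<phi> (boundary N \<omega> - D \<omega>) = \<infinity>"
        using elim by (simp add: boundary_eq branching_measure_eq)
      moreover have "hausdorff \<phi> (boundary N \<omega> - D \<omega>) \<le> hausdorff \<phi> (boundary N \<omega>)"
        by (rule hausdorff_mono) blast
      ultimately show "hausdorff \<phi> (boundary N \<omega> - D \<omega>) = \<infinity> \<and> hausdorff \<phi> (boundary N \<omega>) = \<infinity>"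
        by (simp add: top_unique)
    qed
  qed
qed

lemma case_ii:
  assumes rep: "gauge_rep (offspring_mean M N) g \<phi>"
    and div: "\<not> summable (\<lambda>n. integrated_tail M N (g (real n)))"
  shows "AE \<omega> in M. hausdorff \<phi> (boundary N \<omega> - exceptional_set M N g \<omega>) = 0 \<and>
    emeasure (branching_measure M N \<omega>) (exceptional_set M N g \<omega>) = 0"
proof -
  interpret gauge law g \<phi> by (rule gauge[OF rep])
  have "\<not> summable (\<lambda>n. K (g (real n)))" using div by (simp add: tail_gauge[OF rep])
  from AE_family[OF divergent_case[OF this]] show ?thesis
    by (simp add: boundary_eq branching_measure_eq exceptional_set_eq[OF rep])
qed

text \<open>The boundary consists of the thin part, null by the growth condition, and the rest, null
  by divergence of the series.\<close>

lemma case_iii: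
  assumes rep: "gauge_rep (offspring_mean M N) g \<phi>"
    and div: "\<not> summable (\<lambda>n. integrated_tail M N (g (real n)))"
    and lim: "Limsup (at_right 0) (\<lambda>\<delta>. limsup (\<lambda>n.
         ereal ((\<Sum>k\<le>n. integrated_tail M N (\<delta> * g (real k))) / ln (max (g (real n)) (exp 1))))) = \<infinity>"
  shows "AE \<omega> in M. hausdorff \<phi> (boundary N \<omega>) = 0"
proof -
  interpret gauge law g \<phi> by (rule gauge[OF rep])
  have K: "\<not> summable (\<lambda>n. K (g (real n)))" using div by (simp add: tail_gauge[OF rep])
  have "Limsup (at_right 0) (\<lambda>\<delta>. limsup (\<lambda>n.
         ereal ((\<Sum>k\<le>n. K (\<delta> * g (real k))) / ln (max (g (real n)) (exp 1)))))
    = Limsup (at_right 0) (\<lambda>\<delta>. limsup (\<lambda>n.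
         ereal ((\<Sum>k\<le>n. integrated_tail M N (\<delta> * g (real k))) / ln (max (g (real n)) (exp 1)))))"
  proof (rule Limsup_eq, rule eventually_mono[OF eventually_at_right_less])
    fix \<delta> :: real assume "0 < \<delta>"
    then have "integrated_tail M N (\<delta> * g (real k)) = K (\<delta> * g (real k))" for k
      using g_pos[of k] by (intro integrated_tail_eq) simp
    then show "limsup (\<lambda>n. ereal ((\<Sum>k\<le>n. K (\<delta> * g (real k))) / ln (max (g (real n)) (exp 1))))
      = limsup (\<lambda>n. ereal ((\<Sum>k\<le>n. integrated_tail M N (\<delta> * g (real k))) / ln (max (g (real n)) (exp 1))))"
      by simp
  qed
  also note lim
  finally have "AE \<nu> in GW. hausdorff \<phi> (thin \<nu>) = 0" by (rule thin_null[OF K])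
  from AE_family[OF this] AE_family[OF divergent_case[OF K]] show ?thesis
  proof eventually_elim
    case (elim \<omega>)
    then have "hausdorff \<phi> (thin (family \<omega>) \<union> (bdry (family \<omega>) - thin (family \<omega>))) = 0"
      by (intro hausdorff_null_Un) simp_all
    moreover have "thin (family \<omega>) \<union> (bdry (family \<omega>) - thin (family \<omega>)) = bdry (family \<omega>)"
      by (auto simp: thin_def)
    ultimately show ?case by (simp add: boundary_eq)
  qed
qed

text \<open>In the convergent case the Hausdorff measure is infinite on a nonempty boundary. In the
  divergent case absolute continuity applies to the exceptional set, and the whole boundary has
  measure 0. Either way exactness forces an almost surely empty boundary, hence \<open>W = 0\<close>
  almost surely, against \<open>not_AE_W_eq_0\<close>.\<close>

lemma no_exact_gauge:
  assumes rep: "gauge_rep (offspring_mean M N) g \<phi>"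
    and exact: "exact_hausdorff M N \<phi>" and ac: "abs_continuous_hausdorff M N \<phi>"
  shows False
proof -
  interpret gauge law g \<phi> by (rule gauge[OF rep])
  have ex: "AE \<omega> in M. boundary N \<omega> \<noteq> {} \<longrightarrow> 0 < hausdorff \<phi> (boundary N \<omega>) \<and> hausdorff \<phi> (boundary N \<omega>) < \<infinity>"
    using exact by (simp add: exact_hausdorff_def)
  have "AE \<omega> in M. boundary N \<omega> = {}"
  proof (cases "summable (\<lambda>n. integrated_tail M N (g (real n)))")
    case True
    have "AE \<omega> in M. boundary N \<omega> \<noteq> {} \<longrightarrow>
        hausdorff \<phi> (boundary N \<omega> - {}) = \<infinity> \<and> hausdorff \<phi> (boundary N \<omega>) = \<infinity>"
      by (rule case_i[OF rep True]) simp
    with ex show ?thesis by eventually_elim auto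
  next
    case False
    have ac': "AE \<omega> in M. \<forall>A \<in> sets borel. A \<subseteq> boundary N \<omega> \<longrightarrow>
        emeasure (branching_measure M N \<omega>) A = 0 \<longrightarrow> hausdorff \<phi> A = 0"
      using ac by (simp add: abs_continuous_hausdorff_def)
    from ex ac' case_ii[OF rep False] show ?thesis
    proof eventually_elim
      case (elim \<omega>)
      let ?D = "exceptional_set M N g \<omega>"
      have D: "?D \<in> sets borel" "?D \<subseteq> boundary N \<omega>"
        using thin_borel by (simp_all add: exceptional_set_eq[OF rep]) (auto simp: thin_def boundary_eq)
      then have "hausdorff \<phi> ?D = 0" using elim(2,3) by blast
      then have "hausdorff \<phi> (?D \<union> (boundary N \<omega> - ?D)) = 0"
        using elim(3) by (intro hausdorff_null_Un) simp_all
      moreover have "?D \<union> (boundary N \<omega> - ?D) = boundary N \<omega>" using D(2) by blast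
      ultimately show ?case using elim(1) by auto
    qed
  qed
  moreover have "AE \<omega> in M. emeasure (bm (family \<omega>)) (bdry (family \<omega>)) = ennreal (W (family \<omega>)) \<and> W (family \<omega>) \<ge> 0"
  proof (rule AE_family[OF eventually_mono[OF AE_regular]])
    show "emeasure (bm \<nu>) (bdry \<nu>) = ennreal (W \<nu>) \<and> W \<nu> \<ge> 0" if "regular \<nu>" for \<nu>
      using emeasure_bm_bdry[OF that] W_nonneg[OF that] by blast
  qed
  ultimately have "AE \<omega> in M. W (family \<omega>) = 0"
    by eventually_elim (simp add: boundary_eq ennreal_eq_0_iff)
  moreover have "{\<nu> \<in> space GW. W \<nu> = 0} \<in> sets GW" by measurable
  ultimately have "AE \<nu> in distr M GW family. W \<nu> = 0"
    by (subst AE_distr_iff[OF measurable_family]) simp_all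
  then have "AE \<nu> in GW. W \<nu> = 0" unfolding distr_family .
  then show False using not_AE_W_eq_0 by blast
qed

end

theorem theorem1p2:
  fixes M :: "'w measure" and N :: "nat list \<Rightarrow> 'w \<Rightarrow> nat"
  assumes "galton_watson M N"
    and "dominated_variation (integrated_tail M N)"
  shows "(\<nexists>\<phi>. \<phi> \<in> class_Phi (offspring_mean M N) \<and>
            exact_hausdorff M N \<phi> \<and> abs_continuous_hausdorff M N \<phi>) \<and>
    (\<forall>\<phi> g. gauge_rep (offspring_mean M N) g \<phi> \<longrightarrow>
      (summable (\<lambda>n. integrated_tail M N (g (real n))) \<longrightarrow>
        (\<forall>\<Delta>' :: 'w \<Rightarrow> nat stream set.
          (AE \<omega> in M. \<Delta>' \<omega> \<in> sets borel \<and> \<Delta>' \<omega> \<subseteq> boundary N \<omega> \<and>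
             emeasure (branching_measure M N \<omega>) (\<Delta>' \<omega>) = 0) \<longrightarrow>
          (AE \<omega> in M. boundary N \<omega> \<noteq> {} \<longrightarrow>
             hausdorff \<phi> (boundary N \<omega> - \<Delta>' \<omega>) = \<infinity> \<and>
             hausdorff \<phi> (boundary N \<omega>) = \<infinity>))) \<and>
      (\<not> summable (\<lambda>n. integrated_tail M N (g (real n))) \<longrightarrow>
        (AE \<omega> in M. hausdorff \<phi> (boundary N \<omega> - exceptional_set M N g \<omega>) = 0 \<and>
           emeasure (branching_measure M N \<omega>) (exceptional_set M N g \<omega>) = 0)) \<and>
      (\<not> summable (\<lambda>n. integrated_tail M N (g (real n))) \<and>
       Limsup (at_right 0) (\<lambda>\<delta>. limsup (\<lambda>n.
         ereal ((\<Sum>k\<le>n. integrated_tail M N (\<delta> * g (real k))) /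
                ln (max (g (real n)) (exp 1))))) = \<infinity> \<longrightarrow>
        (AE \<omega> in M. hausdorff \<phi> (boundary N \<omega>) = 0)))"
proof -
  interpret dominated_galton_watson M N
    by (intro dominated_galton_watson.intro dominated_galton_watson_axioms.intro assms)
  show ?thesis
  proof (intro conjI allI impI)
    show "\<nexists>\<phi>. \<phi> \<in> class_Phi (offspring_mean M N) \<and> exact_hausdorff M N \<phi> \<and> abs_continuous_hausdorff M N \<phi>"
      unfolding class_Phi_def using no_exact_gauge by blast
  qed ((rule case_i; assumption) | (rule case_ii; assumption) | (elim conjE, rule case_iii; assumption))+
qed

end
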